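(* Let $H\in C^2(\mathbb{R}^d)$ be convex and coercive (i.e. $H(p)\to+\infty$ as $|p|\to\infty$), let $g:\mathbb{T}^d\to\mathbb{R}$ be Lipschitz continuous and semiconcave, and let $F\in C^2(\mathbb{R}^{d}\times\mathbb{R}^d)$ be convex with $F(-p,p)=H(p)$ for every $p\in\mathbb{R}^d$. Let $R>0$ be a constant, and let $\varepsilon=(h,\Delta t)$ be chosen so that the monotonicity condition with constant $R$ holds. Let $u$ be the viscosity solution of $$\partial_t u+H(Du)=0 \ \text{ in } \mathbb{T}^d\times(0,T),\qquad u(\cdot,0)=g \ \text{ on }\mathbb{T}^d ,$$ and let $\{u^\varepsilon_n\}_{n=0}^N$ be the solution of the semi-discrete finite difference scheme. Then for every $p\in[1,+\infty]$ there exists a constant $C>0$, independent of $\varepsilon$, such that $$\sup_{n=0,\dots,N}\big\|u_n^\varepsilon(\cdot)-u(\cdot,n\Delta t)\big\|_{L^p(\mathbb{T}^d)}\le C\,|\varepsilon|^{\frac12+\frac1{2p}},$$ where $1/p=0$ for $p=+\infty$.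
   Context: $\mathbb{T}^d$ is the $d$-dimensional flat torus, identified with $[0,1]^d$ with periodic boundary conditions; $T>0$ is fixed and $e_1,\dots,e_d$ is the standard basis. A function $u:\mathbb{T}^d\to\mathbb{R}$ is semiconcave with constant $C_{conc}>0$ if for all $x_1,x_2\in\mathbb{T}^d$ and $\lambda\in(0,1)$: $u(\lambda x_1+(1-\lambda)x_2)\ge\lambda u(x_1)+(1-\lambda)u(x_2)-\lambda(1-\lambda)C_{conc}|x_1-x_2|^2$. Discretization parameters: a uniform space step $h>0$ and a time step $\Delta t>0$ with $N\Delta t=T$, $N$ a positive integer; $\varepsilon=(h,\Delta t)$ and $|\varepsilon|=h+\Delta t$. Difference operators: $\delta_h^{(i)}v(x)=\frac{v(x+he_i)-v(x)}{h}$, $\delta_{-h}^{(i)}v(x)=\frac{v(x)-v(x-he_i)}{h}$, $\delta_{\pm h}v=(\delta_{\pm h}^{(1)}v,\dots,\delta_{\pm h}^{(d)}v)$. Monotonicity condition with constant $R>0$: $\varepsilon=(h,\Delta t)$ is such that the update operator $$G\big(v(x),\{v(x\pm he_i)\}_{i=1}^d\big):=v(x)-\Delta t\,F\big(-\delta_hv(x),\delta_{-h}v(x)\big)$$ is a nondecreasing function of each of the grid values involved (the central value $v(x)$ and the neighboring values $v(x\pm he_i)$), provided that the absolute value of the discrete slopes $-\delta_hv(x)$ and $\delta_{-h}v(x)$ is bounded by $R$. Semi-discrete finite difference scheme: $u^\varepsilon_0(x)=g(x)$ and $u^\varepsilon_{n+1}(x)-u^\varepsilon_n(x)+\Delta t\,F(-\delta_hu^\varepsilon_n(x),\delta_{-h}u^\varepsilon_n(x))=0$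 for $x\in\mathbb{T}^d$, $n=0,\dots,N-1$.
   Formalization: Adds the assumption that the discrete slopes of the initial datum g at step h are at most R in absolute value (automatic if R is at least the Lipschitz constant of g); for R unrelated to g the claim is false. *)

theory Defs
  imports "HOL-Analysis.Analysis" "HOL-Probability.Essential_Supremum"
begin

section \<open>Functions on the flat torus\<close>

text \<open>
  A function on the torus is represented by its lift to the whole space, that is, by a function
  that is 1-periodic in every coordinate direction; the unit cube is a fundamental domain.
\<close>

definition torus_periodic :: "(real ^ 'd \<Rightarrow> 'b) \<Rightarrow> bool" where
  "torus_periodic v \<longleftrightarrow> (\<forall>x i. v (x + axis i 1) = v x)"

text \<open>
  Since \<open>v\<close> is a lift, \<open>x\<^sub>1\<close> and \<open>x\<^sub>2\<close> range over all representatives of two points of the torus.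
\<close>

definition semiconcave_with :: "real \<Rightarrow> (real ^ 'd \<Rightarrow> real) \<Rightarrow> bool" where
  "semiconcave_with C v \<longleftrightarrow>
     (\<forall>x\<^sub>1 x\<^sub>2. \<forall>l\<in>{0<..<1}.
        v (l *\<^sub>R x\<^sub>1 + (1 - l) *\<^sub>R x\<^sub>2)
          \<ge> l * v x\<^sub>1 + (1 - l) * v x\<^sub>2 - l * (1 - l) * C * (norm (x\<^sub>1 - x\<^sub>2))\<^sup>2)"

text \<open>
  The norm takes the value \<open>\<infinity>\<close> when the integral diverges. The finite case is guarded because
  there is no real power on \<^typ>\<open>ennreal\<close>.
\<close>

definition torus_Lp_norm :: "ereal \<Rightarrow> (real ^ 'd \<Rightarrow> real) \<Rightarrow> ennreal" where
  "torus_Lp_norm p v =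
     (if p = \<infinity> then esssup (lebesgue_on (cbox 0 1)) (\<lambda>x. ennreal \<bar>v x\<bar>)
      else
        let q = real_of_ereal p;
            I = \<integral>\<^sup>+ x. ennreal (\<bar>v x\<bar> powr q) \<partial>lebesgue_on (cbox 0 1)
        in if I = \<infinity> then \<infinity> else ennreal (enn2real I powr (1 / q)))"


section \<open>Twice continuously differentiable functions\<close>

definition C2_fun :: "('a::euclidean_space \<Rightarrow> real) \<Rightarrow> bool" where
  "C2_fun f \<longleftrightarrow>
     (\<exists>(Df :: 'a \<Rightarrow> 'a) (D2f :: 'a \<Rightarrow> 'a \<Rightarrow>\<^sub>L 'a).
        (\<forall>x. GDERIV f x :> Df x) \<and>
        (\<forall>x. (Df has_derivative blinfun_apply (D2f x)) (at x)) \<and>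
        continuous_on UNIV D2f)"


section \<open>Viscosity solutions of the Cauchy problem\<close>

text \<open>
  \<open>D\<phi>\<close> is the space-time gradient of the test function \<open>\<phi>\<close>: \<open>fst (D\<phi> z)\<close> is the gradient in
  space and \<open>snd (D\<phi> z)\<close> the time derivative. Being touched from above or below is a local
  notion, so test functions on the covering space need not be periodic.
\<close>

definition C1_test_fun ::
    "real \<Rightarrow> ((real ^ 'd) \<times> real \<Rightarrow> real) \<Rightarrow> ((real ^ 'd) \<times> real \<Rightarrow> (real ^ 'd) \<times> real) \<Rightarrow> bool" where
  "C1_test_fun T \<phi> D\<phi> \<longleftrightarrow>
     (\<forall>z \<in> UNIV \<times> {0<..<T}. GDERIV \<phi> z :> D\<phi> z) \<and> continuous_on (UNIV \<times> {0<..<T}) D\<phi>"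

definition viscosity_subsolution ::
    "(real ^ 'd \<Rightarrow> real) \<Rightarrow> real \<Rightarrow> ((real ^ 'd) \<times> real \<Rightarrow> real) \<Rightarrow> bool" where
  "viscosity_subsolution H T u \<longleftrightarrow>
     (\<forall>\<phi> D\<phi>. C1_test_fun T \<phi> D\<phi> \<longrightarrow>
        (\<forall>z \<in> UNIV \<times> {0<..<T}.
           (\<forall>\<^sub>F y in nhds z. u y - \<phi> y \<le> u z - \<phi> z) \<longrightarrow>
           snd (D\<phi> z) + H (fst (D\<phi> z)) \<le> 0))"

definition viscosity_supersolution ::
    "(real ^ 'd \<Rightarrow> real) \<Rightarrow> real \<Rightarrow> ((real ^ 'd) \<times> real \<Rightarrow> real) \<Rightarrow> bool" where
  "viscosity_supersolution H T u \<longleftrightarrow>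
     (\<forall>\<phi> D\<phi>. C1_test_fun T \<phi> D\<phi> \<longrightarrow>
        (\<forall>z \<in> UNIV \<times> {0<..<T}.
           (\<forall>\<^sub>F y in nhds z. u y - \<phi> y \<ge> u z - \<phi> z) \<longrightarrow>
           snd (D\<phi> z) + H (fst (D\<phi> z)) \<ge> 0))"

definition viscosity_solution ::
    "(real ^ 'd \<Rightarrow> real) \<Rightarrow> (real ^ 'd \<Rightarrow> real) \<Rightarrow> real \<Rightarrow> ((real ^ 'd) \<times> real \<Rightarrow> real) \<Rightarrow> bool" where
  "viscosity_solution H g T u \<longleftrightarrow>
     (\<forall>t\<in>{0..T}. torus_periodic (\<lambda>x. u (x, t))) \<and>
     continuous_on (UNIV \<times> {0..T}) u \<and>
     viscosity_subsolution H T u \<and> viscosity_supersolution H T u \<and>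
     (\<forall>x. u (x, 0) = g x)"


section \<open>The semi-discrete finite difference scheme\<close>

definition fd_forward :: "real \<Rightarrow> (real ^ 'd \<Rightarrow> real) \<Rightarrow> real ^ 'd \<Rightarrow> real ^ 'd" where
  "fd_forward h v x = (\<chi> i. (v (x + h *\<^sub>R axis i 1) - v x) / h)"

definition fd_backward :: "real \<Rightarrow> (real ^ 'd \<Rightarrow> real) \<Rightarrow> real ^ 'd \<Rightarrow> real ^ 'd" where
  "fd_backward h v x = (\<chi> i. (v x - v (x - h *\<^sub>R axis i 1)) / h)"

primrec fd_scheme ::
    "((real ^ 'd) \<times> (real ^ 'd) \<Rightarrow> real) \<Rightarrow> (real ^ 'd \<Rightarrow> real) \<Rightarrow> real \<Rightarrow> real
       \<Rightarrow> nat \<Rightarrow> real ^ 'd \<Rightarrow> real" where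
  "fd_scheme F g h \<Delta>t 0 = g"
| "fd_scheme F g h \<Delta>t (Suc n) =
     (\<lambda>x. fd_scheme F g h \<Delta>t n x
        - \<Delta>t * F (- fd_forward h (fd_scheme F g h \<Delta>t n) x, fd_backward h (fd_scheme F g h \<Delta>t n) x))"

text \<open>
  The update as a function of the \<open>2 d + 1\<close> grid values, regarded as independent real variables:
  \<open>c\<close> stands for \<open>v x\<close>, \<open>a i\<close> for \<open>v (x + h e\<^sub>i)\<close> and \<open>b i\<close> for \<open>v (x - h e\<^sub>i)\<close>.
\<close>

definition update_op ::
    "((real ^ 'd) \<times> (real ^ 'd) \<Rightarrow> real) \<Rightarrow> real \<Rightarrow> real \<Rightarrow> real \<Rightarrow> ('d \<Rightarrow> real) \<Rightarrow> ('d \<Rightarrow> real) \<Rightarrow> real" where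
  "update_op F h \<Delta>t c a b = c - \<Delta>t * F (- (\<chi> i. (a i - c) / h), \<chi> i. (c - b i) / h)"

definition slopes_bounded ::
    "real \<Rightarrow> real \<Rightarrow> real \<Rightarrow> ('d \<Rightarrow> real) \<Rightarrow> ('d \<Rightarrow> real) \<Rightarrow> bool" where
  "slopes_bounded R h c a b \<longleftrightarrow> (\<forall>i. \<bar>(a i - c) / h\<bar> \<le> R \<and> \<bar>(c - b i) / h\<bar> \<le> R)"

definition monotonicity_condition ::
    "((real ^ 'd) \<times> (real ^ 'd) \<Rightarrow> real) \<Rightarrow> real \<Rightarrow> real \<Rightarrow> real \<Rightarrow> bool" where
  "monotonicity_condition F R h \<Delta>t \<longleftrightarrow>
     (\<forall>a b. mono_on {c. slopes_bounded R h c a b} (\<lambda>c. update_op F h \<Delta>t c a b)) \<and>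
     (\<forall>c a b i. mono_on {s. slopes_bounded R h c (a(i := s)) b}
                        (\<lambda>s. update_op F h \<Delta>t c (a(i := s)) b)) \<and>
     (\<forall>c a b i. mono_on {s. slopes_bounded R h c a (b(i := s))}
                        (\<lambda>s. update_op F h \<Delta>t c a (b(i := s))))"

text \<open>
  The monotonicity condition says nothing about slopes larger than \<open>R\<close>, so it only bears on the
  scheme if the discrete slopes of the initial datum lie in the range \<open>[-R, R]\<close>; monotonicity
  then keeps those of all later iterates in this range. This holds whenever \<open>R\<close> is at least the
  Lipschitz constant of the datum. Forward slopes suffice: a backward slope at \<open>x\<close> is a forward
  slope at \<open>x - h e\<^sub>i\<close>.
\<close>

definition datum_slopes_bounded :: "real \<Rightarrow> real \<Rightarrow> (real ^ 'd \<Rightarrow> real) \<Rightarrow> bool" where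
  "datum_slopes_bounded R h g \<longleftrightarrow> (\<forall>x i. \<bar>fd_forward h g x $ i\<bar> \<le> R)"

end

theory Submission
  imports Defs
begin

text \<open>
  Both norms at the ends of the scale are estimated, \<open>L\<^sup>\<infinity>\<close> at rate \<open>\<epsilon>\<^sup>1\<^sup>/\<^sup>2\<close> and \<open>L\<^sup>1\<close> at rate \<open>\<epsilon>\<close>, and the
  \<open>L\<^sup>p\<close> estimate follows by interpolation (\<open>torus_Lp_norm_le\<close>). Everything takes place on the level of
  schemes; no representation formula for \<open>u\<close> is used.

  The numerical Hamiltonian is evaluated at a vector of \<open>2 d\<close> slopes, one for each neighbour. The
  monotonicity condition says that the gradient of \<open>F\<close> is nonnegative on the box of slopes of size
  \<open>R\<close>, and that \<open>\<Delta>t / h\<close> times the sum of its entries is at most one there (\<open>monotone_schemeI\<close>).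
  Only the ratio \<open>\<Delta>t / h\<close> enters, so the scheme may be refined by halving both steps. A monotone
  step commutes with translations and constants, so it preserves bounds on difference
  quotients, and as \<open>F\<close> is convex it also preserves semiconcavity (\<open>step_admissible\<close>).

  The \<open>L\<^sup>\<infinity>\<close> estimate is the comparison argument of Crandall and Lions: variables are doubled between the
  viscosity solution and the scheme (\<open>subsolution_le_scheme\<close>). It identifies \<open>u\<close> as the limit of
  the refined schemes.

  For the \<open>L\<^sup>1\<close> estimate two facts are combined. First, the scheme exceeds \<open>u\<close> by at most a multiple of
  \<open>h\<close>. By convexity a step is a minimum over averages, and two half steps move to midpoints of
  points reached by one full step, where a semiconcave function is larger than the
  average (\<open>two_half_steps_ge\<close>); hence refining the scheme lowers it by at most \<open>C h\<close>. Second, the mean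
  of \<open>u - u\<^sup>\<epsilon>\<close> is at most of order \<open>\<epsilon>\<close>. Its growth over one step is \<open>\<Delta>t\<close> times the mean of
  \<open>H (Du\<^sup>\<epsilon>) - H (Du)\<close>, which convexity bounds by the mean of \<open>DH (Du\<^sup>\<epsilon>) \<cdot> D(u\<^sup>\<epsilon> - u)\<close>, and an integration by
  parts turns this into the mean of \<open>(u - u\<^sup>\<epsilon>) div (DH (Du\<^sup>\<epsilon>))\<close>. Semiconcavity bounds the divergence from
  above only (\<open>divergence_le\<close>), which suffices because \<open>u - u\<^sup>\<epsilon>\<close> is almost nonnegative by the first fact.
  To make sense of the divergence, \<open>u\<^sup>\<epsilon>\<close> is mollified at scale \<open>h\<close>; the replacement costs \<open>O(h)\<close> in
  the mean (\<open>flux_consistency\<close>), and \<open>u\<close> itself is approximated by refined schemes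
  (\<open>flux_lower_bound\<close>, \<open>solution_mean_decrease\<close>). A discrete Gronwall argument closes the
  estimate (\<open>mean_error\<close>). A function that is almost nonnegative and has a small mean is small in \<open>L\<^sup>1\<close>.

  All this requires that the slopes of the datum are at most \<open>R\<close> at every scale. If they are not,
  the slope condition on the datum fails for all small \<open>h\<close>, and for \<open>h\<close> bounded away from zero the estimate
  only says that the error is bounded (\<open>scheme_error_bounds\<close>).
\<close>

section \<open>Slopes and the step operator\<close>

lemma Basis_pair_cases:
  fixes l :: "(real ^ 'd) \<times> (real ^ 'd)"
  assumes "l \<in> Basis"
  obtains (left) i where "l = (axis i 1, 0)" | (right) i where "l = (0, axis i 1)"
  using assms by (auto simp: Basis_prod_def Basis_vec_def)

text \<open>Basis vectors \<open>l\<close> of the slope space enumerate the neighbours of a node: the slope component \<open>l\<close>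
  belongs to the neighbour in direction \<open>dir l\<close>, which is \<open>e\<^sub>i\<close> in the first factor and \<open>- e\<^sub>i\<close> in the
  second. With this convention forward and backward slopes obey the same formula, with the sign in
  which the scheme is nondecreasing in all neighbours.\<close>

definition dir :: "(real ^ 'd) \<times> (real ^ 'd) \<Rightarrow> real ^ 'd" where
  "dir l = fst l - snd l"

lemma norm_dir: "l \<in> Basis \<Longrightarrow> norm (dir l) = 1"
  by (erule Basis_pair_cases) (auto simp: dir_def)

definition slopes :: "real \<Rightarrow> (real ^ 'd \<Rightarrow> real) \<Rightarrow> real ^ 'd \<Rightarrow> (real ^ 'd) \<times> (real ^ 'd)" where
  "slopes h v x = (- fd_forward h v x, fd_backward h v x)"

lemma slopes_inner:
  assumes "l \<in> Basis"
  shows "slopes h v x \<bullet> l = (v x - v (x + h *\<^sub>R dir l)) / h"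
  using assms
proof (cases rule: Basis_pair_cases)
  case (left i)
  then show ?thesis
    by (simp add: slopes_def fd_forward_def dir_def inner_axis minus_divide_left)
next
  case (right i)
  then show ?thesis
    by (simp add: slopes_def fd_backward_def dir_def inner_axis)
qed

lemma inner_slopes:
  "a \<bullet> slopes h v x = (\<Sum>l\<in>Basis. (a \<bullet> l) * ((v x - v (x + h *\<^sub>R dir l)) / h))"
  by (subst euclidean_inner) (simp add: slopes_inner)

lemma slopes_add_const: "slopes h (\<lambda>y. v y + K) x = slopes h v x"
  by (simp add: slopes_def fd_forward_def fd_backward_def)

lemma slopes_shift: "slopes h (\<lambda>y. v (y + a)) x = slopes h v (x + a)"
  by (simp add: slopes_def fd_forward_def fd_backward_def algebra_simps)

lemma slopes_minus: "slopes h (\<lambda>y. - v y) x = - slopes h v x"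
  by (rule euclidean_eqI) (simp add: slopes_inner diff_divide_distrib)

lemma slopes_diff: "slopes h (\<lambda>y. v y - w y) x = slopes h v x - slopes h w x"
  by (rule euclidean_eqI) (simp add: slopes_inner inner_diff_left diff_divide_distrib)

lemma slopes_average:
  "slopes h (\<lambda>y. (v y + w y) / 2) x = (1/2) *\<^sub>R slopes h v x + (1/2) *\<^sub>R slopes h w x"
  by (rule euclidean_eqI)
     (simp add: slopes_inner inner_add_left diff_divide_distrib add_divide_distrib mult.commute)

definition fd_step ::
    "((real ^ 'd) \<times> (real ^ 'd) \<Rightarrow> real) \<Rightarrow> real \<Rightarrow> real \<Rightarrow> (real ^ 'd \<Rightarrow> real) \<Rightarrow> real ^ 'd \<Rightarrow> real" where
  "fd_step F h \<tau> v x = v x - \<tau> * F (slopes h v x)"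

lemma fd_scheme_Suc: "fd_scheme F g h \<tau> (Suc n) = fd_step F h \<tau> (fd_scheme F g h \<tau> n)"
  by (simp add: fd_step_def slopes_def fun_eq_iff)

lemma fd_step_add_const: "fd_step F h \<tau> (\<lambda>y. v y + K) x = fd_step F h \<tau> v x + K"
  by (simp add: fd_step_def slopes_add_const)

lemma fd_step_shift: "fd_step F h \<tau> (\<lambda>y. v (y + a)) x = fd_step F h \<tau> v (x + a)"
  by (simp add: fd_step_def slopes_shift)

definition slope_box :: "real \<Rightarrow> ((real ^ 'd) \<times> (real ^ 'd)) set" where
  "slope_box R = cbox (- R *\<^sub>R One) (R *\<^sub>R One)"

lemma mem_slope_box: "q \<in> slope_box R \<longleftrightarrow> (\<forall>l\<in>Basis. \<bar>q \<bullet> l\<bar> \<le> R)"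
  by (simp add: slope_box_def mem_box abs_le_iff ball_conj_distrib minus_le_iff) blast

lemma compact_slope_box: "compact (slope_box R)"
  and convex_slope_box: "convex (slope_box R)"
  by (simp_all add: slope_box_def)

lemma zero_in_slope_box: "0 \<le> R \<Longrightarrow> 0 \<in> slope_box R"
  by (simp add: mem_slope_box)

text \<open>Bounds on difference quotients in the coordinate directions at all scales are what a monotone
  step preserves; they hold with the constant \<open>R\<close> of the slope box itself, whereas a Lipschitz
  constant with respect to the norm would lose a dimensional factor.\<close>

definition coord_lipschitz :: "real \<Rightarrow> (real ^ 'd \<Rightarrow> real) \<Rightarrow> bool" where
  "coord_lipschitz R v \<longleftrightarrow> (\<forall>x i s. \<bar>v (x + s *\<^sub>R axis i 1) - v x\<bar> \<le> R * \<bar>s\<bar>)"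

text \<open>Second differences, unlike the general inequality with weights \<open>\<lambda>\<close> and \<open>1 - \<lambda>\<close>, involve only
  an average of two translates, with which a step is easily compared.\<close>

definition midpoint_semiconcave :: "real \<Rightarrow> (real ^ 'd \<Rightarrow> real) \<Rightarrow> bool" where
  "midpoint_semiconcave c v \<longleftrightarrow> (\<forall>x y. v (x + y) + v (x - y) \<le> 2 * v x + 2 * c * (norm y)\<^sup>2)"

lemma semiconcave_with_imp_midpoint:
  assumes "semiconcave_with c v"
  shows "midpoint_semiconcave c v"
  unfolding midpoint_semiconcave_def
proof (intro allI)
  fix x y
  have "v ((1/2) *\<^sub>R (x + y) + (1 - 1/2) *\<^sub>R (x - y)) \<ge> (1/2) * v (x + y) + (1 - 1/2) * v (x - y)
      - (1/2) * (1 - 1/2) * c * (norm ((x + y) - (x - y)))\<^sup>2"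
    using assms[unfolded semiconcave_with_def, rule_format, of "1/2" "x + y" "x - y"] by simp
  moreover have "(1/2) *\<^sub>R (x + y) + (1 - 1/2) *\<^sub>R (x - y) = x"
    by (simp add: algebra_simps flip: scaleR_add_left)
  moreover have "norm ((x + y) - (x - y)) = 2 * norm y"
  proof -
    have "(x + y) - (x - y) = 2 *\<^sub>R y" by (simp add: scaleR_2)
    then show ?thesis by simp
  qed
  ultimately show "v (x + y) + v (x - y) \<le> 2 * v x + 2 * c * (norm y)\<^sup>2"
    by (simp add: power_mult_distrib)
qed

lemma coord_lipschitz_dir:
  assumes "coord_lipschitz R v" "l \<in> Basis"
  shows "\<bar>v (x + s *\<^sub>R dir l) - v x\<bar> \<le> R * \<bar>s\<bar>"
  using assms(2)
proof (cases rule: Basis_pair_cases)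
  case (left i)
  then show ?thesis using assms(1) by (simp add: dir_def coord_lipschitz_def)
next
  case (right i)
  have "\<bar>v (x + (-s) *\<^sub>R axis i 1) - v x\<bar> \<le> R * \<bar>-s\<bar>"
    using assms(1) unfolding coord_lipschitz_def by blast
  then show ?thesis using right by (simp add: dir_def)
qed

lemma coord_lipschitz_slopes:
  fixes v :: "real ^ 'd \<Rightarrow> real"
  assumes "coord_lipschitz R v" "0 < h"
  shows "slopes h v x \<in> slope_box R"
  unfolding mem_slope_box
proof
  fix l :: "(real ^ 'd) \<times> (real ^ 'd)" assume l: "l \<in> Basis"
  have "\<bar>v (x + h *\<^sub>R dir l) - v x\<bar> \<le> R * \<bar>h\<bar>"
    by (rule coord_lipschitz_dir[OF assms(1) l])
  then show "\<bar>slopes h v x \<bullet> l\<bar> \<le> R"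
    using l assms(2) by (simp add: slopes_inner abs_minus_commute divide_le_eq)
qed

lemma coord_lipschitz_l1:
  assumes "coord_lipschitz R v"
  shows "\<bar>v (x + y) - v x\<bar> \<le> R * (\<Sum>i\<in>UNIV. \<bar>y $ i\<bar>)"
proof -
  have *: "\<bar>v (x + (\<Sum>i\<in>S. (y $ i) *\<^sub>R axis i 1)) - v x\<bar> \<le> R * (\<Sum>i\<in>S. \<bar>y $ i\<bar>)"
    if "finite S" for S
    using that
  proof (induction S)
    case (insert i S)
    let ?z = "x + (\<Sum>i\<in>S. (y $ i) *\<^sub>R axis i 1)"
    have "\<bar>v (?z + (y $ i) *\<^sub>R axis i 1) - v ?z\<bar> \<le> R * \<bar>y $ i\<bar>"
      using assms unfolding coord_lipschitz_def by blast
    moreover have "x + (\<Sum>i\<in>insert i S. (y $ i) *\<^sub>R axis i 1) = ?z + (y $ i) *\<^sub>R axis i 1"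
      using insert by (simp add: algebra_simps)
    ultimately show ?case using insert by (simp add: algebra_simps)
  qed simp
  have "(\<Sum>i\<in>UNIV. (y $ i) *\<^sub>R axis i 1) = y"
    by (metis basis_expansion scalar_mult_eq_scaleR)
  then show ?thesis using *[of UNIV] by simp
qed

lemma coord_lipschitz_norm:
  fixes v :: "real ^ 'd \<Rightarrow> real"
  assumes "coord_lipschitz R v"
  shows "\<bar>v x - v y\<bar> \<le> R * real CARD('d) * norm (x - y)"
proof -
  have "0 \<le> R"
    using assms[unfolded coord_lipschitz_def, rule_format, of 0 1 undefined] by linarith
  have "\<bar>v (y + (x - y)) - v y\<bar> \<le> R * (\<Sum>i\<in>UNIV. \<bar>(x - y) $ i\<bar>)"
    by (rule coord_lipschitz_l1[OF assms])
  also have "\<dots> \<le> R * (\<Sum>i\<in>(UNIV::'d set). norm (x - y))"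
    using \<open>0 \<le> R\<close> by (intro mult_left_mono sum_mono component_le_norm_cart) auto
  finally show ?thesis by (simp add: mult.assoc)
qed

lemma coord_lipschitz_continuous:
  assumes "coord_lipschitz R v"
  shows "continuous_on UNIV v"
proof -
  have R: "0 \<le> R"
    using assms[unfolded coord_lipschitz_def, rule_format, of 0 1 undefined] by linarith
  have "(R * real CARD('a))-lipschitz_on UNIV v"
    using coord_lipschitz_norm[OF assms] R by (intro lipschitz_onI) (auto simp: dist_norm)
  then show ?thesis by (rule lipschitz_on_continuous_on)
qed

section \<open>Periodic functions and their means\<close>

lemma torus_periodicD: "torus_periodic v \<Longrightarrow> v (x + axis i 1) = v x"
  by (simp add: torus_periodic_def)

lemma torus_periodic_of_int:
  assumes "torus_periodic v"
  shows "v (x + of_int k *\<^sub>R axis i 1) = v x"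
proof (induction k rule: int_induct[where k=0])
  case (step1 k)
  have "x + of_int (k + 1) *\<^sub>R axis i 1 = (x + of_int k *\<^sub>R axis i 1) + axis i 1"
    by (simp add: algebra_simps)
  then show ?case using step1 torus_periodicD[OF assms] by metis
next
  case (step2 k)
  have "x + of_int k *\<^sub>R axis i 1 = (x + of_int (k - 1) *\<^sub>R axis i 1) + axis i 1"
    by (simp add: algebra_simps)
  then show ?case using step2 torus_periodicD[OF assms] by metis
qed simp

lemma sum_axis: "(\<Sum>i\<in>UNIV. (y $ i) *\<^sub>R axis i 1) = (y :: real ^ 'd)"
  by (metis basis_expansion scalar_mult_eq_scaleR)

lemma torus_periodic_lattice:
  fixes z :: "real ^ 'd"
  assumes "torus_periodic v" "\<And>i. z $ i \<in> \<int>"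
  shows "v (x + z) = v x"
proof -
  have "v (x + (\<Sum>i\<in>S. (z $ i) *\<^sub>R axis i 1)) = v x" if "finite S" for S
    using that
  proof (induction S)
    case (insert i S)
    obtain k where k: "z $ i = of_int k" using assms(2) Ints_cases by metis
    have "x + (\<Sum>i\<in>insert i S. (z $ i) *\<^sub>R axis i 1)
        = (x + (\<Sum>i\<in>S. (z $ i) *\<^sub>R axis i 1)) + of_int k *\<^sub>R axis i 1"
      using insert k by (simp add: algebra_simps)
    then show ?case using insert by (simp only: torus_periodic_of_int[OF assms(1)])
  qed simp
  from this[of UNIV] show ?thesis by (simp add: sum_axis)
qed

lemma lattice_translate_to_cell:
  obtains z where "\<And>i. z $ i \<in> \<int>" "(x :: real ^ 'd) + z \<in> cbox 0 1"
proof -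
  define z :: "real ^ 'd" where "z = (\<chi> i. - of_int \<lfloor>x $ i\<rfloor>)"
  have "z $ i \<in> \<int>" for i by (simp add: z_def)
  moreover have "0 \<le> (x + z) $ i \<and> (x + z) $ i \<le> 1" for i
    unfolding z_def by simp linarith
  then have "x + z \<in> cbox 0 1" by (simp add: mem_box_cart)
  ultimately show thesis using that by blast
qed

lemma torus_periodic_bounded:
  fixes v :: "real ^ 'd \<Rightarrow> 'b::real_normed_vector"
  assumes "torus_periodic v" "continuous_on UNIV v"
  obtains B where "0 \<le> B" "\<And>x. norm (v x) \<le> B"
proof -
  have "bounded (v ` cbox 0 1)"
    by (intro compact_imp_bounded compact_continuous_image continuous_on_subset[OF assms(2)]) auto
  then obtain B where B: "\<And>x. x \<in> cbox 0 1 \<Longrightarrow> norm (v x) \<le> B"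
    unfolding bounded_iff by blast
  have "norm (v x) \<le> B" for x
  proof -
    obtain z where "\<And>i. z $ i \<in> \<int>" "x + z \<in> cbox 0 1"
      using lattice_translate_to_cell by blast
    then show ?thesis using B torus_periodic_lattice[OF assms(1)] by metis
  qed
  moreover then have "0 \<le> B" using norm_ge_zero order_trans by blast
  ultimately show thesis using that by blast
qed

lemma torus_periodic_uniformly_continuous:
  fixes v :: "real ^ 'd \<Rightarrow> 'b::real_normed_vector"
  assumes "torus_periodic v" "continuous_on UNIV v" "0 < e"
  obtains r where "0 < r" "\<And>x y. norm (y - x) < r \<Longrightarrow> norm (v y - v x) < e"
proof -
  let ?K = "{x + y |x y. x \<in> cbox 0 (1 :: real ^ 'd) \<and> y \<in> cball 0 1}"
  have "compact ?K" by (intro compact_sums) auto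
  then have "uniformly_continuous_on ?K v"
    using continuous_on_subset[OF assms(2)] by (intro compact_uniformly_continuous) auto
  from this[unfolded uniformly_continuous_on_def, rule_format, OF assms(3)]
  obtain r where r: "0 < r"
      "\<forall>x\<in>?K. \<forall>y\<in>?K. dist y x < r \<longrightarrow> dist (v y) (v x) < e"
    by blast
  have "norm (v y - v x) < e" if xy: "norm (y - x) < min r 1" for x y
  proof -
    obtain z where z: "\<And>i. z $ i \<in> \<int>" "x + z \<in> cbox 0 1"
      using lattice_translate_to_cell by blast
    have "x + z \<in> ?K" using z by (intro CollectI exI[of _ "x + z"] exI[of _ 0]) auto
    moreover have "y + z \<in> ?K"
      using z xy by (intro CollectI exI[of _ "x + z"] exI[of _ "y - x"]) auto
    ultimately have "dist (v (y + z)) (v (x + z)) < e"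
      using xy r(2) by (simp add: dist_norm)
    then show ?thesis using torus_periodic_lattice[OF assms(1) z(1)] by (simp add: dist_norm)
  qed
  then show thesis using r(1) by (intro that[of "min r 1"]) auto
qed

lemma integral_cbox_split:
  fixes f :: "real ^ 'd \<Rightarrow> real"
  assumes "continuous_on UNIV f"
  shows "integral (cbox a b) f
    = integral (cbox a b \<inter> {x. x $ k \<le> s}) f + integral (cbox a b \<inter> {x. s \<le> x $ k}) f"
proof -
  have f: "f integrable_on cbox a b"
    by (intro integrable_continuous continuous_on_subset[OF assms]) auto
  have k: "axis k (1::real) \<in> Basis" by (simp add: axis_in_Basis_iff)
  have "(f has_integral (integral (cbox a b \<inter> {x. x \<bullet> axis k 1 \<le> s}) f
       + integral (cbox a b \<inter> {x. s \<le> x \<bullet> axis k 1}) f)) (cbox a b)"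
    by (rule has_integral_split[OF _ _ k])
       (use integrable_split[OF f k] in \<open>auto intro: integrable_integral\<close>)
  from integral_unique[OF this] show ?thesis by (simp add: inner_axis)
qed

text \<open>The cell and its translate by \<open>s e\<^sub>k\<close> share a box; what remains of either is a slab, and the
  two slabs differ by the period \<open>e\<^sub>k\<close>.\<close>

lemma integral_cell_shift_small:
  fixes v :: "real ^ 'd \<Rightarrow> real"
  assumes per: "torus_periodic v" and cont: "continuous_on UNIV v" and s: "0 \<le> s" "s \<le> 1"
  shows "integral (cbox 0 1) (\<lambda>x. v (x + s *\<^sub>R axis k 1)) = integral (cbox 0 1) v"
proof -
  let ?a = "s *\<^sub>R axis k 1 :: real ^ 'd"
  let ?C = "cbox 0 (1 + (s - 1) *\<^sub>R axis k 1) :: (real ^ 'd) set"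
  have comp: "(t *\<^sub>R axis k (1::real)) $ i = (if i = k then t else 0)" for t :: real and i :: 'd
    by (simp add: axis_def)
  have comp0: "i \<noteq> k \<Longrightarrow> axis k (1::real) $ i = 0" for i
    by (simp add: axis_def)
  have comp1: "axis k (1::real) $ i = (if i = k then 1 else 0)" for i
    by (simp add: axis_def)
  have box: "x \<in> cbox l u \<longleftrightarrow>
      l $ k \<le> x $ k \<and> x $ k \<le> u $ k \<and> (\<forall>i. i \<noteq> k \<longrightarrow> l $ i \<le> x $ i \<and> x $ i \<le> u $ i)"
    for x l u :: "real ^ 'd"
    unfolding mem_box_cart by metis
  have "integral (cbox 0 1) (\<lambda>x. v (x + ?a)) = integral (cbox ?a (1 + ?a)) v"
    using integral_shift_cbox[of ?a ?a "1 + ?a" v] by simp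
  also have "\<dots> = integral (cbox ?a (1 + ?a) \<inter> {x. x $ k \<le> 1}) v
      + integral (cbox ?a (1 + ?a) \<inter> {x. 1 \<le> x $ k}) v"
    by (rule integral_cbox_split[OF cont])
  also have "cbox ?a (1 + ?a) \<inter> {x. x $ k \<le> 1} = cbox ?a 1"
    using s by (auto simp: box comp comp0)
  also have "cbox ?a (1 + ?a) \<inter> {x. 1 \<le> x $ k} = cbox (axis k 1) (1 + ?a)"
    using s by (auto simp: box comp comp1 comp0)
  also have "integral (cbox (axis k 1) (1 + ?a)) v = integral ?C (\<lambda>x. v (x + axis k 1))"
    using integral_shift_cbox[of "axis k 1" "axis k 1" "1 + ?a" v] by (simp add: algebra_simps)
  also have "(\<lambda>x. v (x + axis k 1)) = v" using torus_periodicD[OF per] by auto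
  also have "?C = cbox 0 1 \<inter> {x. x $ k \<le> s}"
    using s by (auto simp: box comp comp0)
  also have "cbox ?a 1 = cbox 0 1 \<inter> {x. s \<le> x $ k}"
    using s by (auto simp: box comp comp0)
  also have "integral (cbox 0 1 \<inter> {x. s \<le> x $ k}) v + integral (cbox 0 1 \<inter> {x. x $ k \<le> s}) v
      = integral (cbox 0 1) v"
    using integral_cbox_split[OF cont, of 0 1 k s] by simp
  finally show ?thesis .
qed

lemma torus_periodic_shift:
  assumes "torus_periodic v"
  shows "torus_periodic (\<lambda>x. v (x + a))"
  unfolding torus_periodic_def
proof (intro allI)
  fix x i
  have "x + axis i 1 + a = (x + a) + axis i 1" by simp
  then show "v (x + axis i 1 + a) = v (x + a)" using torus_periodicD[OF assms] by metis
qed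

lemma continuous_on_shift:
  "continuous_on UNIV v \<Longrightarrow> continuous_on UNIV (\<lambda>x :: real ^ 'd. v (x + a))"
  by (rule continuous_on_compose2[of UNIV v]) (auto intro: continuous_intros)

lemma integral_cell_shift:
  fixes v :: "real ^ 'd \<Rightarrow> real"
  assumes per: "torus_periodic v" and cont: "continuous_on UNIV v"
  shows "integral (cbox 0 1) (\<lambda>x. v (x + a)) = integral (cbox 0 1) v"
proof -
  have axis: "integral (cbox 0 1) (\<lambda>x. w (x + s *\<^sub>R axis k 1)) = integral (cbox 0 1) w"
    if w: "torus_periodic w" "continuous_on UNIV w" for w :: "real ^ 'd \<Rightarrow> real" and s k
  proof -
    have "x + s *\<^sub>R axis k 1 = (x + frac s *\<^sub>R axis k 1) + of_int \<lfloor>s\<rfloor> *\<^sub>R axis k 1" for x :: "real ^ 'd"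
      by (simp add: frac_def algebra_simps)
    then have "(\<lambda>x. w (x + s *\<^sub>R axis k 1)) = (\<lambda>x. w (x + frac s *\<^sub>R axis k 1))"
      using torus_periodic_of_int[OF w(1)] by metis
    then show ?thesis
      using integral_cell_shift_small[OF w, of "frac s" k]
      by (simp add: frac_ge_0 frac_lt_1 less_imp_le)
  qed
  have "integral (cbox 0 1) (\<lambda>x. v (x + (\<Sum>i\<in>S. (a $ i) *\<^sub>R axis i 1))) = integral (cbox 0 1) v"
    if "finite S" for S
    using that
  proof (induction S)
    case (insert i S)
    let ?b = "\<Sum>i\<in>S. (a $ i) *\<^sub>R axis i 1"
    have "integral (cbox 0 1) (\<lambda>x. v ((x + (a $ i) *\<^sub>R axis i 1) + ?b))
        = integral (cbox 0 1) (\<lambda>x. v (x + ?b))"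
      by (rule axis[OF torus_periodic_shift[OF per] continuous_on_shift[OF cont]])
    then show ?case using insert by (simp add: add.assoc)
  qed simp
  from this[of UNIV] show ?thesis by (simp add: sum_axis)
qed

lemma continuous_on_cell:
  fixes f :: "real ^ 'd \<Rightarrow> real"
  shows "continuous_on UNIV f \<Longrightarrow> f integrable_on cbox 0 1"
  by (rule integrable_continuous, rule continuous_on_subset) auto

lemma content_cell: "measure lborel (cbox 0 (1 :: real ^ 'd)) = 1"
proof -
  have "0 \<in> cbox 0 (1 :: real ^ 'd)" by (simp add: mem_box_cart)
  then have "cbox 0 (1 :: real ^ 'd) \<noteq> {}" by blast
  from content_cbox_cart[OF this] show ?thesis by simp
qed

lemma integral_cell_const: "integral (cbox 0 (1 :: real ^ 'd)) (\<lambda>_. c) = (c :: real)"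
  by (simp add: content_cell)

lemma integral_cell_le:
  fixes f g :: "real ^ 'd \<Rightarrow> real"
  assumes "continuous_on UNIV f" "continuous_on UNIV g" "\<And>x. f x \<le> g x"
  shows "integral (cbox 0 1) f \<le> integral (cbox 0 1) g"
  using assms by (intro integral_le continuous_on_cell) auto

text \<open>This turns one-sided bounds into \<open>L\<^sup>1\<close> bounds: differences of translates have mean zero, and
  semiconcavity bounds second differences from above.\<close>

lemma integral_cell_abs_le:
  fixes f :: "real ^ 'd \<Rightarrow> real"
  assumes "continuous_on UNIV f" "\<And>x. - K \<le> f x" "0 \<le> K"
  shows "integral (cbox 0 1) (\<lambda>x. \<bar>f x\<bar>) \<le> integral (cbox 0 1) f + 2 * K"
proof -
  have "integral (cbox 0 1) (\<lambda>x. \<bar>f x\<bar>) \<le> integral (cbox 0 1) (\<lambda>x. f x + 2 * K)"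
  proof (intro integral_cell_le continuous_intros assms(1))
    show "\<bar>f x\<bar> \<le> f x + 2 * K" for x using assms(2)[of x] assms(3) by linarith
  qed
  also have "\<dots> = integral (cbox 0 1) f + 2 * K"
    using integral_add[OF continuous_on_cell[OF assms(1)] continuous_on_cell[of "\<lambda>_. 2 * K"]]
    by (simp add: content_cell)
  finally show ?thesis .
qed

section \<open>Monotone steps and refinement\<close>

lemma nonneg_derivative_at_right:
  fixes f :: "real \<Rightarrow> real"
  assumes "(f has_real_derivative D) (at 0)" "0 < e" "\<And>t. 0 < t \<Longrightarrow> t < e \<Longrightarrow> f 0 \<le> f t"
  shows "0 \<le> D"
proof (rule ccontr)
  assume "\<not> 0 \<le> D"
  then obtain r where r: "0 < r" "\<And>t. 0 < t \<Longrightarrow> t < r \<Longrightarrow> f (0 + t) < f 0"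
    using DERIV_neg_dec_right[OF assms(1)] by auto
  have "0 < min r e / 2" "min r e / 2 < r" "min r e / 2 < e" using r(1) assms(2) by auto
  then show False using r(2)[of "min r e / 2"] assms(3)[of "min r e / 2"] by auto
qed

lemma GDERIV_line:
  assumes "GDERIV F z :> D"
  shows "((\<lambda>t. F (z + t *\<^sub>R d)) has_real_derivative D \<bullet> d) (at 0)"
proof -
  have "(F has_derivative (\<lambda>h. h \<bullet> D)) (at (z + 0 *\<^sub>R d))" using assms by (simp add: gderiv_def)
  moreover have "((\<lambda>t. z + t *\<^sub>R d) has_derivative (\<lambda>t. t *\<^sub>R d)) (at 0)"
    by (auto intro!: derivative_eq_intros)
  ultimately have "((\<lambda>t. F (z + t *\<^sub>R d)) has_derivative (\<lambda>t. (t *\<^sub>R d) \<bullet> D)) (at 0)"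
    using has_derivative_compose by fastforce
  then show ?thesis
    by (simp add: has_field_derivative_def inner_commute mult_commute_abs)
qed

text \<open>The difference quotient of \<open>F\<close> along the segment from \<open>x\<close> to \<open>y\<close> is at most \<open>F y - F x\<close>, and its limit
  is the directional derivative.\<close>

lemma convex_gradient_inequality:
  assumes "convex_on UNIV F" "GDERIV F x :> D"
  shows "F x + D \<bullet> (y - x) \<le> F y"
proof -
  let ?f = "\<lambda>t. t * (F y - F x) - F (x + t *\<^sub>R (y - x))"
  have d: "(?f has_real_derivative (F y - F x - D \<bullet> (y - x))) (at 0)"
  proof -
    have "((\<lambda>t. t * (F y - F x)) has_real_derivative (F y - F x)) (at 0)"
      by (auto intro!: derivative_eq_intros)
    from DERIV_diff[OF this GDERIV_line[OF assms(2), of "y - x"]] show ?thesis .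
  qed
  have le: "?f 0 \<le> ?f t" if t: "0 < t" "t < 1" for t
  proof -
    have "F ((1 - t) *\<^sub>R x + t *\<^sub>R y) \<le> (1 - t) * F x + t * F y"
      using convex_onD[OF assms(1), of t x y] t by simp
    moreover have "(1 - t) *\<^sub>R x + t *\<^sub>R y = x + t *\<^sub>R (y - x)" by (simp add: algebra_simps)
    ultimately show ?thesis by (simp add: algebra_simps)
  qed
  have "0 \<le> F y - F x - D \<bullet> (y - x)"
    by (rule nonneg_derivative_at_right[OF d zero_less_one le])
  then show ?thesis by simp
qed

text \<open>Monotonicity of the update in all grid values at once, with the neighbouring values
  written as \<open>c - h (q \<bullet> l)\<close> in terms of the slopes \<open>q\<close>. In contrast to convexity this
  property is invariant under the reflection \<open>F q \<mapsto> - F (- q)\<close>, so that upper and lower bounds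
  can be treated alike.\<close>

definition box_monotone ::
    "((real ^ 'd) \<times> (real ^ 'd) \<Rightarrow> real) \<Rightarrow> real \<Rightarrow> real \<Rightarrow> real \<Rightarrow> bool" where
  "box_monotone F R h \<tau> \<longleftrightarrow>
     (\<forall>c c' q q'. q \<in> slope_box R \<longrightarrow> q' \<in> slope_box R \<longrightarrow> c \<le> c' \<longrightarrow>
        (\<forall>l\<in>Basis. c - h * (q \<bullet> l) \<le> c' - h * (q' \<bullet> l)) \<longrightarrow> c - \<tau> * F q \<le> c' - \<tau> * F q')"

lemma box_monotone_reflect:
  fixes F :: "(real ^ 'd) \<times> (real ^ 'd) \<Rightarrow> real"
  assumes "box_monotone F R h \<tau>"
  shows "box_monotone (\<lambda>q. - F (- q)) R h \<tau>"
  unfolding box_monotone_def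
proof (intro allI impI)
  fix c c' :: real and q q' :: "(real ^ 'd) \<times> (real ^ 'd)"
  assume H: "q \<in> slope_box R" "q' \<in> slope_box R" "c \<le> c'"
    "\<forall>l\<in>Basis. c - h * (q \<bullet> l) \<le> c' - h * (q' \<bullet> l)"
  have "- q' \<in> slope_box R" "- q \<in> slope_box R" using H by (simp_all add: mem_slope_box)
  moreover have "\<forall>l\<in>Basis. - c' - h * ((- q') \<bullet> l) \<le> - c - h * ((- q) \<bullet> l)"
    using H(4) by (auto simp: algebra_simps)
  ultimately have "- c' - \<tau> * F (- q') \<le> - c - \<tau> * F (- q)"
    using H(3) by (intro assms[unfolded box_monotone_def, rule_format]) auto
  then show "c - \<tau> * - F (- q) \<le> c' - \<tau> * - F (- q')" by simp
qed

lemma box_monotone_step: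
  assumes "box_monotone F R h \<tau>" "0 < h" "slopes h v x \<in> slope_box R" "slopes h w x \<in> slope_box R"
    "v x \<le> w x" "\<And>l. l \<in> Basis \<Longrightarrow> v (x + h *\<^sub>R dir l) \<le> w (x + h *\<^sub>R dir l)"
  shows "fd_step F h \<tau> v x \<le> fd_step F h \<tau> w x"
proof -
  have "v x - h * (slopes h v x \<bullet> l) \<le> w x - h * (slopes h w x \<bullet> l)" if "l \<in> Basis" for l
    using assms(2) assms(6)[OF that] that by (simp add: slopes_inner)
  then show ?thesis
    using assms(1)[unfolded box_monotone_def, rule_format, OF assms(3,4,5)] by (simp add: fd_step_def)
qed

text \<open>The translate of \<open>v\<close> lies below \<open>v + K\<close>, and a monotone step commutes with both operations.\<close>

lemma step_shift_bound:
  assumes mono: "box_monotone F R h \<tau>" and h: "0 < h" and sl: "\<And>x. slopes h v x \<in> slope_box R"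
    and le: "\<And>x. v (x + a) \<le> v x + K"
  shows "fd_step F h \<tau> v (x + a) \<le> fd_step F h \<tau> v x + K"
proof -
  have "fd_step F h \<tau> (\<lambda>y. v (y + a)) x \<le> fd_step F h \<tau> (\<lambda>y. v y + K) x"
    by (rule box_monotone_step[OF mono h]) (simp_all add: slopes_shift slopes_add_const sl le)
  then show ?thesis by (simp add: fd_step_shift fd_step_add_const)
qed

lemma step_abs_shift_bound:
  assumes mono: "box_monotone F R h \<tau>" and h: "0 < h" and sl: "\<And>x. slopes h v x \<in> slope_box R"
    and le: "\<And>x. \<bar>v (x + a) - v x\<bar> \<le> K"
  shows "\<bar>fd_step F h \<tau> v (x + a) - fd_step F h \<tau> v x\<bar> \<le> K"
proof -
  have "v (x + a) \<le> v x + K" for x using le[of x] by linarith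
  from step_shift_bound[OF mono h sl this, of x]
  have "fd_step F h \<tau> v (x + a) \<le> fd_step F h \<tau> v x + K" .
  moreover have "v (x + - a) \<le> v x + K" for x using le[of "x - a"] by simp
  from step_shift_bound[OF mono h sl this, of "x + a"]
  have "fd_step F h \<tau> v x \<le> fd_step F h \<tau> v (x + a) + K" by simp
  ultimately show ?thesis by linarith
qed

text \<open>By convexity of \<open>F\<close> the average of two translates of the step lies below the step of the average,
  and by semiconcavity the average lies below \<open>v\<close> plus a constant.\<close>

lemma step_midpoint_semiconcave:
  assumes mono: "box_monotone F R h \<tau>" and h: "0 < h" and \<tau>: "0 \<le> \<tau>"
    and sl: "\<And>x. slopes h v x \<in> slope_box R" and conv: "convex_on UNIV F"
    and sc: "midpoint_semiconcave c v"
  shows "midpoint_semiconcave c (fd_step F h \<tau> v)"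
  unfolding midpoint_semiconcave_def
proof (intro allI)
  fix x y
  let ?s = "slopes h v"
  let ?w = "\<lambda>z. (v (z + y) + v (z + - y)) / 2"
  have w: "slopes h ?w x = (1/2) *\<^sub>R ?s (x + y) + (1/2) *\<^sub>R ?s (x - y)"
    using slopes_average[of h "\<lambda>z. v (z + y)" "\<lambda>z. v (z + - y)" x] by (simp add: slopes_shift del: add_uminus_conv_diff) simp
  have "F (slopes h ?w x) \<le> (1/2) * F (?s (x + y)) + (1/2) * F (?s (x - y))"
    unfolding w using convex_onD[OF conv, of "1/2" "?s (x + y)" "?s (x - y)"] by simp
  then have "2 * \<tau> * F (slopes h ?w x) \<le> \<tau> * F (?s (x + y)) + \<tau> * F (?s (x - y))"
    using mult_left_mono[of _ _ "2 * \<tau>"] \<tau> by (fastforce simp: algebra_simps)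
  then have "fd_step F h \<tau> v (x + y) + fd_step F h \<tau> v (x - y) \<le> 2 * fd_step F h \<tau> ?w x"
    by (simp add: fd_step_def field_simps)
  also have "fd_step F h \<tau> ?w x \<le> fd_step F h \<tau> (\<lambda>z. v z + c * (norm y)\<^sup>2) x"
  proof (rule box_monotone_step[OF mono h])
    have "?w z \<le> v z + c * (norm y)\<^sup>2" for z
      using sc[unfolded midpoint_semiconcave_def, rule_format, of z y] by (simp add: field_simps)
    then show "?w x \<le> v x + c * (norm y)\<^sup>2"
      "\<And>l. ?w (x + h *\<^sub>R dir l) \<le> v (x + h *\<^sub>R dir l) + c * (norm y)\<^sup>2" by blast+
    show "slopes h ?w x \<in> slope_box R"
      unfolding w using convex_slope_box[of R] sl by (intro convexD) auto
  qed (simp_all add: slopes_add_const sl)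
  finally show "fd_step F h \<tau> v (x + y) + fd_step F h \<tau> v (x - y)
      \<le> 2 * fd_step F h \<tau> v x + 2 * c * (norm y)\<^sup>2"
    by (simp add: fd_step_add_const)
qed

definition admissible :: "real \<Rightarrow> real \<Rightarrow> (real ^ 'd \<Rightarrow> real) \<Rightarrow> bool" where
  "admissible R c v \<longleftrightarrow> torus_periodic v \<and> coord_lipschitz R v \<and> midpoint_semiconcave c v"

lemma step_torus_periodic: "torus_periodic v \<Longrightarrow> torus_periodic (fd_step F h \<tau> v)"
  unfolding torus_periodic_def
proof (intro allI)
  fix x i assume v: "\<forall>x i. v (x + axis i 1) = v x"
  then have "(\<lambda>y. v (y + axis i 1)) = v" by auto
  then show "fd_step F h \<tau> v (x + axis i 1) = fd_step F h \<tau> v x"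
    using fd_step_shift[of F h \<tau> v "axis i 1" x] by simp
qed

lemma step_admissible:
  assumes mono: "box_monotone F R h \<tau>" and h: "0 < h" and \<tau>: "0 \<le> \<tau>"
    and conv: "convex_on UNIV F" and v: "admissible R c v"
  shows "admissible R c (fd_step F h \<tau> v)"
proof -
  have sl: "slopes h v x \<in> slope_box R" for x
    using v h by (simp add: admissible_def coord_lipschitz_slopes)
  have "coord_lipschitz R (fd_step F h \<tau> v)"
    unfolding coord_lipschitz_def
    by (intro allI step_abs_shift_bound[OF mono h sl])
       (use v in \<open>simp add: admissible_def coord_lipschitz_def\<close>)
  then show ?thesis
    using v step_torus_periodic[of v F h \<tau>] step_midpoint_semiconcave[OF mono h \<tau> sl conv, of c]
    by (simp add: admissible_def)
qed

text \<open>The parameter \<open>\<rho>\<close> is the ratio of the time step to the space step. Both conditions on the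
  gradient are independent of the steps otherwise, which makes refinement at a fixed ratio
  possible.\<close>

locale monotone_scheme =
  fixes F :: "(real ^ 'd) \<times> (real ^ 'd) \<Rightarrow> real" and DF R \<rho>
  assumes grad: "\<And>z. GDERIV F z :> DF z"
    and conv: "convex_on UNIV F"
    and R: "0 < R"
    and lam: "0 < \<rho>"
    and DF_nonneg: "\<And>q l. q \<in> slope_box R \<Longrightarrow> l \<in> Basis \<Longrightarrow> 0 \<le> DF q \<bullet> l"
    and DF_sum: "\<And>q. q \<in> slope_box R \<Longrightarrow> \<rho> * (\<Sum>l\<in>Basis. DF q \<bullet> l) \<le> 1"
begin

lemma tangent: "F x + DF x \<bullet> (y - x) \<le> F y"
  by (rule convex_gradient_inequality[OF conv grad])

lemma box_monotone: "0 < h \<Longrightarrow> box_monotone F R h (\<rho> * h)"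
  unfolding box_monotone_def
proof (intro allI impI)
  fix c c' :: real and q q' :: "(real ^ 'd) \<times> (real ^ 'd)"
  assume h: "0 < h" and H: "q \<in> slope_box R" "q' \<in> slope_box R" "c \<le> c'"
    "\<forall>l\<in>Basis. c - h * (q \<bullet> l) \<le> c' - h * (q' \<bullet> l)"
  let ?a = "DF q'"
  have "\<rho> * h * (?a \<bullet> (q' - q)) = \<rho> * (\<Sum>l\<in>Basis. (?a \<bullet> l) * (h * (q' \<bullet> l) - h * (q \<bullet> l)))"
    by (subst euclidean_inner)
       (simp add: inner_diff_left sum_distrib_left algebra_simps)
  also have "\<dots> \<le> \<rho> * (\<Sum>l\<in>Basis. (?a \<bullet> l) * (c' - c))"
    using H(4) DF_nonneg[OF H(2)] lam
    by (intro mult_left_mono sum_mono) (auto simp: algebra_simps)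
  also have "\<dots> = (\<rho> * (\<Sum>l\<in>Basis. ?a \<bullet> l)) * (c' - c)"
    by (simp add: sum_distrib_right)
  also have "\<dots> \<le> 1 * (c' - c)"
    using DF_sum[OF H(2)] H(3) by (intro mult_right_mono) auto
  finally have 1: "\<rho> * h * (?a \<bullet> (q' - q)) \<le> c' - c" by simp
  have "F q' \<le> F q + ?a \<bullet> (q' - q)"
    using tangent[of q' q] by (simp add: inner_diff_right)
  then have "\<rho> * h * F q' \<le> \<rho> * h * (F q + ?a \<bullet> (q' - q))"
    using h lam by (intro mult_left_mono) auto
  then show "c - \<rho> * h * F q \<le> c' - \<rho> * h * F q'"
    using 1 by (simp add: algebra_simps)
qed

lemma step_mono:
  assumes "0 < h" "coord_lipschitz R v" "coord_lipschitz R w" "\<And>x. v x \<le> w x"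
  shows "fd_step F h (\<rho> * h) v x \<le> fd_step F h (\<rho> * h) w x"
  using assms by (intro box_monotone_step[OF box_monotone] coord_lipschitz_slopes) auto

lemma scheme_admissible:
  assumes "0 < h" "admissible R c g"
  shows "admissible R c (fd_scheme F g h (\<rho> * h) n)"
proof (induction n)
  case 0
  show ?case using assms(2) by simp
next
  case (Suc n)
  have "0 \<le> \<rho> * h" using assms(1) lam by simp
  from step_admissible[OF box_monotone[OF assms(1)] assms(1) this conv Suc]
  show ?case by (simp only: fd_scheme_Suc)
qed

text \<open>One step is a minimum over affine, order preserving averages, by convexity of \<open>F\<close>: replacing
  \<open>F\<close> by its tangent at the current slopes and comparing with an arbitrary reference slope
  \<open>\<sigma>\<close> gives a lower bound in which the values at the node and its neighbours appear with
  nonnegative weights of total mass one.\<close>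

lemma step_ge_average:
  assumes h: "0 < h" and sl: "slopes h v x \<in> slope_box R"
  defines "a \<equiv> DF (slopes h v x)"
  shows "(1 - \<rho> * (\<Sum>l\<in>Basis. a \<bullet> l)) * v x
      + \<rho> * (\<Sum>l\<in>Basis. (a \<bullet> l) * (v (x + h *\<^sub>R dir l) + h * (\<sigma> \<bullet> l))) - \<rho> * h * F \<sigma>
    \<le> fd_step F h (\<rho> * h) v x"
proof -
  let ?s = "slopes h v x"
  define S where "S = (\<Sum>l\<in>Basis. a \<bullet> l)"
  define P where "P = (\<Sum>l\<in>Basis. (a \<bullet> l) * (v (x + h *\<^sub>R dir l) + h * (\<sigma> \<bullet> l)))"
  have "F ?s \<le> F \<sigma> + a \<bullet> (?s - \<sigma>)"
    using tangent[of ?s \<sigma>] by (simp add: a_def inner_diff_right)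
  then have "\<rho> * h * F ?s \<le> \<rho> * h * (F \<sigma> + a \<bullet> (?s - \<sigma>))"
    using h lam by (intro mult_left_mono) auto
  moreover have "h * (a \<bullet> (?s - \<sigma>))
      = (\<Sum>l\<in>Basis. (a \<bullet> l) * v x - (a \<bullet> l) * (v (x + h *\<^sub>R dir l) + h * (\<sigma> \<bullet> l)))"
    using h by (subst euclidean_inner)
      (auto simp: inner_diff_left sum_distrib_left slopes_inner field_simps intro!: sum.cong)
  then have "h * (a \<bullet> (?s - \<sigma>)) = S * v x - P"
    by (simp only: S_def P_def sum_subtractf sum_distrib_right)
  ultimately have "\<rho> * h * F ?s \<le> \<rho> * h * F \<sigma> + \<rho> * (S * v x - P)"
    by (simp add: distrib_left mult.assoc)
  then have "(1 - \<rho> * S) * v x + \<rho> * P - \<rho> * h * F \<sigma> \<le> v x - \<rho> * h * F ?s"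
    by (simp add: algebra_simps)
  then show ?thesis
    by (simp add: fd_step_def S_def P_def)
qed

text \<open>Weights of total mass one, applied to lower bounds that differ between the node and its
  neighbours.\<close>

lemma average_ge:
  assumes q: "q \<in> slope_box R" and a: "a = DF q"
    and P0: "B - e0 \<le> P0" and P: "\<And>l. l \<in> Basis \<Longrightarrow> B - e1 \<le> P l"
  shows "B - (1 - \<rho> * (\<Sum>l\<in>Basis. a \<bullet> l)) * e0 - \<rho> * (\<Sum>l\<in>Basis. a \<bullet> l) * e1
    \<le> (1 - \<rho> * (\<Sum>l\<in>Basis. a \<bullet> l)) * P0 + \<rho> * (\<Sum>l\<in>Basis. (a \<bullet> l) * P l)"
proof -
  let ?S = "\<Sum>l\<in>Basis. a \<bullet> l"
  have "(1 - \<rho> * ?S) * (B - e0) \<le> (1 - \<rho> * ?S) * P0"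
    using DF_sum[OF q] a P0 by (intro mult_left_mono) auto
  moreover have "(\<Sum>l\<in>Basis. (a \<bullet> l) * (B - e1)) \<le> (\<Sum>l\<in>Basis. (a \<bullet> l) * P l)"
    using DF_nonneg[OF q] a P by (intro sum_mono mult_left_mono) auto
  then have "\<rho> * (?S * (B - e1)) \<le> \<rho> * (\<Sum>l\<in>Basis. (a \<bullet> l) * P l)"
    using lam by (intro mult_left_mono) (auto simp: sum_distrib_right)
  ultimately show ?thesis by (simp add: algebra_simps)
qed

text \<open>In the representation
  above two half steps move to a random point \<open>x + h (d\<^sub>l + d\<^sub>m) / 2\<close>, where each of \<open>d\<^sub>l\<close>, \<open>d\<^sub>m\<close> may
  also be zero. This point is the mean of the two grid points \<open>x + h d\<^sub>l\<close> and \<open>x + h d\<^sub>m\<close>, so by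
  semiconcavity the value there is at least the average of the two coarse grid values, and the
  coarse step with the averaged weights is a competitor in the coarse minimum. The
  same reference slope \<open>\<sigma>\<close> at all nodes makes the costs add up.\<close>

lemma two_half_steps_ge:
  assumes h: "0 < h" and v: "admissible R c v" and c: "0 \<le> c"
    and A: "\<And>q. q \<in> slope_box R \<Longrightarrow> (\<Sum>l\<in>Basis. DF q \<bullet> l) \<le> A"
  shows "fd_step F h (\<rho> * h) v x
    \<le> fd_step F (h / 2) (\<rho> * (h / 2)) (fd_step F (h / 2) (\<rho> * (h / 2)) v) x + 2 * c * A * h * (\<rho> * h)"
proof -
  define k where "k = h / 2"
  have k: "0 < k" "h = 2 * k" using h by (simp_all add: k_def)
  define W where "W = fd_step F k (\<rho> * k) v"
  \<comment> \<open>The coarse slopes serve as reference at every fine node.\<close>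
  define \<sigma> where "\<sigma> = slopes h v x"
  let ?d = "dir :: (real ^ 'd) \<times> (real ^ 'd) \<Rightarrow> real ^ 'd"
  let ?E = "c * k\<^sup>2"
  let ?S = "\<lambda>q. \<Sum>l\<in>Basis. DF q \<bullet> l"
  have E: "0 \<le> ?E" using c by simp
  have sc: "v (m + z) + v (m - z) \<le> 2 * v m + 2 * c * (norm z)\<^sup>2" for m z
    using v by (simp add: admissible_def midpoint_semiconcave_def)
  have \<sigma>: "k * (\<sigma> \<bullet> l) = (v x - v (x + h *\<^sub>R ?d l)) / 2" if "l \<in> Basis" for l
    using that k by (simp add: \<sigma>_def slopes_inner)
  have slv: "slopes k v y \<in> slope_box R" for y
    using v k by (simp add: admissible_def coord_lipschitz_slopes)
  have "admissible R c W"
    unfolding W_def using step_admissible[OF box_monotone[OF k(1)] k(1) _ conv v] lam k by simp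
  then have slW: "slopes k W y \<in> slope_box R" for y
    using k by (simp add: admissible_def coord_lipschitz_slopes)
  have S0: "0 \<le> ?S q" if "q \<in> slope_box R" for q using DF_nonneg[OF that] by (simp add: sum_nonneg)
  have A0: "0 \<le> A" using A[OF slv] S0[OF slv] order_trans by blast
  \<comment> \<open>A fine neighbour is the midpoint of \<open>x\<close> and a coarse neighbour.\<close>
  have half: "v x - k * (\<sigma> \<bullet> l) - ?E \<le> v (x + k *\<^sub>R ?d l)" if l: "l \<in> Basis" for l
  proof -
    have "x + k *\<^sub>R ?d l + k *\<^sub>R ?d l = x + h *\<^sub>R ?d l"
      by (simp only: k(2) mult_2 scaleR_add_left add.assoc)
    then show ?thesis using sc[of "x + k *\<^sub>R ?d l" "k *\<^sub>R ?d l"] l \<sigma>[OF l]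
      by (simp add: norm_dir power_mult_distrib field_simps)
  qed
  \<comment> \<open>After two fine steps the position is the midpoint of two coarse neighbours.\<close>
  have both: "v x - k * (\<sigma> \<bullet> m) - 4 * ?E \<le> v (x + k *\<^sub>R ?d m + k *\<^sub>R ?d l) + k * (\<sigma> \<bullet> l)"
    if l: "l \<in> Basis" and m: "m \<in> Basis" for l m
  proof -
    let ?c = "x + k *\<^sub>R ?d m + k *\<^sub>R ?d l" and ?z = "k *\<^sub>R (?d m - ?d l)"
    have 1: "?c + ?z = x + h *\<^sub>R ?d m" "?c - ?z = x + h *\<^sub>R ?d l"
      by (simp_all only: k(2) mult_2 scaleR_add_left scaleR_diff_right) simp_all
    have "norm (?d m - ?d l) \<le> 2"
      using norm_triangle_ineq4[of "?d m" "?d l"] l m by (simp add: norm_dir)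
    then have "norm ?z \<le> 2 * k" using k by simp
    then have "(norm ?z)\<^sup>2 \<le> (2 * k)\<^sup>2" by (intro power_mono) auto
    then have "c * (norm ?z)\<^sup>2 \<le> 4 * ?E" using c mult_left_mono by fastforce
    then show ?thesis using sc[of ?c ?z] \<sigma>[OF l] \<sigma>[OF m] unfolding 1 by (simp add: field_simps)
  qed
  have Wx: "v x - \<rho> * k * F \<sigma> - \<rho> * A * ?E \<le> W x"
  proof -
    let ?q = "slopes k v x"
    have "v x - (1 - \<rho> * ?S ?q) * 0 - \<rho> * ?S ?q * ?E - \<rho> * k * F \<sigma>
      \<le> (1 - \<rho> * ?S ?q) * v x + \<rho> * (\<Sum>l\<in>Basis. (DF ?q \<bullet> l) * (v (x + k *\<^sub>R ?d l) + k * (\<sigma> \<bullet> l)))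
        - \<rho> * k * F \<sigma>"
      using half by (intro diff_right_mono average_ge[OF slv refl]) (auto simp: algebra_simps)
    also have "\<dots> \<le> W x" unfolding W_def by (rule step_ge_average[OF k(1) slv])
    finally have "v x - \<rho> * ?S ?q * ?E - \<rho> * k * F \<sigma> \<le> W x" by simp
    moreover have "\<rho> * ?S ?q * ?E \<le> \<rho> * A * ?E"
      using A[OF slv] lam E by (intro mult_right_mono mult_left_mono) auto
    ultimately show ?thesis by linarith
  qed
  have Wy: "v x - \<rho> * k * F \<sigma> - 4 * ?E \<le> W (x + k *\<^sub>R ?d m) + k * (\<sigma> \<bullet> m)" if m: "m \<in> Basis" for m
  proof -
    let ?y = "x + k *\<^sub>R ?d m"
    let ?q = "slopes k v ?y"
    let ?B = "v x - k * (\<sigma> \<bullet> m)"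
    have "?B - (1 - \<rho> * ?S ?q) * (4 * ?E) - \<rho> * ?S ?q * (4 * ?E) - \<rho> * k * F \<sigma>
      \<le> (1 - \<rho> * ?S ?q) * v ?y
        + \<rho> * (\<Sum>l\<in>Basis. (DF ?q \<bullet> l) * (v (?y + k *\<^sub>R ?d l) + k * (\<sigma> \<bullet> l))) - \<rho> * k * F \<sigma>"
      using half[OF m] both[OF _ m] E
      by (intro diff_right_mono average_ge[OF slv refl]) (auto simp: algebra_simps)
    also have "\<dots> \<le> W ?y" unfolding W_def by (rule step_ge_average[OF k(1) slv])
    finally show ?thesis by (simp add: algebra_simps)
  qed
  let ?q = "slopes k W x"
  let ?B = "v x - \<rho> * k * F \<sigma>"
  have "?B - (1 - \<rho> * ?S ?q) * (\<rho> * A * ?E) - \<rho> * ?S ?q * (4 * ?E) - \<rho> * k * F \<sigma>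
      \<le> (1 - \<rho> * ?S ?q) * W x
        + \<rho> * (\<Sum>l\<in>Basis. (DF ?q \<bullet> l) * (W (x + k *\<^sub>R ?d l) + k * (\<sigma> \<bullet> l))) - \<rho> * k * F \<sigma>"
    using Wx Wy by (intro diff_right_mono average_ge[OF slW refl]) auto
  also have "\<dots> \<le> fd_step F k (\<rho> * k) W x" by (rule step_ge_average[OF k(1) slW])
  finally have "?B - (1 - \<rho> * ?S ?q) * (\<rho> * A * ?E) - \<rho> * ?S ?q * (4 * ?E) - \<rho> * k * F \<sigma>
      \<le> fd_step F k (\<rho> * k) W x" .
  moreover have "(1 - \<rho> * ?S ?q) * (\<rho> * A * ?E) \<le> 1 * (\<rho> * A * ?E)"
    using S0[OF slW] lam A0 E by (intro mult_right_mono) auto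
  moreover have "\<rho> * ?S ?q * (4 * ?E) \<le> \<rho> * A * (4 * ?E)"
    using A[OF slW] lam E by (intro mult_right_mono mult_left_mono) auto
  moreover have "5 * (\<rho> * A * ?E) \<le> 2 * c * A * h * (\<rho> * h)"
    using k lam A0 c by (simp add: power2_eq_square algebra_simps)
  moreover have "fd_step F h (\<rho> * h) v x = ?B - \<rho> * k * F \<sigma>"
    using k by (simp add: fd_step_def \<sigma>_def algebra_simps)
  ultimately show ?thesis unfolding W_def k_def by linarith
qed

end

lemma update_op_at_slopes:
  fixes q :: "(real ^ 'd) \<times> (real ^ 'd)"
  assumes "h \<noteq> 0" "\<And>j. a j = c - h * fst q $ j" "\<And>j. b j = c - h * snd q $ j"
  shows "update_op F h \<tau> c a b = c - \<tau> * F q"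
proof -
  have "- (\<chi> i. (a i - c) / h) = fst q" "(\<chi> i. (c - b i) / h) = snd q"
    using assms by (simp_all add: vec_eq_iff)
  then show ?thesis by (simp add: update_op_def)
qed

lemma slopes_bounded_at_slopes:
  fixes q :: "(real ^ 'd) \<times> (real ^ 'd)"
  assumes "h \<noteq> 0" "\<And>j. a j = c - h * fst q $ j" "\<And>j. b j = c - h * snd q $ j" "q \<in> slope_box R"
  shows "slopes_bounded R h c a b"
proof -
  have "\<bar>fst q $ j\<bar> \<le> R" for j
  proof -
    have "(axis j 1, 0) \<in> (Basis :: ((real ^ 'd) \<times> (real ^ 'd)) set)" by (auto simp: Basis_prod_def)
    then have "\<bar>q \<bullet> (axis j 1, 0)\<bar> \<le> R" using assms(4) unfolding mem_slope_box by blast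
    then show ?thesis by (simp add: inner_prod_def inner_axis)
  qed
  moreover have "\<bar>snd q $ j\<bar> \<le> R" for j
  proof -
    have "(0, axis j 1) \<in> (Basis :: ((real ^ 'd) \<times> (real ^ 'd)) set)" by (auto simp: Basis_prod_def)
    then have "\<bar>q \<bullet> (0, axis j 1)\<bar> \<le> R" using assms(4) unfolding mem_slope_box by blast
    then show ?thesis by (simp add: inner_prod_def inner_axis)
  qed
  ultimately show ?thesis
    using assms(1-3) by (simp add: slopes_bounded_def)
qed

lemma open_box_line:
  fixes q d :: "'a :: euclidean_space"
  assumes "q \<in> box a b"
  obtains e where "0 < e" "\<And>t. 0 \<le> t \<Longrightarrow> t < e \<Longrightarrow> q + t *\<^sub>R d \<in> cbox a b"
proof -
  obtain r where r: "0 < r" "ball q r \<subseteq> box a b"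
    using assms openE[OF open_box] by metis
  have "q + t *\<^sub>R d \<in> cbox a b" if t: "0 \<le> t" "t < r / (norm d + 1)" for t
  proof -
    have "t * norm d \<le> t * (norm d + 1)" using t by (intro mult_left_mono) auto
    also have "\<dots> < r" using t by (simp add: pos_less_divide_eq add_nonneg_pos)
    finally have "q + t *\<^sub>R d \<in> ball q r" using t by (simp add: dist_norm)
    then show ?thesis using r(2) box_subset_cbox by blast
  qed
  moreover have "0 < r / (norm d + 1)" using r by (simp add: add_nonneg_pos)
  ultimately show thesis using that by blast
qed

text \<open>One-sided derivatives of the update at the centre of a family of grid values give the sign
  conditions at slopes in the open box. The central value moves all slopes at once, and in the
  closed box it may not be possible to move it at all; continuity of the gradient then extends
  the conditions to the boundary.\<close>

lemma monotone_schemeI: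
  fixes F :: "(real ^ 'd) \<times> (real ^ 'd) \<Rightarrow> real"
  assumes grad: "\<And>z. GDERIV F z :> DF z" and cont: "continuous_on UNIV DF"
    and conv: "convex_on UNIV F" and R: "0 < R" and h: "0 < h" and \<tau>: "0 < \<tau>"
    and mc: "monotonicity_condition F R h \<tau>"
  shows "monotone_scheme F DF R (\<tau> / h)"
proof -
  let ?lo = "- R *\<^sub>R One :: (real ^ 'd) \<times> (real ^ 'd)" and ?hi = "R *\<^sub>R One"
  note mc = mc[unfolded monotonicity_condition_def]
  have box: "slope_box R = cbox ?lo ?hi" by (simp add: slope_box_def)
  have "box ?lo ?hi \<noteq> {}"
    using R by (simp add: box_ne_empty)
  then have closure: "closure (box ?lo ?hi) = slope_box R" by (simp add: box closure_box)
  have nonneg_open: "0 \<le> DF q \<bullet> l" if q: "q \<in> box ?lo ?hi" and l: "l \<in> Basis" for q l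
  proof -
    obtain e where e: "0 < e" "\<And>t. 0 \<le> t \<Longrightarrow> t < e \<Longrightarrow> q + t *\<^sub>R (- l) \<in> slope_box R"
      using open_box_line[OF q, of "- l"] unfolding box by metis
    have d: "((\<lambda>t. - \<tau> * F (q + t *\<^sub>R (- l))) has_real_derivative - \<tau> * (DF q \<bullet> (- l))) (at 0)"
      by (intro DERIV_cmult GDERIV_line grad)
    have "- \<tau> * F (q + 0 *\<^sub>R (- l)) \<le> - \<tau> * F (q + t *\<^sub>R (- l))" if t: "0 < t" "t < e" for t
      using l
    proof (cases rule: Basis_pair_cases)
      case (left i)
      let ?a = "\<lambda>j. - (h * fst q $ j)" and ?b = "\<lambda>j. - (h * snd q $ j)"
      let ?s = "\<lambda>r. ?a i + h * r"
      have a: "(?a(i := ?s r)) j = 0 - h * fst (q + r *\<^sub>R (- l)) $ j" for r j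
        by (simp add: left axis_def algebra_simps)
      have b: "?b j = 0 - h * snd (q + r *\<^sub>R (- l)) $ j" for r j
        by (simp add: left)
      have "slopes_bounded R h 0 (?a(i := ?s r)) ?b" if "0 \<le> r" "r < e" for r
        by (rule slopes_bounded_at_slopes[OF _ a b e(2)]) (use h that in auto)
      then have "?s r \<in> {s. slopes_bounded R h 0 (?a(i := s)) ?b}" if "0 \<le> r" "r < e" for r
        using that by simp
      moreover have "mono_on {s. slopes_bounded R h 0 (?a(i := s)) ?b} (\<lambda>s. update_op F h \<tau> 0 (?a(i := s)) ?b)"
        using mc by blast
      moreover have "?s 0 \<le> ?s t" using t h by simp
      ultimately have le: "update_op F h \<tau> 0 (?a(i := ?s 0)) ?b \<le> update_op F h \<tau> 0 (?a(i := ?s t)) ?b"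
        using t e(1) unfolding mono_on_def by (meson less_imp_le order_refl)
      have eq: "update_op F h \<tau> 0 (?a(i := ?s r)) ?b = 0 - \<tau> * F (q + r *\<^sub>R (- l))" for r
        by (rule update_op_at_slopes[OF _ a b]) (use h in auto)
      show ?thesis using le unfolding eq[of 0] eq[of t] by simp
    next
      case (right i)
      let ?a = "\<lambda>j. - (h * fst q $ j)" and ?b = "\<lambda>j. - (h * snd q $ j)"
      let ?s = "\<lambda>r. ?b i + h * r"
      have a: "?a j = 0 - h * fst (q + r *\<^sub>R (- l)) $ j" for r j
        by (simp add: right)
      have b: "(?b(i := ?s r)) j = 0 - h * snd (q + r *\<^sub>R (- l)) $ j" for r j
        by (simp add: right axis_def algebra_simps)
      have "slopes_bounded R h 0 ?a (?b(i := ?s r))" if "0 \<le> r" "r < e" for r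
        by (rule slopes_bounded_at_slopes[OF _ a b e(2)]) (use h that in auto)
      then have "?s r \<in> {s. slopes_bounded R h 0 ?a (?b(i := s))}" if "0 \<le> r" "r < e" for r
        using that by simp
      moreover have "mono_on {s. slopes_bounded R h 0 ?a (?b(i := s))} (\<lambda>s. update_op F h \<tau> 0 ?a (?b(i := s)))"
        using mc by blast
      moreover have "?s 0 \<le> ?s t" using t h by simp
      ultimately have le: "update_op F h \<tau> 0 ?a (?b(i := ?s 0)) \<le> update_op F h \<tau> 0 ?a (?b(i := ?s t))"
        using t e(1) unfolding mono_on_def by (meson less_imp_le order_refl)
      have eq: "update_op F h \<tau> 0 ?a (?b(i := ?s r)) = 0 - \<tau> * F (q + r *\<^sub>R (- l))" for r
        by (rule update_op_at_slopes[OF _ a b]) (use h in auto)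
      show ?thesis using le unfolding eq[of 0] eq[of t] by simp
    qed
    from nonneg_derivative_at_right[OF d e(1) this] show ?thesis using \<tau> by (simp add: zero_le_mult_iff)
  qed
  have sum_open: "DF q \<bullet> One \<le> h / \<tau>" if q: "q \<in> box ?lo ?hi" for q
  proof -
    obtain e where e: "0 < e" "\<And>t. 0 \<le> t \<Longrightarrow> t < e \<Longrightarrow> q + t *\<^sub>R One \<in> slope_box R"
      using open_box_line[OF q, of One] unfolding box by metis
    have "((\<lambda>t. h * t) has_real_derivative h) (at 0)"
      by (auto intro!: derivative_eq_intros)
    from DERIV_diff[OF this DERIV_cmult[OF GDERIV_line[OF grad], of \<tau> q One]]
    have d: "((\<lambda>t. h * t - \<tau> * F (q + t *\<^sub>R One)) has_real_derivative h - \<tau> * (DF q \<bullet> One)) (at 0)" .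
    have "h * 0 - \<tau> * F (q + 0 *\<^sub>R One) \<le> h * t - \<tau> * F (q + t *\<^sub>R One)" if t: "0 < t" "t < e" for t
    proof -
      let ?a = "\<lambda>j. - (h * fst q $ j)" and ?b = "\<lambda>j. - (h * snd q $ j)"
      have One: "fst (One :: (real ^ 'd) \<times> (real ^ 'd)) $ j = 1" "snd (One :: (real ^ 'd) \<times> (real ^ 'd)) $ j = 1" for j :: 'd
      proof -
        have "(axis j (1::real), 0) \<in> (Basis :: ((real ^ 'd) \<times> (real ^ 'd)) set)"
          "(0, axis j (1::real)) \<in> (Basis :: ((real ^ 'd) \<times> (real ^ 'd)) set)"
          by (auto simp: Basis_prod_def)
        moreover have "One \<bullet> b = 1" if "b \<in> Basis" for b :: "(real ^ 'd) \<times> (real ^ 'd)"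
          using that by (subst inner_sum_left) (simp add: inner_Basis)
        ultimately have "One \<bullet> (axis j (1::real), 0 :: real ^ 'd) = 1" "One \<bullet> (0 :: real ^ 'd, axis j (1::real)) = 1"
          by blast+
        then show "fst (One :: (real ^ 'd) \<times> (real ^ 'd)) $ j = 1" "snd (One :: (real ^ 'd) \<times> (real ^ 'd)) $ j = 1"
          unfolding inner_prod_def fst_conv snd_conv by (simp_all only: inner_zero_right inner_axis add_0_left add_0_right) simp_all
      qed
      have a: "?a j = h * r - h * fst (q + r *\<^sub>R One) $ j" for r j
        by (simp only: fst_add fst_scaleR vector_add_component vector_scaleR_component One) (simp add: algebra_simps)
      have b: "?b j = h * r - h * snd (q + r *\<^sub>R One) $ j" for r j
        by (simp only: snd_add snd_scaleR vector_add_component vector_scaleR_component One) (simp add: algebra_simps)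
      have "slopes_bounded R h (h * r) ?a ?b" if "0 \<le> r" "r < e" for r
        by (rule slopes_bounded_at_slopes[OF _ a b e(2)]) (use h that in auto)
      then have "h * r \<in> {c. slopes_bounded R h c ?a ?b}" if "0 \<le> r" "r < e" for r
        using that by simp
      moreover have "mono_on {c. slopes_bounded R h c ?a ?b} (\<lambda>c. update_op F h \<tau> c ?a ?b)"
        using mc by blast
      moreover have "h * 0 \<le> h * t" using t h by simp
      ultimately have le: "update_op F h \<tau> (h * 0) ?a ?b \<le> update_op F h \<tau> (h * t) ?a ?b"
        using t e(1) unfolding mono_on_def by (meson less_imp_le order_refl)
      have eq: "update_op F h \<tau> (h * r) ?a ?b = h * r - \<tau> * F (q + r *\<^sub>R One)" for r
        by (rule update_op_at_slopes[OF _ a b]) (use h in auto)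
      show ?thesis using le unfolding eq[of 0] eq[of t] by simp
    qed
    from nonneg_derivative_at_right[OF d e(1) this] show ?thesis
      using \<tau> by (simp add: field_simps)
  qed
  have nonneg: "0 \<le> DF q \<bullet> l" if q: "q \<in> slope_box R" and l: "l \<in> Basis" for q l
  proof -
    have "closed {q. 0 \<le> DF q \<bullet> l}"
      by (intro closed_Collect_le continuous_intros cont)
    then have "closure (box ?lo ?hi) \<subseteq> {q. 0 \<le> DF q \<bullet> l}"
      using nonneg_open[OF _ l] by (intro closure_minimal subsetI CollectI)
    then show ?thesis using q closure by blast
  qed
  have sum: "DF q \<bullet> One \<le> h / \<tau>" if q: "q \<in> slope_box R" for q
  proof -
    have "closed {q. DF q \<bullet> One \<le> h / \<tau>}"
      by (intro closed_Collect_le continuous_intros cont)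
    then have "closure (box ?lo ?hi) \<subseteq> {q. DF q \<bullet> One \<le> h / \<tau>}"
      using sum_open by (intro closure_minimal subsetI CollectI)
    then show ?thesis using q closure by blast
  qed
  show ?thesis
  proof
    show "\<tau> / h * (\<Sum>l\<in>Basis. DF q \<bullet> l) \<le> 1" if "q \<in> slope_box R" for q
      using sum[OF that] h \<tau> by (simp add: inner_sum_right field_simps)
  qed (use grad conv R h \<tau> nonneg in auto)
qed

locale bounded_monotone_scheme = monotone_scheme F DF R \<rho>
  for F :: "(real ^ 'd) \<times> (real ^ 'd) \<Rightarrow> real" and DF R \<rho> +
  fixes M K A :: real
  assumes F_bound: "\<And>q. q \<in> slope_box R \<Longrightarrow> \<bar>F q\<bar> \<le> M"
    and DF_bound: "\<And>q. q \<in> slope_box R \<Longrightarrow> norm (DF q) \<le> K"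
    and DF_sum_bound: "\<And>q. q \<in> slope_box R \<Longrightarrow> (\<Sum>l\<in>Basis. DF q \<bullet> l) \<le> A"
begin

lemma M_nonneg: "0 \<le> M"
  using F_bound[OF zero_in_slope_box[OF less_imp_le[OF R]]] by linarith

lemma K_nonneg: "0 \<le> K"
  using DF_bound[OF zero_in_slope_box[OF less_imp_le[OF R]]] norm_ge_zero[of "DF 0"] by linarith

lemma F_lipschitz:
  assumes "q \<in> slope_box R" "q' \<in> slope_box R"
  shows "\<bar>F q - F q'\<bar> \<le> K * norm (q - q')"
proof -
  have "\<bar>DF x \<bullet> (y - x)\<bar> \<le> K * norm (y - x)" if "x \<in> slope_box R" for x y
    using Cauchy_Schwarz_ineq2[of "DF x" "y - x"] DF_bound[OF that]
      mult_right_mono[of "norm (DF x)" K "norm (y - x)"] by simp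
  from this[OF assms(1), of q'] this[OF assms(2), of q] show ?thesis
    using tangent[of q q'] tangent[of q' q] by (simp add: norm_minus_commute)
qed

lemma A_nonneg: "0 \<le> A"
proof -
  have "0 \<le> (\<Sum>l\<in>Basis. DF 0 \<bullet> l)"
    using DF_nonneg[OF zero_in_slope_box] R by (simp add: sum_nonneg)
  also have "\<dots> \<le> A" using DF_sum_bound[OF zero_in_slope_box] R by simp
  finally show ?thesis .
qed

lemma scheme_le_refined_once:
  assumes h: "0 < h" and g: "admissible R c g" and c: "0 \<le> c"
  shows "fd_scheme F g h (\<rho> * h) n x
    \<le> fd_scheme F g (h / 2) (\<rho> * (h / 2)) (2 * n) x + 2 * c * A * h * (\<rho> * h * real n)"
proof (induction n arbitrary: x)
  case (Suc n)
  let ?V = "fd_scheme F g (h / 2) (\<rho> * (h / 2)) (2 * n)"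
  let ?e = "2 * c * A * h * (\<rho> * h * real n)"
  have V: "admissible R c ?V" using scheme_admissible[of "h/2", OF _ g] h by simp
  have v: "admissible R c (fd_scheme F g h (\<rho> * h) n)" by (rule scheme_admissible[OF h g])
  have "fd_scheme F g h (\<rho> * h) (Suc n) x \<le> fd_step F h (\<rho> * h) (\<lambda>y. ?V y + ?e) x"
    unfolding fd_scheme_Suc
    by (rule step_mono[OF h]) (use v V Suc in \<open>auto simp: admissible_def coord_lipschitz_def\<close>)
  also have "\<dots> = fd_step F h (\<rho> * h) ?V x + ?e" by (rule fd_step_add_const)
  also have "\<dots> \<le> fd_step F (h / 2) (\<rho> * (h / 2)) (fd_step F (h / 2) (\<rho> * (h / 2)) ?V) x
      + 2 * c * A * h * (\<rho> * h) + ?e"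
    using two_half_steps_ge[OF h V c DF_sum_bound] by simp
  also have "fd_step F (h / 2) (\<rho> * (h / 2)) (fd_step F (h / 2) (\<rho> * (h / 2)) ?V)
      = fd_scheme F g (h / 2) (\<rho> * (h / 2)) (2 * Suc n)"
    by (simp only: fd_scheme_Suc mult_Suc_right add_2_eq_Suc)
  finally show ?case by (simp add: algebra_simps)
qed simp

text \<open>The one-step losses are proportional to the square of the space step, so over a fixed time the
  \<open>k\<close>-th halving costs a multiple of \<open>h / 2\<^sup>k\<close>, and the losses form a geometric series.\<close>

lemma scheme_le_refined:
  assumes h: "0 < h" and g: "admissible R c g" and c: "0 \<le> c"
  shows "fd_scheme F g h (\<rho> * h) n x
    \<le> fd_scheme F g (h / 2 ^ k) (\<rho> * (h / 2 ^ k)) (n * 2 ^ k) x + 4 * c * A * h * (\<rho> * h * real n)"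
proof -
  define E where "E = 2 * c * A * h * (\<rho> * h * real n)"
  have E: "0 \<le> E" using h c A_nonneg lam by (simp add: E_def)
  have "fd_scheme F g h (\<rho> * h) n x
    \<le> fd_scheme F g (h / 2 ^ k) (\<rho> * (h / 2 ^ k)) (n * 2 ^ k) x + E * (2 - 2 / 2 ^ k)"
  proof (induction k)
    case (Suc k)
    have "0 < h / 2 ^ k" using h by simp
    from scheme_le_refined_once[OF this g c, of "n * 2 ^ k" x]
    have "fd_scheme F g (h / 2 ^ k) (\<rho> * (h / 2 ^ k)) (n * 2 ^ k) x
      \<le> fd_scheme F g (h / 2 ^ Suc k) (\<rho> * (h / 2 ^ Suc k)) (n * 2 ^ Suc k) x + E * (1 / 2 ^ k)"
      by (simp add: E_def mult.left_commute mult.commute)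
    with Suc show ?case by (simp add: right_diff_distrib)
  qed simp
  moreover have "E * (2 - 2 / 2 ^ k) \<le> E * 2" using E by (intro mult_left_mono) auto
  ultimately have "fd_scheme F g h (\<rho> * h) n x
    \<le> fd_scheme F g (h / 2 ^ k) (\<rho> * (h / 2 ^ k)) (n * 2 ^ k) x + E * 2" by linarith
  moreover have "E * 2 = 4 * c * A * h * (\<rho> * h * real n)" by (simp add: E_def)
  ultimately show ?thesis by (simp only:)
qed

lemma step_time_lipschitz:
  assumes "0 < h" "slopes h v x \<in> slope_box R"
  shows "\<bar>fd_step F h (\<rho> * h) v x - v x\<bar> \<le> \<rho> * h * M"
proof -
  have "\<bar>\<rho> * h * F (slopes h v x)\<bar> \<le> \<rho> * h * M"
    using F_bound[OF assms(2)] assms(1) lam by (simp add: abs_mult mult_left_mono)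
  then show ?thesis by (simp add: fd_step_def)
qed

lemma scheme_time_lipschitz:
  assumes h: "0 < h" and sl: "\<And>n x. slopes h (fd_scheme F g h (\<rho> * h) n) x \<in> slope_box R"
  shows "\<bar>fd_scheme F g h (\<rho> * h) (m + n) x - fd_scheme F g h (\<rho> * h) m x\<bar> \<le> \<rho> * h * real n * M"
proof (induction n)
  case (Suc n)
  have "\<bar>fd_scheme F g h (\<rho> * h) (m + Suc n) x - fd_scheme F g h (\<rho> * h) (m + n) x\<bar> \<le> \<rho> * h * M"
    unfolding add_Suc_right fd_scheme_Suc by (rule step_time_lipschitz[OF h sl])
  moreover have "\<rho> * h * real (Suc n) * M = \<rho> * h * real n * M + \<rho> * h * M"
    by (simp add: algebra_simps)
  ultimately show ?case using Suc by linarith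
qed simp

end

section \<open>Doubling of variables\<close>

text \<open>The function \<open>u (x, t) - w j y\<close> with penalties for \<open>x \<noteq> y\<close> and for \<open>t \<noteq> s j\<close>. The term
  \<open>\<eta> / (T - t)\<close> keeps maximum points away from the final time, where nothing is known
  about \<open>u\<close>, and \<open>\<theta> t\<close> makes the inequality for the subsolution strict.\<close>

definition doubling ::
    "((real ^ 'd) \<times> real \<Rightarrow> real) \<Rightarrow> ('j \<Rightarrow> real ^ 'd \<Rightarrow> real) \<Rightarrow> ('j \<Rightarrow> real) \<Rightarrow> real \<Rightarrow> real \<Rightarrow> real \<Rightarrow> real
      \<Rightarrow> real \<Rightarrow> real ^ 'd \<Rightarrow> real \<Rightarrow> real ^ 'd \<Rightarrow> 'j \<Rightarrow> real" where
  "doubling u w s T \<alpha> \<beta> \<theta> \<eta> x t y j =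
     u (x, t) - w j y - (norm (x - y))\<^sup>2 / (2 * \<alpha>) - \<beta> * (t - s j)\<^sup>2 - \<theta> * t - \<eta> / (T - t)"

text \<open>Simultaneous translation of \<open>x\<close> and \<open>y\<close> by a lattice vector changes nothing, so \<open>x\<close> may be taken in
  the cell; the penalties then confine \<open>y\<close> and \<open>t\<close> to a compact set.\<close>

lemma doubling_attains_maximum:
  fixes u :: "(real ^ 'd) \<times> real \<Rightarrow> real" and w :: "'j \<Rightarrow> real ^ 'd \<Rightarrow> real"
  assumes T: "0 < T" and cont: "continuous_on (UNIV \<times> {0..T}) u"
    and per: "\<And>t. t \<in> {0..T} \<Longrightarrow> torus_periodic (\<lambda>x. u (x, t))"
    and J: "finite J" "J \<noteq> {}" and w: "\<And>j. j \<in> J \<Longrightarrow> torus_periodic (w j)"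
      "\<And>j. j \<in> J \<Longrightarrow> continuous_on UNIV (w j)"
    and pos: "0 < \<alpha>" "0 \<le> \<beta>" "0 < \<eta>"
  obtains x0 t0 y0 j0 where "j0 \<in> J" "0 \<le> t0" "t0 < T"
    "\<And>x t y j. 0 \<le> t \<Longrightarrow> t < T \<Longrightarrow> j \<in> J \<Longrightarrow>
       doubling u w s T \<alpha> \<beta> \<theta> \<eta> x t y j \<le> doubling u w s T \<alpha> \<beta> \<theta> \<eta> x0 t0 y0 j0"
proof -
  let ?D = "doubling u w s T \<alpha> \<beta> \<theta> \<eta>"
  obtain j1 where j1: "j1 \<in> J" using J by blast
  have per_shift: "?D (x + z) t (y + z) j = ?D x t y j"
    if "j \<in> J" "0 \<le> t" "t < T" "\<And>i. z $ i \<in> \<int>" for x t y j z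
    using torus_periodic_lattice[OF w(1)[OF that(1)] that(4)]
      torus_periodic_lattice[OF per[of t] that(4)] that by (simp add: doubling_def)
  have "bounded (u ` (cbox 0 1 \<times> {0..T}))"
    by (intro compact_imp_bounded compact_continuous_image continuous_on_subset[OF cont] compact_Times) auto
  then obtain Bu where Bu: "\<And>z. z \<in> cbox 0 1 \<times> {0..T} \<Longrightarrow> \<bar>u z\<bar> \<le> Bu"
    unfolding bounded_iff by fastforce
  have "\<exists>B. \<forall>y. \<bar>w j y\<bar> \<le> B" if "j \<in> J" for j
    using torus_periodic_bounded[OF w(1)[OF that] w(2)[OF that]] by (metis real_norm_def)
  then obtain b where b: "\<And>j y. j \<in> J \<Longrightarrow> \<bar>w j y\<bar> \<le> b j" by metis
  define B where "B = \<bar>Bu\<bar> + (\<Sum>j\<in>J. \<bar>b j\<bar>)"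
  have B: "\<bar>u (x, t)\<bar> \<le> B" "\<bar>w j y\<bar> \<le> B" if "x \<in> cbox 0 1" "0 \<le> t" "t < T" "j \<in> J" for x t y j
  proof -
    have "\<bar>b j\<bar> \<le> (\<Sum>j\<in>J. \<bar>b j\<bar>)" using J(1) that(4) member_le_sum[of j J "\<lambda>j. \<bar>b j\<bar>"] by auto
    then show "\<bar>w j y\<bar> \<le> B" using b[OF that(4), of y] unfolding B_def by linarith
    have "0 \<le> (\<Sum>j\<in>J. \<bar>b j\<bar>)" by (simp add: sum_nonneg)
    moreover have "(x, t) \<in> cbox 0 1 \<times> {0..T}" using that by auto
    then have "\<bar>u (x, t)\<bar> \<le> Bu" by (rule Bu)
    ultimately show "\<bar>u (x, t)\<bar> \<le> B" unfolding B_def by linarith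
  qed
  define V where "V = ?D 0 0 0 j1"
  define D where "D = 2 * B + \<bar>\<theta>\<bar> * T - V"
  have zero_cell: "(0 :: real ^ 'd) \<in> cbox 0 1" by (simp add: mem_box_cart)
  have upper: "?D x t y j \<le> 2 * B + \<bar>\<theta>\<bar> * T - (norm (x - y))\<^sup>2 / (2 * \<alpha>) - \<eta> / (T - t)"
    if "x \<in> cbox 0 1" "0 \<le> t" "t < T" "j \<in> J" for x t y j
  proof -
    have "- \<theta> * t \<le> \<bar>\<theta>\<bar> * t" using that(2) mult_right_mono[of "- \<theta>" "\<bar>\<theta>\<bar>" t] by simp
    also have "\<dots> \<le> \<bar>\<theta>\<bar> * T" using that by (intro mult_left_mono) auto
    finally have "- \<theta> * t \<le> \<bar>\<theta>\<bar> * T" .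
    moreover have "0 \<le> \<beta> * (t - s j)\<^sup>2" using pos by simp
    ultimately show ?thesis using B(1)[OF that] B(2)[OF that, of y] unfolding doubling_def by linarith
  qed
  have D: "0 < D"
  proof -
    have "V \<le> 2 * B + \<bar>\<theta>\<bar> * T - \<eta> / T"
      using upper[OF zero_cell _ T j1, of 0] by (simp add: V_def)
    moreover have "0 < \<eta> / T" using pos T by simp
    ultimately show ?thesis unfolding D_def by linarith
  qed
  \<comment> \<open>Outside the compact set given by \<open>r\<close> and \<open>\<sigma>\<close> the function is below its value \<open>V\<close> at the origin.\<close>
  define r where "r = 2 * \<alpha> * D + 1"
  define \<sigma> where "\<sigma> = \<eta> / D"
  have \<sigma>: "0 < \<sigma>" using pos D by (simp add: \<sigma>_def)
  have inside: "norm (x - y) \<le> r \<and> t \<le> T - \<sigma>"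
    if x: "x \<in> cbox 0 1" "0 \<le> t" "t < T" "j \<in> J" and le: "V \<le> ?D x t y j" for x t y j
  proof -
    have p1: "0 \<le> (norm (x - y))\<^sup>2 / (2 * \<alpha>)" and p2: "0 < \<eta> / (T - t)"
      using pos x by simp_all
    have "(norm (x - y))\<^sup>2 / (2 * \<alpha>) \<le> D" using upper[OF x, of y] le p2 unfolding D_def by linarith
    then have "(norm (x - y))\<^sup>2 \<le> 2 * \<alpha> * D" using pos by (simp add: pos_divide_le_eq mult.commute)
    also have "\<dots> \<le> r\<^sup>2"
      using pos D by (simp add: r_def power2_eq_square algebra_simps add_nonneg_pos)
    finally have "norm (x - y) \<le> r"
      by (rule power2_le_imp_le) (use pos D in \<open>simp add: r_def\<close>)
    moreover have "\<eta> / (T - t) \<le> D" using upper[OF x, of y] le p1 unfolding D_def by linarith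
    then have "\<eta> \<le> D * (T - t)" using x by (simp add: pos_divide_le_eq)
    then have "t \<le> T - \<sigma>" using D by (simp add: \<sigma>_def field_simps)
    ultimately show ?thesis by blast
  qed
  let ?K = "cbox 0 (1 :: real ^ 'd) \<times> ({0..T - \<sigma>} \<times> cball (0 :: real ^ 'd) r)"
  have K: "compact ?K" by (intro compact_Times compact_cball compact_cbox compact_Icc)
  have ref: "(0, 0, 0) \<in> ?K"
    using inside[OF zero_cell _ T j1, of 0] zero_cell pos D by (simp add: V_def r_def)
  have contK: "continuous_on ?K (\<lambda>(x, t, z). ?D x t (x + z) j)" if "j \<in> J" for j
  proof -
    have u: "continuous_on ?K (\<lambda>p. u (fst p, fst (snd p)))"
      by (rule continuous_on_compose2[OF cont]) (use \<sigma> in \<open>auto intro!: continuous_intros\<close>)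
    have w': "continuous_on ?K (\<lambda>p. w j (fst p + snd (snd p)))"
      by (rule continuous_on_compose2[OF w(2)[OF that]]) (auto intro!: continuous_intros)
    have "continuous_on ?K (\<lambda>p. \<eta> / (T - fst (snd p)))"
      by (intro continuous_intros) (use \<sigma> in auto)
    then show ?thesis
      unfolding doubling_def split_beta using pos \<sigma> by (intro continuous_intros u w') auto
  qed
  define G where "G j = (\<lambda>(x, t, z). ?D x t (x + z) j)" for j
  have "\<forall>j\<in>J. \<exists>p. p \<in> ?K \<and> (\<forall>p'\<in>?K. G j p' \<le> G j p)"
    using continuous_attains_sup[OF K _ contK] ref unfolding G_def by blast
  from bchoice[OF this] obtain p where p: "\<And>j. j \<in> J \<Longrightarrow> p j \<in> ?K"
    "\<And>j p'. j \<in> J \<Longrightarrow> p' \<in> ?K \<Longrightarrow> G j p' \<le> G j (p j)"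
    by blast
  define val where "val j = G j (p j)" for j
  obtain j0 where j0: "j0 \<in> J" "\<And>j. j \<in> J \<Longrightarrow> val j \<le> val j0"
  proof -
    have "Max (val ` J) \<in> val ` J" using J by (intro Max_in) auto
    then obtain j0 where "j0 \<in> J" "val j0 = Max (val ` J)" by auto
    then show thesis using that J(1) by (metis Max_ge finite_imageI imageI)
  qed
  obtain x0 t0 z0 where p0: "p j0 = (x0, t0, z0)" by (metis prod_cases3)
  have t0: "0 \<le> t0" "t0 < T" using p(1)[OF j0(1)] \<sigma> unfolding p0 by auto
  have val0: "val j0 = ?D x0 t0 (x0 + z0) j0" by (simp add: val_def G_def p0)
  have "?D x t y j \<le> val j0" if t: "0 \<le> t" "t < T" and j: "j \<in> J" for x t y j
  proof -
    obtain z where z: "\<And>i. z $ i \<in> \<int>" "x + z \<in> cbox 0 1"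
      using lattice_translate_to_cell by blast
    have eq: "?D (x + z) t (y + z) j = ?D x t y j" by (rule per_shift[OF j t z(1)])
    show ?thesis
    proof (cases "V \<le> ?D x t y j")
      case True
      then have "norm ((x + z) - (y + z)) \<le> r \<and> t \<le> T - \<sigma>"
        by (intro inside[OF z(2) t j]) (simp only: eq)
      then have "(x + z, t, (y + z) - (x + z)) \<in> ?K"
        using z(2) t by (simp add: norm_minus_commute)
      from p(2)[OF j this] have "?D (x + z) t (y + z) j \<le> val j"
        by (simp add: val_def G_def add.commute)
      then show ?thesis using j0(2)[OF j] eq by linarith
    next
      case False
      have "V \<le> val j1" using p(2)[OF j1 ref] by (simp add: V_def val_def G_def)
      then show ?thesis using False j0(2)[OF j1] by linarith
    qed
  qed
  from that[OF j0(1) t0 this[unfolded val0]] show thesis .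
qed

text \<open>In the second argument the maximality of \<open>y\<^sub>0\<close> exhibits \<open>p\<close> as a subgradient of
  a function with slopes at most \<open>R\<close>; in the first argument it makes \<open>u\<close> touched from above by a
  smooth function with spatial gradient \<open>p\<close>.\<close>

lemma doubling_maximum_slope:
  fixes u :: "(real ^ 'd) \<times> real \<Rightarrow> real"
  assumes max: "\<And>y. doubling u w s T \<alpha> \<beta> \<theta> \<eta> x0 t0 y j0 \<le> doubling u w s T \<alpha> \<beta> \<theta> \<eta> x0 t0 y0 j0"
    and w: "coord_lipschitz R (w j0)" and \<alpha>: "0 < \<alpha>"
  shows "\<bar>((1 / \<alpha>) *\<^sub>R (x0 - y0)) $ i\<bar> \<le> R"
proof -
  let ?d = "x0 - y0"
  let ?p = "?d $ i / \<alpha>"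
  have key: "r * ?p \<le> R * \<bar>r\<bar> + r\<^sup>2 / (2 * \<alpha>)" for r
  proof -
    have "(norm (x0 - (y0 + r *\<^sub>R axis i 1)))\<^sup>2 = (norm (?d - r *\<^sub>R axis i 1))\<^sup>2"
      by (simp add: algebra_simps)
    also have "\<dots> = (norm ?d)\<^sup>2 - 2 * r * ?d $ i + r\<^sup>2"
      unfolding power2_norm_eq_inner
      by (simp add: inner_diff_left inner_diff_right inner_axis inner_axis' power2_eq_square algebra_simps)
    finally have "w j0 y0 - w j0 (y0 + r *\<^sub>R axis i 1)
      \<le> ((norm ?d)\<^sup>2 - 2 * r * ?d $ i + r\<^sup>2) / (2 * \<alpha>) - (norm ?d)\<^sup>2 / (2 * \<alpha>)"
      using max[of "y0 + r *\<^sub>R axis i 1"] unfolding doubling_def by simp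
    also have "\<dots> = r\<^sup>2 / (2 * \<alpha>) - r * ?p"
      using \<alpha> by (simp add: field_simps)
    finally show ?thesis
      using w[unfolded coord_lipschitz_def, rule_format, of y0 r i] by linarith
  qed
  have "?p \<le> R + e" "- ?p \<le> R + e" if "0 < e" for e
  proof -
    let ?r = "2 * \<alpha> * e"
    have r: "0 < ?r" using that \<alpha> by simp
    have "?r * ?p \<le> ?r * (R + e)"
      using key[of ?r] r \<alpha> by (simp add: power2_eq_square field_simps)
    then show "?p \<le> R + e" using r mult_le_cancel_left_pos by blast
    have "?r * (- ?p) \<le> ?r * (R + e)"
      using key[of "- ?r"] r \<alpha> by (simp add: power2_eq_square field_simps)
    then show "- ?p \<le> R + e" using r mult_le_cancel_left_pos by blast
  qed
  then have "?p \<le> R" "- ?p \<le> R" using field_le_epsilon by blast+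
  then show ?thesis by (simp add: abs_le_iff)
qed

lemma doubling_maximum_subsolution:
  fixes u :: "(real ^ 'd) \<times> real \<Rightarrow> real"
  assumes sub: "viscosity_subsolution H T u"
    and max: "\<And>x t. 0 \<le> t \<Longrightarrow> t < T \<Longrightarrow>
      doubling u w s T \<alpha> \<beta> \<theta> \<eta> x t y0 j0 \<le> doubling u w s T \<alpha> \<beta> \<theta> \<eta> x0 t0 y0 j0"
    and t0: "0 < t0" "t0 < T" and pos: "0 < \<alpha>" "0 < \<eta>"
  shows "2 * \<beta> * (t0 - s j0) + \<theta> + H ((1 / \<alpha>) *\<^sub>R (x0 - y0)) \<le> 0"
proof -
  let ?\<phi> = "\<lambda>z :: (real ^ 'd) \<times> real. (norm (fst z - y0))\<^sup>2 / (2 * \<alpha>) + \<beta> * (snd z - s j0)\<^sup>2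
      + \<theta> * snd z + \<eta> / (T - snd z)"
  let ?D = "\<lambda>z :: (real ^ 'd) \<times> real. ((1 / \<alpha>) *\<^sub>R (fst z - y0),
      2 * \<beta> * (snd z - s j0) + \<theta> + \<eta> / (T - snd z)\<^sup>2)"
  have "GDERIV ?\<phi> z :> ?D z" if z: "z \<in> UNIV \<times> {0<..<T}" for z
  proof -
    have T: "T - snd z \<noteq> 0" using z by auto
    have 1: "((\<lambda>z. (norm (fst z - y0))\<^sup>2 / (2 * \<alpha>)) has_derivative
        (\<lambda>h. fst h \<bullet> ((1 / \<alpha>) *\<^sub>R (fst z - y0)))) (at z)"
    proof -
      have "((\<lambda>z. (fst z - y0) \<bullet> (fst z - y0)) has_derivative
          (\<lambda>h. (fst z - y0) \<bullet> fst h + fst h \<bullet> (fst z - y0))) (at z)"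
        by (intro has_derivative_inner) (auto intro!: derivative_eq_intros)
      from bounded_linear.has_derivative[OF bounded_linear_divide this, of "2 * \<alpha>"]
      show ?thesis
        unfolding power2_norm_eq_inner
        by (rule has_derivative_eq_rhs) (use pos in \<open>simp add: inner_commute fun_eq_iff\<close>)
    qed
    have 2: "((\<lambda>z. \<beta> * (snd z - s j0)\<^sup>2 + \<theta> * snd z + \<eta> / (T - snd z)) has_derivative
        (\<lambda>h. snd h * (2 * \<beta> * (snd z - s j0) + \<theta> + \<eta> / (T - snd z)\<^sup>2))) (at z)"
    proof -
      have "((\<lambda>t. \<beta> * (t - s j0)\<^sup>2 + \<theta> * t + \<eta> / (T - t)) has_real_derivative
          2 * \<beta> * (snd z - s j0) + \<theta> + \<eta> / (T - snd z)\<^sup>2) (at (snd z))"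
        using T by (auto intro!: derivative_eq_intros simp: power2_eq_square)
      then have "((\<lambda>t. \<beta> * (t - s j0)\<^sup>2 + \<theta> * t + \<eta> / (T - t)) has_derivative
          (\<lambda>t. t * (2 * \<beta> * (snd z - s j0) + \<theta> + \<eta> / (T - snd z)\<^sup>2))) (at (snd z))"
        by (simp add: has_field_derivative_def mult_commute_abs)
      from has_derivative_compose[OF has_derivative_snd[OF has_derivative_ident] this]
      show ?thesis .
    qed
    show ?thesis
      unfolding gderiv_def using has_derivative_add[OF 1 2] by (simp add: inner_prod_def add.assoc)
  qed
  moreover have "continuous_on (UNIV \<times> {0<..<T}) ?D"
    by (intro continuous_intros) auto
  ultimately have test: "C1_test_fun T ?\<phi> ?D" unfolding C1_test_fun_def by blast
  have z0: "(x0, t0) \<in> UNIV \<times> {0<..<T}" using t0 by simp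
  have "open (UNIV \<times> {0<..<T} :: ((real ^ 'd) \<times> real) set)" by (intro open_Times) auto
  then have "\<forall>\<^sub>F y in nhds (x0, t0). y \<in> UNIV \<times> {0<..<T}"
    using z0 eventually_nhds by blast
  then have "\<forall>\<^sub>F y in nhds (x0, t0). u y - ?\<phi> y \<le> u (x0, t0) - ?\<phi> (x0, t0)"
  proof eventually_elim
    case (elim y)
    then show ?case
      using max[of "snd y" "fst y"] by (auto simp: doubling_def algebra_simps)
  qed
  from sub[unfolded viscosity_subsolution_def, rule_format, OF test z0 this]
  have "2 * \<beta> * (t0 - s j0) + \<theta> + \<eta> / (T - t0)\<^sup>2 + H ((1 / \<alpha>) *\<^sub>R (x0 - y0)) \<le> 0"
    by simp
  moreover have "0 \<le> \<eta> / (T - t0)\<^sup>2" using pos by simp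
  ultimately show ?thesis by linarith
qed

lemma le_of_forall_small_error:
  fixes a b c :: real
  assumes "\<And>e. 0 < e \<Longrightarrow> a \<le> b + e * c"
  shows "a \<le> b"
proof (rule field_le_epsilon)
  fix e :: real assume "0 < e"
  let ?d = "e / (\<bar>c\<bar> + 1)"
  have "0 < ?d" using \<open>0 < e\<close> by (simp add: add_nonneg_pos)
  have "?d * c \<le> ?d * (\<bar>c\<bar> + 1)" using \<open>0 < ?d\<close> by (intro mult_left_mono) auto
  then have "?d * c \<le> e" by simp
  with assms[OF \<open>0 < ?d\<close>] show "a \<le> b + e" by linarith
qed

lemma linear_minus_quadratic_le:
  fixes \<alpha> :: real
  assumes "0 < \<alpha>"
  shows "L * d - d\<^sup>2 / (2 * \<alpha>) \<le> L\<^sup>2 * \<alpha> / 2"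
proof -
  have "0 \<le> (d - L * \<alpha>)\<^sup>2 / (2 * \<alpha>)" using assms by simp
  also have "\<dots> = d\<^sup>2 / (2 * \<alpha>) - L * d + L\<^sup>2 * \<alpha> / 2"
    using assms by (simp add: field_simps power2_eq_square)
  finally show ?thesis by linarith
qed

lemma inner_diagonal:
  fixes p :: "real ^ 'd"
  assumes "l \<in> Basis"
  shows "(- p, p) \<bullet> l = - (dir l \<bullet> p)"
  using assms by (cases rule: Basis_pair_cases) (simp_all add: dir_def inner_commute)

lemma diagonal_in_slope_box:
  fixes p :: "real ^ 'd"
  assumes "\<And>i. \<bar>p $ i\<bar> \<le> R"
  shows "(- p, p) \<in> slope_box R"
  unfolding mem_slope_box
proof
  fix l :: "(real ^ 'd) \<times> (real ^ 'd)" assume "l \<in> Basis"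
  then show "\<bar>(- p, p) \<bullet> l\<bar> \<le> R"
    using assms by (cases rule: Basis_pair_cases) (simp_all add: inner_axis)
qed

text \<open>Doubling with the datum itself, independent of time, as comparison function: for \<open>\<theta> > M\<close> no
  maximum point can have positive time.\<close>

lemma subsolution_initial_growth:
  fixes u :: "(real ^ 'd) \<times> real \<Rightarrow> real" and g :: "real ^ 'd \<Rightarrow> real"
  assumes T: "0 < T" and sub: "viscosity_subsolution H T u"
    and cont: "continuous_on (UNIV \<times> {0..T}) u"
    and per: "\<And>t. t \<in> {0..T} \<Longrightarrow> torus_periodic (\<lambda>x. u (x, t))"
    and u0: "\<And>x. u (x, 0) = g x"
    and g: "torus_periodic g" "coord_lipschitz R g"
    and H: "\<And>p. (\<And>i. \<bar>p $ i\<bar> \<le> R) \<Longrightarrow> - H p \<le> M"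
    and t: "0 \<le> t" "t < T"
  shows "u (x, t) \<le> g x + M * t"
proof (rule le_of_forall_small_error)
  fix e :: real assume e: "0 < e"
  let ?L = "R * real CARD('d)"
  let ?D = "doubling u (\<lambda>_::unit. g) (\<lambda>_. 0) T e 0 (M + e) e"
  have fin: "finite {()}" "{()} \<noteq> {}" by auto
  obtain x0 t0 y0 and j0 :: unit where m: "0 \<le> t0" "t0 < T"
    "\<And>x t y j. 0 \<le> t \<Longrightarrow> t < T \<Longrightarrow> ?D x t y j \<le> ?D x0 t0 y0 j0"
    by (rule doubling_attains_maximum[OF T cont per fin, of "\<lambda>_. g" e 0 e "\<lambda>_. 0" "M + e"])
       (use g e coord_lipschitz_continuous[OF g(2)] in auto)
  let ?p = "(1 / e) *\<^sub>R (x0 - y0)"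
  have p: "\<bar>?p $ i\<bar> \<le> R" for i
    by (rule doubling_maximum_slope[OF m(3)[OF m(1,2)] g(2) e])
  have "t0 = 0"
  proof (rule ccontr)
    assume "t0 \<noteq> 0"
    then have "2 * 0 * (t0 - 0) + (M + e) + H ?p \<le> 0"
      using m(1) by (intro doubling_maximum_subsolution[OF sub m(3) _ m(2) e e]) auto
    then show False using H[OF p] e by linarith
  qed
  have "?D x t x j0 \<le> ?D x0 t0 y0 j0" by (rule m(3)[OF t])
  then have "u (x, t) - g x - (M + e) * t - e / (T - t)
      \<le> g x0 - g y0 - (norm (x0 - y0))\<^sup>2 / (2 * e) - e / T"
    by (simp add: doubling_def \<open>t0 = 0\<close> u0)
  also have "\<dots> \<le> ?L * norm (x0 - y0) - (norm (x0 - y0))\<^sup>2 / (2 * e)"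
  proof -
    have "0 \<le> e / T" using e T by simp
    then show ?thesis using coord_lipschitz_norm[OF g(2), of x0 y0] by linarith
  qed
  also have "\<dots> \<le> ?L\<^sup>2 * e / 2" by (rule linear_minus_quadratic_le[OF e])
  finally have "u (x, t) - g x - (M + e) * t - e / (T - t) \<le> ?L\<^sup>2 * e / 2" .
  moreover have "e * (t + 1 / (T - t) + ?L\<^sup>2 / 2) = e * t + e / (T - t) + ?L\<^sup>2 * e / 2"
    by (simp only: distrib_left times_divide_eq_right mult_1_right mult.commute)
  ultimately show "u (x, t) \<le> g x + M * t + e * (t + 1 / (T - t) + ?L\<^sup>2 / 2)"
    by (simp only: distrib_right)
qed

lemma le_of_le_before:
  fixes f :: "real \<Rightarrow> real"
  assumes cont: "continuous_on {0..T} f" and r: "0 < r" "r \<le> T"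
    and le: "\<And>t. 0 \<le> t \<Longrightarrow> t < r \<Longrightarrow> f t \<le> c"
  shows "f r \<le> c"
proof -
  let ?t = "\<lambda>k. r - r / real (Suc (Suc k))"
  have "(\<lambda>k. r / real (Suc (Suc k))) \<longlonglongrightarrow> 0"
    using LIMSEQ_Suc[OF LIMSEQ_Suc[OF lim_const_over_n[of r]]] by simp
  then have lim: "?t \<longlonglongrightarrow> r" using tendsto_diff[OF tendsto_const[of r]] by fastforce
  have t: "0 \<le> ?t k" "?t k < r" for k
    using r by (simp_all add: field_simps)
  have "?t k \<in> {0..T}" for k
    unfolding atLeastAtMost_iff using t[of k] r(2) by linarith
  moreover have "r \<in> {0..T}" using r by simp
  ultimately have "(\<lambda>k. f (?t k)) \<longlonglongrightarrow> f r"
    by (intro continuous_on_tendsto_compose[OF cont lim] always_eventually) auto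
  then show ?thesis
    by (rule tendsto_upperbound) (use le[OF t] in auto)
qed

text \<open>At a maximum with positive time and positive level the earlier iterate \<open>v\<close> is touched from below by
  a paraboloid, and applying the monotone step to both shows that the scheme is a supersolution with an error
  of order \<open>h / \<alpha>\<close>. Neighbouring values of the paraboloid that lie too low for the slope box are
  raised to the slope \<open>R\<close>; \<open>v\<close> stays above because its own slopes are at most \<open>R\<close>.\<close>

lemma scheme_maximum_supersolution:
  fixes v w :: "real ^ 'd \<Rightarrow> real"
  assumes mono: "box_monotone F R h \<tau>" and h: "0 < h" and \<tau>: "0 < \<tau>" and \<alpha>: "0 < \<alpha>"
    and Fl: "\<And>q q'. q \<in> slope_box R \<Longrightarrow> q' \<in> slope_box R \<Longrightarrow> \<bar>F q - F q'\<bar> \<le> K * norm (q - q')"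
    and K: "0 \<le> K"
    and v: "coord_lipschitz R v" and w: "w = fd_step F h \<tau> v"
    and p: "\<And>i. \<bar>((1 / \<alpha>) *\<^sub>R (x0 - y0)) $ i\<bar> \<le> R"
    and below: "\<And>y. w y0 + ((norm (x0 - y0))\<^sup>2 - (norm (x0 - y))\<^sup>2) / (2 * \<alpha>) - \<tau> * b \<le> v y"
  defines "p \<equiv> (1 / \<alpha>) *\<^sub>R (x0 - y0)"
  shows "- (K * real (DIM((real ^ 'd) \<times> (real ^ 'd))) * h) / (2 * \<alpha>) \<le> b + F (- p, p)"
proof -
  let ?c = "w y0 - \<tau> * b"
  let ?r = "\<lambda>l. min R (- (dir l \<bullet> p) + h / (2 * \<alpha>))"
  define q where "q = (\<Sum>l\<in>Basis. ?r l *\<^sub>R l)"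
  have ql: "q \<bullet> l = ?r l" if "l \<in> Basis" for l
    unfolding q_def using that by (rule inner_sum_left_Basis)
  have R: "0 \<le> R" using p[of undefined] by linarith
  have diag: "(- p, p) \<in> slope_box R" unfolding p_def by (rule diagonal_in_slope_box[OF p])
  have dp: "\<bar>dir l \<bullet> p\<bar> \<le> R" if "l \<in> Basis" for l
    using diag that unfolding mem_slope_box by (simp add: inner_diagonal)
  have ha: "0 \<le> h / (2 * \<alpha>)" using h \<alpha> by simp
  have qbox: "q \<in> slope_box R"
    unfolding mem_slope_box
  proof
    fix l :: "(real ^ 'd) \<times> (real ^ 'd)" assume l: "l \<in> Basis"
    show "\<bar>q \<bullet> l\<bar> \<le> R" using dp[OF l] ha R unfolding ql[OF l] by (auto simp: abs_le_iff min_def)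
  qed
  have c: "?c \<le> v y0" using below[of y0] by simp
  have nb: "?c - h * (q \<bullet> l) \<le> v y0 - h * (slopes h v y0 \<bullet> l)" if l: "l \<in> Basis" for l
  proof -
    have s: "v y0 - h * (slopes h v y0 \<bullet> l) = v (y0 + h *\<^sub>R dir l)"
      using l h by (simp add: slopes_inner)
    show ?thesis
    proof (cases "R \<le> - (dir l \<bullet> p) + h / (2 * \<alpha>)")
      case True
      then have "q \<bullet> l = R" using ql[OF l] by simp
      moreover have "v y0 - R * h \<le> v (y0 + h *\<^sub>R dir l)"
        using coord_lipschitz_dir[OF v l, of y0 h] h by (simp add: abs_le_iff)
      ultimately show ?thesis unfolding s using c by (simp add: mult.commute)
    next
      case False
      then have q': "q \<bullet> l = - (dir l \<bullet> p) + h / (2 * \<alpha>)" using ql[OF l] by simp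
      have "(norm (x0 - (y0 + h *\<^sub>R dir l)))\<^sup>2 = (norm ((x0 - y0) - h *\<^sub>R dir l))\<^sup>2"
        by (simp add: algebra_simps)
      also have "\<dots> = (norm (x0 - y0))\<^sup>2 - 2 * h * (dir l \<bullet> (x0 - y0)) + h\<^sup>2 * (norm (dir l))\<^sup>2"
        unfolding power2_norm_eq_inner
        by (simp add: inner_diff_left inner_diff_right power2_eq_square algebra_simps inner_commute)
      finally have n: "(norm (x0 - y0))\<^sup>2 - (norm (x0 - (y0 + h *\<^sub>R dir l)))\<^sup>2
          = 2 * h * (dir l \<bullet> (x0 - y0)) - h\<^sup>2"
        using l by (simp add: norm_dir)
      have dpx: "dir l \<bullet> p = (dir l \<bullet> (x0 - y0)) / \<alpha>" by (simp add: p_def)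
      have "- (h * (q \<bullet> l)) = (2 * h * (dir l \<bullet> (x0 - y0)) - h\<^sup>2) / (2 * \<alpha>)"
        unfolding q' dpx using \<alpha> by (simp add: field_simps power2_eq_square)
      then show ?thesis using below[of "y0 + h *\<^sub>R dir l"] unfolding s n by linarith
    qed
  qed
  have "?c - \<tau> * F q \<le> v y0 - \<tau> * F (slopes h v y0)"
    using mono[unfolded box_monotone_def, rule_format, OF qbox coord_lipschitz_slopes[OF v h] c nb] by blast
  then have "?c - \<tau> * F q \<le> w y0" by (simp add: w fd_step_def)
  then have "0 \<le> \<tau> * (b + F q)" by (simp add: algebra_simps)
  then have bF: "0 \<le> b + F q" using \<tau> by (simp add: zero_le_mult_iff)
  have "norm (q - (- p, p)) \<le> (\<Sum>l\<in>Basis. \<bar>(q - (- p, p)) \<bullet> l\<bar>)" by (rule norm_le_l1)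
  also have "\<dots> \<le> (\<Sum>l\<in>(Basis :: ((real ^ 'd) \<times> (real ^ 'd)) set). h / (2 * \<alpha>))"
  proof (rule sum_mono)
    fix l :: "(real ^ 'd) \<times> (real ^ 'd)" assume l: "l \<in> Basis"
    show "\<bar>(q - (- p, p)) \<bullet> l\<bar> \<le> h / (2 * \<alpha>)"
      unfolding inner_diff_left ql[OF l] inner_diagonal[OF l]
      using dp[OF l] ha by (auto simp: abs_le_iff min_def)
  qed
  also have "\<dots> = real (DIM((real ^ 'd) \<times> (real ^ 'd))) * (h / (2 * \<alpha>))" by simp
  finally have "K * norm (q - (- p, p)) \<le> K * (real (DIM((real ^ 'd) \<times> (real ^ 'd))) * (h / (2 * \<alpha>)))"
    using K by (rule mult_left_mono)
  then have "F q \<le> F (- p, p) + K * (real (DIM((real ^ 'd) \<times> (real ^ 'd))) * (h / (2 * \<alpha>)))"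
    using Fl[OF qbox diag] by linarith
  then show ?thesis using bF by simp
qed

text \<open>With \<open>\<alpha>\<close> of the order of the square root of the steps the consistency error \<open>(h + \<tau>) / \<alpha>\<close> and the
  penalization error \<open>\<alpha>\<close> balance. A slightly larger \<open>\<theta>\<close> excludes
  maximum points at which both times are positive; if one of the times vanishes, Lipschitz bounds
  in time and space control the value. The final time is reached by continuity.\<close>

lemma subsolution_le_scheme:
  fixes u :: "(real ^ 'd) \<times> real \<Rightarrow> real" and g :: "real ^ 'd \<Rightarrow> real"
  assumes T: "0 < T" and sub: "viscosity_subsolution H T u"
    and cont: "continuous_on (UNIV \<times> {0..T}) u"
    and per: "\<And>t. t \<in> {0..T} \<Longrightarrow> torus_periodic (\<lambda>x. u (x, t))"
    and u0: "\<And>x. u (x, 0) = g x"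
    and FH: "\<And>p. F (- p, p) = H p"
    and Fb: "\<And>q. q \<in> slope_box R \<Longrightarrow> \<bar>F q\<bar> \<le> M"
    and Fl: "\<And>q q'. q \<in> slope_box R \<Longrightarrow> q' \<in> slope_box R \<Longrightarrow> \<bar>F q - F q'\<bar> \<le> K * norm (q - q')"
    and K: "0 \<le> K" and M: "0 \<le> M"
    and mono: "box_monotone F R h \<tau>" and h: "0 < h" and \<tau>: "0 < \<tau>"
    and v0: "v 0 = g" and v: "\<And>n. v (Suc n) = fd_step F h \<tau> (v n)"
      "\<And>n. torus_periodic (v n)" "\<And>n. coord_lipschitz R (v n)"
    and n: "real n * \<tau> \<le> T"
  shows "u (x, real n * \<tau>) - v n x
    \<le> (((R * real CARD('d))\<^sup>2 + M\<^sup>2) / 2 + (1 + K * real (DIM((real ^ 'd) \<times> (real ^ 'd)))) * T / 2) * sqrt (h + \<tau>)"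
proof -
  let ?L = "R * real CARD('d)"
  define m where "m = K * real (DIM((real ^ 'd) \<times> (real ^ 'd)))"
  define \<alpha> where "\<alpha> = sqrt (h + \<tau>)"
  have \<alpha>: "0 < \<alpha>" "\<alpha>\<^sup>2 = h + \<tau>" using h \<tau> by (simp_all add: \<alpha>_def)
  define \<beta> where "\<beta> = 1 / (2 * \<alpha>)"
  have \<beta>: "0 \<le> \<beta>" using \<alpha> by (simp add: \<beta>_def)
  have m0: "0 \<le> m" using K by (simp add: m_def)
  \<comment> \<open>The consistency error of the scheme at a maximum point; with any larger \<open>\<theta>\<close> the
    subsolution inequality contradicts it.\<close>
  define \<theta>0 where "\<theta>0 = (\<tau> + m * h) / (2 * \<alpha>)"
  have \<theta>0: "0 \<le> \<theta>0" using \<tau> h \<alpha> m0 by (simp add: \<theta>0_def)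
  have \<theta>0_le: "\<theta>0 \<le> (1 + m) / 2 * \<alpha>"
  proof -
    have "\<tau> + m * h \<le> (1 + m) * (h + \<tau>)" using m0 h \<tau> by (simp add: distrib_left distrib_right)
    also have "\<dots> = (1 + m) * \<alpha> * \<alpha>" using \<alpha>(2) by (simp add: power2_eq_square)
    finally show ?thesis using \<alpha>(1) by (simp add: \<theta>0_def field_simps)
  qed
  have v_time: "v j y \<ge> g y - M * (real j * \<tau>)" for j y
  proof (induction j)
    case (Suc j)
    have "F (slopes h (v j) y) \<le> M" using Fb[OF coord_lipschitz_slopes[OF v(3) h]] by (simp add: abs_le_iff)
    then have "\<tau> * F (slopes h (v j) y) \<le> \<tau> * M" using \<tau> by (intro mult_left_mono) auto
    then show ?case using Suc by (simp add: v fd_step_def algebra_simps)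
  qed (simp add: v0)
  have growth: "u (x, t) \<le> g x + M * t" if "0 \<le> t" "t < T" for x t
  proof (rule subsolution_initial_growth[OF T sub cont per u0])
    show "torus_periodic g" "coord_lipschitz R g" using v(2,3)[of 0] v0 by simp_all
    show "- H p \<le> M" if "\<And>i. \<bar>p $ i\<bar> \<le> R" for p
      using Fb[OF diagonal_in_slope_box[OF that]] by (simp add: FH abs_le_iff)
  qed (use that in auto)
  have gL: "g x - g y \<le> ?L * norm (x - y)" for x y
    using coord_lipschitz_norm[OF v(3)[of 0], of x y] by (simp add: v0)
  define B where "B = (?L\<^sup>2 + M\<^sup>2) * \<alpha> / 2"
  have before: "u (x, t) - v n x - (t - real n * \<tau>)\<^sup>2 / (2 * \<alpha>) \<le> B + \<theta>0 * T"
    if t: "0 \<le> t" "t < T" for t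
  proof (rule le_of_forall_small_error)
    fix e :: real assume e: "0 < e"
    let ?D = "doubling u v (\<lambda>j. real j * \<tau>) T \<alpha> \<beta> (\<theta>0 + e) e"
    obtain x0 t0 y0 j0 where mx: "j0 \<in> {0..n}" "0 \<le> t0" "t0 < T"
      "\<And>x t y j. 0 \<le> t \<Longrightarrow> t < T \<Longrightarrow> j \<in> {0..n} \<Longrightarrow> ?D x t y j \<le> ?D x0 t0 y0 j0"
    proof (rule doubling_attains_maximum[OF T cont per, of "{0..n}" v \<alpha> \<beta> e "\<lambda>j. real j * \<tau>" "\<theta>0 + e"])
      show "continuous_on UNIV (v j)" for j by (rule coord_lipschitz_continuous[OF v(3)])
    qed (use v(2) \<alpha> \<beta> e in auto)
    let ?p = "(1 / \<alpha>) *\<^sub>R (x0 - y0)"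
    let ?s = "real j0 * \<tau>"
    have p: "\<bar>?p $ i\<bar> \<le> R" for i
      by (rule doubling_maximum_slope[OF mx(4)[OF mx(2,3,1)] v(3) \<alpha>(1)])
    have "t0 = 0 \<or> j0 = 0"
    proof (rule ccontr)
      assume "\<not> (t0 = 0 \<or> j0 = 0)"
      then obtain j where j: "j0 = Suc j" and t0: "0 < t0" using mx(2) by (cases j0) auto
      have sub': "2 * \<beta> * (t0 - ?s) + (\<theta>0 + e) + H ?p \<le> 0"
        by (rule doubling_maximum_subsolution[OF sub mx(4)[OF _ _ mx(1)] t0 mx(3) \<alpha>(1) e])
      have jn: "j \<in> {0..n}" using mx(1) j by simp
      \<comment> \<open>The difference quotient of the time penalty between the levels \<open>j\<close> and \<open>Suc j\<close>.\<close>
      let ?b = "2 * \<beta> * (t0 - ?s) + \<beta> * \<tau>"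
      have "- (m * h) / (2 * \<alpha>) \<le> ?b + F (- ?p, ?p)"
        unfolding m_def
      proof (rule scheme_maximum_supersolution[OF mono h \<tau> \<alpha>(1) Fl K v(3)[of j] _ p, where w = "v j0"])
        show "v j0 = fd_step F h \<tau> (v j)" by (simp add: j v)
        show "v j0 y0 + ((norm (x0 - y0))\<^sup>2 - (norm (x0 - y))\<^sup>2) / (2 * \<alpha>) - \<tau> * ?b \<le> v j y" for y
        proof -
          have "?D x0 t0 y j \<le> ?D x0 t0 y0 j0" by (rule mx(4)[OF mx(2,3) jn])
          then have "v j0 y0 + (norm (x0 - y0))\<^sup>2 / (2 * \<alpha>) - (norm (x0 - y))\<^sup>2 / (2 * \<alpha>)
              + (\<beta> * (t0 - ?s)\<^sup>2 - \<beta> * (t0 - real j * \<tau>)\<^sup>2) \<le> v j y"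
            unfolding doubling_def by linarith
          moreover have "\<beta> * (t0 - ?s)\<^sup>2 - \<beta> * (t0 - real j * \<tau>)\<^sup>2 = - (\<tau> * ?b)"
            by (simp add: j power2_eq_square algebra_simps)
          ultimately show ?thesis by (simp add: diff_divide_distrib)
        qed
      qed
      moreover have "\<beta> * \<tau> + m * h / (2 * \<alpha>) = \<theta>0"
        by (simp add: \<theta>0_def \<beta>_def add_divide_distrib)
      ultimately show False using sub' e by (simp add: FH)
    qed
    have "?D x0 t0 y0 j0 \<le> B"
    proof -
      have 1: "?D x0 t0 y0 j0 \<le> u (x0, t0) - v j0 y0 - (norm (x0 - y0))\<^sup>2 / (2 * \<alpha>) - \<beta> * (t0 - ?s)\<^sup>2"
      proof -
        have "0 \<le> (\<theta>0 + e) * t0" "0 \<le> e / (T - t0)" using \<theta>0 e mx by simp_all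
        then show ?thesis unfolding doubling_def by linarith
      qed
      have 2: "u (x0, t0) - v j0 y0 \<le> g x0 - g y0 + M * \<bar>t0 - ?s\<bar>"
        using \<open>t0 = 0 \<or> j0 = 0\<close>
      proof
        assume "t0 = 0"
        then show ?thesis using v_time[of y0 j0] \<tau> by (simp add: u0)
      next
        assume "j0 = 0"
        then show ?thesis using growth[OF mx(2,3), of x0] mx(2) by (simp add: v0)
      qed
      have 3: "?L * norm (x0 - y0) - (norm (x0 - y0))\<^sup>2 / (2 * \<alpha>) \<le> ?L\<^sup>2 * \<alpha> / 2"
        by (rule linear_minus_quadratic_le[OF \<alpha>(1)])
      have 4: "M * \<bar>t0 - ?s\<bar> - \<beta> * (t0 - ?s)\<^sup>2 \<le> M\<^sup>2 * \<alpha> / 2"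
        using linear_minus_quadratic_le[OF \<alpha>(1), of M "\<bar>t0 - ?s\<bar>"] by (simp add: \<beta>_def)
      have "B = ?L\<^sup>2 * \<alpha> / 2 + M\<^sup>2 * \<alpha> / 2" by (simp add: B_def algebra_simps add_divide_distrib)
      then show ?thesis using 1 2 3 4 gL[of x0 y0] by linarith
    qed
    then have "?D x t x n \<le> B" using mx(4)[OF t, of n x x] by simp
    moreover have "\<theta>0 * t \<le> \<theta>0 * T" using t \<theta>0 by (intro mult_left_mono) auto
    ultimately show "u (x, t) - v n x - (t - real n * \<tau>)\<^sup>2 / (2 * \<alpha>) \<le> B + \<theta>0 * T + e * (t + 1 / (T - t))"
      by (simp add: doubling_def \<beta>_def algebra_simps)
  qed
  have "u (x, real n * \<tau>) - v n x \<le> B + \<theta>0 * T"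
  proof (cases "n = 0")
    case True
    then show ?thesis using before[of 0] T by (simp add: u0 v0)
  next
    case False
    have "continuous_on {0..T} (\<lambda>t. u (x, t))"
      by (rule continuous_on_compose2[OF cont]) (auto intro!: continuous_intros)
    then have "continuous_on {0..T} (\<lambda>t. u (x, t) - v n x - (t - real n * \<tau>)\<^sup>2 / (2 * \<alpha>))"
      using \<alpha>(1) by (intro continuous_intros) auto
    from le_of_le_before[OF this _ n, of "B + \<theta>0 * T"] show ?thesis
      using False \<tau> n before by simp
  qed
  also have "\<theta>0 * T \<le> (1 + m) / 2 * \<alpha> * T"
    using \<theta>0_le T by (intro mult_right_mono) auto
  also have "B + (1 + m) / 2 * \<alpha> * T = ((?L\<^sup>2 + M\<^sup>2) / 2 + (1 + m) * T / 2) * \<alpha>"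
    by (simp add: B_def field_simps)
  finally show ?thesis by (simp add: m_def \<alpha>_def)
qed

lemma viscosity_supersolution_reflect:
  assumes "viscosity_supersolution H T u"
  shows "viscosity_subsolution (\<lambda>p. - H (- p)) T (\<lambda>z. - u z)"
  unfolding viscosity_subsolution_def
proof (intro allI impI ballI)
  fix \<phi> D\<phi> z
  assume t: "C1_test_fun T \<phi> D\<phi>" and z: "z \<in> UNIV \<times> {0<..<T}"
    and ev: "\<forall>\<^sub>F y in nhds z. - u y - \<phi> y \<le> - u z - \<phi> z"
  have t': "C1_test_fun T (\<lambda>z. - \<phi> z) (\<lambda>z. - D\<phi> z)"
    using t unfolding C1_test_fun_def by (auto intro!: GDERIV_minus continuous_intros)
  have ev': "\<forall>\<^sub>F y in nhds z. u z - - \<phi> z \<le> u y - - \<phi> y"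
    using ev by eventually_elim simp
  have "0 \<le> snd (- D\<phi> z) + H (fst (- D\<phi> z))"
    using assms[unfolded viscosity_supersolution_def, rule_format, OF t' z ev'] .
  then show "snd (D\<phi> z) + - H (- fst (D\<phi> z)) \<le> 0" by simp
qed

context bounded_monotone_scheme
begin

text \<open>The lower bound for \<open>u\<close> is the upper bound for \<open>- u\<close>, which is a subsolution for the reflected
  Hamiltonian \<open>- H (- p)\<close>; the comparison argument is invariant under this reflection.\<close>

lemma scheme_error_sqrt:
  fixes u :: "(real ^ 'd) \<times> real \<Rightarrow> real"
  assumes T: "0 < T" and u: "viscosity_solution H g T u"
    and FH: "\<And>p. F (- p, p) = H p"
    and h: "0 < h" and g: "admissible R c g" and n: "real n * (\<rho> * h) \<le> T"
  shows "\<bar>u (x, real n * (\<rho> * h)) - fd_scheme F g h (\<rho> * h) n x\<bar>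
    \<le> (((R * real CARD('d))\<^sup>2 + M\<^sup>2) / 2 + (1 + K * real (DIM((real ^ 'd) \<times> (real ^ 'd)))) * T / 2)
        * sqrt (h + \<rho> * h)"
proof -
  note u = u[unfolded viscosity_solution_def]
  let ?v = "fd_scheme F g h (\<rho> * h)"
  have v: "torus_periodic (?v n)" "coord_lipschitz R (?v n)" for n
    using scheme_admissible[OF h g] by (simp_all add: admissible_def)
  have \<tau>: "0 < \<rho> * h" using h lam by simp
  have 1: "u (x, real n * (\<rho> * h)) - ?v n x \<le>
    (((R * real CARD('d))\<^sup>2 + M\<^sup>2) / 2 + (1 + K * real (DIM((real ^ 'd) \<times> (real ^ 'd)))) * T / 2)
        * sqrt (h + \<rho> * h)"
    by (rule subsolution_le_scheme[where F = F and H = H and g = g])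
       (use u T FH F_bound F_lipschitz K_nonneg M_nonneg box_monotone[OF h] h \<tau> v n in
         \<open>auto simp: fd_scheme_Suc simp del: fd_scheme.simps(2)\<close>)
  have 2: "- u (x, real n * (\<rho> * h)) - (\<lambda>y. - ?v n y) x \<le>
    (((R * real CARD('d))\<^sup>2 + M\<^sup>2) / 2 + (1 + K * real (DIM((real ^ 'd) \<times> (real ^ 'd)))) * T / 2)
        * sqrt (h + \<rho> * h)"
  proof (rule subsolution_le_scheme[where F = "\<lambda>q. - F (- q)" and H = "\<lambda>p. - H (- p)" and g = "\<lambda>x. - g x"
        and u = "\<lambda>z. - u z" and v = "\<lambda>n y. - ?v n y"])
    show "viscosity_subsolution (\<lambda>p. - H (- p)) T (\<lambda>z. - u z)"
      using u viscosity_supersolution_reflect by blast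
    show "continuous_on (UNIV \<times> {0..T}) (\<lambda>z. - u z)" using u by (intro continuous_intros) auto
    show "torus_periodic (\<lambda>x. - u (x, t))" if "t \<in> {0..T}" for t
      using u that unfolding torus_periodic_def by simp
    show "- F (- (- p, p)) = - H (- p)" for p using FH[of "- p"] by simp
    have neg: "- q \<in> slope_box R" if "q \<in> slope_box R" for q :: "(real ^ 'd) \<times> (real ^ 'd)"
      using that by (simp add: mem_slope_box)
    show "\<bar>- F (- q)\<bar> \<le> M" if "q \<in> slope_box R" for q
      using F_bound[OF neg[OF that]] by simp
    show "\<bar>- F (- q) - - F (- q')\<bar> \<le> K * norm (q - q')"
      if "q \<in> slope_box R" "q' \<in> slope_box R" for q q'
      using F_lipschitz[OF neg[OF that(1)] neg[OF that(2)]] by (simp add: abs_minus_commute norm_minus_commute)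
    show "box_monotone (\<lambda>q. - F (- q)) R h (\<rho> * h)"
      by (rule box_monotone_reflect[OF box_monotone[OF h]])
    show "(\<lambda>y. - ?v (Suc n) y) = fd_step (\<lambda>q. - F (- q)) h (\<rho> * h) (\<lambda>y. - ?v n y)" for n
      unfolding fd_scheme_Suc by (simp add: fd_step_def slopes_minus fun_eq_iff)
    show "torus_periodic (\<lambda>y. - ?v n y)" for n using v(1)[of n] unfolding torus_periodic_def by simp
    show "coord_lipschitz R (\<lambda>y. - ?v n y)" for n
      using v(2)[of n] unfolding coord_lipschitz_def by (simp add: abs_minus_commute)
  qed (use u T K_nonneg M_nonneg h \<tau> n in auto)
  from 1 2 show ?thesis by (simp add: abs_le_iff)
qed

end

section \<open>Mollification\<close>

definition conv :: "(real ^ 'd \<Rightarrow> real) \<Rightarrow> (real ^ 'd \<Rightarrow> 'b::real_normed_vector) \<Rightarrow> real ^ 'd \<Rightarrow> 'b" where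
  "conv w k x = integral (cbox (- 1) 1) (\<lambda>z. w (x + z) *\<^sub>R k z)"

lemma conv_eq_integral_translate:
  fixes k :: "real ^ 'd \<Rightarrow> 'b::banach"
  assumes w: "continuous_on UNIV w" and k: "continuous_on UNIV k"
    and supp: "\<And>z. z \<notin> cbox (- 1) 1 \<Longrightarrow> k z = 0"
    and sub: "cbox (x - 1) (x + 1) \<subseteq> cbox a b"
  shows "conv w k x = integral (cbox a b) (\<lambda>y. w y *\<^sub>R k (y - x))"
proof -
  let ?f = "\<lambda>y. w y *\<^sub>R k (y - x)"
  have c: "continuous_on S ?f" for S
    by (intro continuous_intros continuous_on_subset[OF w] continuous_on_compose2[OF k]) auto
  have "conv w k x = integral (cbox ((x - 1) - x) ((x + 1) - x)) (\<lambda>z. ?f (z + x))"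
    by (simp add: conv_def add.commute)
  also have "\<dots> = integral (cbox (x - 1) (x + 1)) ?f" by (rule integral_shift_cbox)
  also have "\<dots> = integral (cbox a b) ?f"
  proof -
    have "(?f has_integral integral (cbox (x - 1) (x + 1)) ?f) (cbox (x - 1) (x + 1))"
      by (intro integrable_integral integrable_continuous c)
    moreover have "?f y = 0" if "y \<notin> cbox (x - 1) (x + 1)" for y
    proof -
      have "y - x \<notin> cbox (- 1) 1" using that by (auto simp: mem_box_cart algebra_simps)
      then show ?thesis using supp by simp
    qed
    ultimately have "(?f has_integral integral (cbox (x - 1) (x + 1)) ?f) (cbox a b)"
      using sub by (rule has_integral_on_superset)
    then show ?thesis by (simp add: integral_unique)
  qed
  finally show ?thesis .
qed

text \<open>After translation the derivative falls on the kernel. Near a point the support of the translated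
  kernel stays in a fixed box, which permits differentiation under the integral.\<close>

lemma conv_has_derivative:
  fixes k :: "real ^ 'd \<Rightarrow> 'b::euclidean_space" and k' :: "real ^ 'd \<Rightarrow> (real ^ 'd) \<Rightarrow>\<^sub>L 'b"
  assumes w: "continuous_on UNIV w"
    and k: "\<And>z. (k has_derivative blinfun_apply (k' z)) (at z)" and k': "continuous_on UNIV k'"
    and supp: "\<And>z. z \<notin> cbox (- 1) 1 \<Longrightarrow> k z = 0" "\<And>z. z \<notin> cbox (- 1) 1 \<Longrightarrow> k' z = 0"
  shows "(conv w k has_derivative blinfun_apply (- conv w k' x)) (at x)"
proof -
  have kc: "continuous_on UNIV k"
    by (rule has_derivative_continuous_on) (use k in auto)
  \<comment> \<open>For centres in \<open>?U\<close> the kernel is supported in the box from \<open>?a\<close> to \<open>?b\<close>.\<close>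
  let ?U = "box (x - 1) (x + 1)" and ?a = "x - 2" and ?b = "x + 2"
  let ?f = "\<lambda>x y. w y *\<^sub>R k (y - x)"
  let ?f' = "\<lambda>x y. w y *\<^sub>R - k' (y - x)"
  have x: "x \<in> ?U" by (simp add: mem_box_cart)
  have sub: "cbox (x' - 1) (x' + 1) \<subseteq> cbox ?a ?b" if "x' \<in> ?U" for x'
  proof
    fix y assume y: "y \<in> cbox (x' - 1) (x' + 1)"
    have "x $ i - 2 \<le> y $ i \<and> y $ i \<le> x $ i + 2" for i
      using y that by (simp add: mem_box_cart) (smt (verit))
    then show "y \<in> cbox ?a ?b" by (simp add: mem_box_cart)
  qed
  have "((\<lambda>x. integral (cbox ?a ?b) (?f x)) has_derivative
      blinfun_apply (integral (cbox ?a ?b) (?f' x))) (at x within ?U)"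
  proof (rule leibniz_rule[OF _ _ _ x])
    show "((\<lambda>x. ?f x t) has_derivative blinfun_apply (?f' x' t)) (at x' within ?U)" for x' t
    proof -
      have "((\<lambda>x. t - x) has_derivative (\<lambda>h. - h)) (at x')"
        by (auto intro!: derivative_eq_intros)
      from has_derivative_compose[OF this k[of "t - x'"]]
      have "((\<lambda>x. k (t - x)) has_derivative (\<lambda>h. blinfun_apply (k' (t - x')) (- h))) (at x')" .
      from has_derivative_scaleR_right[OF this, of "w t"]
      have "((\<lambda>x. ?f x t) has_derivative (\<lambda>h. w t *\<^sub>R blinfun_apply (k' (t - x')) (- h))) (at x')" .
      moreover have "(\<lambda>h. w t *\<^sub>R blinfun_apply (k' (t - x')) (- h)) = blinfun_apply (?f' x' t)"
        by (auto simp: fun_eq_iff blinfun.scaleR_left blinfun.minus_left blinfun.minus_right)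
      ultimately show ?thesis by (simp add: has_derivative_at_withinI)
    qed
    show "?f x' integrable_on cbox ?a ?b" for x'
      by (intro integrable_continuous continuous_intros continuous_on_subset[OF w]
          continuous_on_compose2[OF kc]) auto
    have "continuous_on (?U \<times> cbox ?a ?b) (\<lambda>p. w (snd p) *\<^sub>R - k' (snd p - fst p))"
      by (intro continuous_intros continuous_on_compose2[OF w] continuous_on_compose2[OF k']) auto
    then show "continuous_on (?U \<times> cbox ?a ?b) (\<lambda>(x, t). ?f' x t)" by (simp add: split_beta)
  qed (rule convex_box)
  then have "((\<lambda>x. integral (cbox ?a ?b) (?f x)) has_derivative
      blinfun_apply (integral (cbox ?a ?b) (?f' x))) (at x)"
    using x by (simp add: at_within_open[OF _ open_box])
  then have "(conv w k has_derivative blinfun_apply (integral (cbox ?a ?b) (?f' x))) (at x)"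
    by (rule has_derivative_transform_within_open[OF _ open_box x])
       (use conv_eq_integral_translate[OF w kc supp(1) sub] in simp)
  moreover have "integral (cbox ?a ?b) (?f' x) = - conv w k' x"
    using conv_eq_integral_translate[OF w k' supp(2) sub[OF x]] by simp
  ultimately show ?thesis by simp
qed

lemma conv_continuous:
  fixes k :: "real ^ 'd \<Rightarrow> 'b::banach"
  assumes w: "continuous_on UNIV w" and k: "continuous_on UNIV k"
  shows "continuous_on UNIV (conv w k)"
proof -
  have "continuous_on (UNIV \<times> cbox (- 1) 1) (\<lambda>p :: (real ^ 'd) \<times> (real ^ 'd). w (fst p + snd p) *\<^sub>R k (snd p))"
    by (intro continuous_intros continuous_on_compose2[OF w] continuous_on_compose2[OF k]) auto
  then show ?thesis
    unfolding conv_def[abs_def]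
    by (intro integral_continuous_on_param) (simp add: split_beta)
qed

lemma DERIV_pos_part_power:
  "((\<lambda>t::real. (max 0 t) ^ Suc (Suc n)) has_real_derivative real (Suc (Suc n)) * (max 0 t) ^ Suc n) (at t)"
proof -
  consider "t < 0" | "0 < t" | "t = 0" by linarith
  then show ?thesis
  proof cases
    case 1
    have "((\<lambda>t::real. 0) has_real_derivative 0) (at t)" by simp
    then have "((\<lambda>t::real. (max 0 t) ^ Suc (Suc n)) has_real_derivative 0) (at t)"
      by (rule has_field_derivative_transform_within_open[where S = "{..<0}"]) (use 1 in auto)
    then show ?thesis using 1 by simp
  next
    case 2
    have "((\<lambda>t::real. t ^ Suc (Suc n)) has_real_derivative real (Suc (Suc n)) * t ^ Suc n) (at t)"
      by (rule derivative_eq_intros refl)+ simp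
    then have "((\<lambda>t::real. (max 0 t) ^ Suc (Suc n)) has_real_derivative real (Suc (Suc n)) * t ^ Suc n) (at t)"
      by (rule has_field_derivative_transform_within_open[where S = "{0<..}"]) (use 2 in auto)
    then show ?thesis using 2 by simp
  next
    case 3
    have "(\<lambda>h::real. (max 0 h) ^ Suc (Suc n) / h) \<midarrow>0\<rightarrow> 0"
    proof (rule Lim_null_comparison)
      have "(max 0 h) ^ Suc (Suc n) \<le> \<bar>h\<bar> ^ Suc (Suc n)" for h :: real
        by (intro power_mono) auto
      then have "norm ((max 0 h) ^ Suc (Suc n) / h) \<le> \<bar>h\<bar> ^ Suc n" if "h \<noteq> 0" for h :: real
        using that by (simp add: abs_mult divide_le_eq mult.assoc mult.left_commute mult.commute)
      then show "\<forall>\<^sub>F h in at 0. norm ((max 0 h) ^ Suc (Suc n) / h) \<le> \<bar>h :: real\<bar> ^ Suc n"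
        by (auto simp: eventually_at_filter)
      have "((\<lambda>h :: real. \<bar>h\<bar> ^ Suc n) \<longlongrightarrow> \<bar>0\<bar> ^ Suc n) (at 0)" by (intro tendsto_intros)
      then show "((\<lambda>h :: real. \<bar>h\<bar> ^ Suc n) \<longlongrightarrow> 0) (at 0)" by simp
    qed
    then show ?thesis using 3 by (simp add: DERIV_def del: power_Suc)
  qed
qed

text \<open>The kernel \<open>(1 - \<bar>z\<bar>\<^sup>2)\<^sub>+\<^sup>3\<close> is of class \<open>C\<^sup>2\<close> and has explicit derivatives, supported in the unit ball.\<close>

definition bump :: "real ^ 'd \<Rightarrow> real" where
  "bump z = (max 0 (1 - z \<bullet> z)) ^ 3"

definition bump_grad :: "real ^ 'd \<Rightarrow> real ^ 'd" where
  "bump_grad z = (- 6 * (max 0 (1 - z \<bullet> z))\<^sup>2) *\<^sub>R z"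

definition bump_hess :: "real ^ 'd \<Rightarrow> (real ^ 'd) \<Rightarrow>\<^sub>L (real ^ 'd)" where
  "bump_hess z = Blinfun (\<lambda>h. (24 * max 0 (1 - z \<bullet> z) * (z \<bullet> h)) *\<^sub>R z - (6 * (max 0 (1 - z \<bullet> z))\<^sup>2) *\<^sub>R h)"

lemma bump_hess_apply:
  "blinfun_apply (bump_hess z) h
    = (24 * max 0 (1 - z \<bullet> z) * (z \<bullet> h)) *\<^sub>R z - (6 * (max 0 (1 - z \<bullet> z))\<^sup>2) *\<^sub>R h"
proof -
  have "bounded_linear (\<lambda>h. (24 * max 0 (1 - z \<bullet> z) * (z \<bullet> h)) *\<^sub>R z - (6 * (max 0 (1 - z \<bullet> z))\<^sup>2) *\<^sub>R h)"
    by (intro bounded_linear_sub bounded_linear_scaleR_left[THEN bounded_linear_compose]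
        bounded_linear_mult_right[THEN bounded_linear_compose] bounded_linear_inner_right bounded_linear_scaleR_right)
  then show ?thesis by (simp add: bump_hess_def bounded_linear_Blinfun_apply)
qed

lemma outside_cube_norm:
  fixes z :: "real ^ 'd"
  assumes "z \<notin> cbox (- 1) 1"
  shows "max 0 (1 - z \<bullet> z) = 0"
proof -
  obtain i where "1 < \<bar>z $ i\<bar>" using assms by (auto simp: mem_box_cart not_le abs_if) (smt (verit))+
  then have "1 < norm z" using component_le_norm_cart[of z i] by linarith
  then have "1 < z \<bullet> z" unfolding power2_norm_eq_inner[symmetric] by (simp add: one_less_power)
  then show ?thesis by simp
qed

lemma bump_has_derivative:
  "(bump has_derivative blinfun_apply (blinfun_inner_right (bump_grad z))) (at (z :: real ^ 'd))"
proof -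
  have "((\<lambda>z :: real ^ 'd. 1 - z \<bullet> z) has_derivative (\<lambda>h. - (2 * (z \<bullet> h)))) (at z)"
    by (auto intro!: derivative_eq_intros simp: inner_commute)
  moreover have "((\<lambda>t::real. (max 0 t) ^ 3) has_derivative (*) (3 * (max 0 (1 - z \<bullet> z))\<^sup>2)) (at (1 - z \<bullet> z))"
    using DERIV_pos_part_power[of 1 "1 - z \<bullet> z"] by (simp add: has_field_derivative_def numeral_eq_Suc)
  ultimately have "((\<lambda>z :: real ^ 'd. (max 0 (1 - z \<bullet> z)) ^ 3) has_derivative
      (\<lambda>h. 3 * (max 0 (1 - z \<bullet> z))\<^sup>2 * - (2 * (z \<bullet> h)))) (at z)"
    by (rule has_derivative_compose)
  then show ?thesis
    unfolding bump_def[abs_def]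
    by (rule has_derivative_eq_rhs) (simp add: fun_eq_iff bump_grad_def)
qed

lemma bump_grad_has_derivative:
  "(bump_grad has_derivative blinfun_apply (bump_hess z)) (at (z :: real ^ 'd))"
proof -
  have "((\<lambda>z :: real ^ 'd. 1 - z \<bullet> z) has_derivative (\<lambda>h. - (2 * (z \<bullet> h)))) (at z)"
    by (auto intro!: derivative_eq_intros simp: inner_commute)
  moreover have "((\<lambda>t::real. (max 0 t)\<^sup>2) has_derivative (*) (2 * max 0 (1 - z \<bullet> z))) (at (1 - z \<bullet> z))"
    using DERIV_pos_part_power[of 0 "1 - z \<bullet> z"] by (simp add: has_field_derivative_def numeral_eq_Suc)
  ultimately have "((\<lambda>z :: real ^ 'd. (max 0 (1 - z \<bullet> z))\<^sup>2) has_derivative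
      (\<lambda>h. 2 * max 0 (1 - z \<bullet> z) * - (2 * (z \<bullet> h)))) (at z)"
    by (rule has_derivative_compose)
  from has_derivative_scaleR[OF has_derivative_mult_right[OF this, of "- 6"] has_derivative_ident]
  show ?thesis
    unfolding bump_grad_def[abs_def]
    by (rule has_derivative_eq_rhs) (auto simp: fun_eq_iff bump_hess_apply algebra_simps)
qed

lemma bump_continuous: "continuous_on UNIV bump"
  unfolding bump_def[abs_def] by (intro continuous_intros)

lemma bump_grad_continuous: "continuous_on UNIV bump_grad"
  unfolding bump_grad_def[abs_def] by (intro continuous_intros)

lemma bump_hess_continuous: "continuous_on UNIV bump_hess"
  by (rule continuous_on_blinfun_componentwise) (simp add: bump_hess_apply, intro continuous_intros)

definition bump_mass :: "'d::finite itself \<Rightarrow> real" where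
  "bump_mass _ = integral (cbox (- 1) (1 :: real ^ 'd)) bump"

lemma bump_mass_pos: "0 < bump_mass TYPE('d::finite)"
proof -
  have c: "continuous_on (cbox (- 1) (1 :: real ^ 'd)) bump"
    using bump_continuous continuous_on_subset by blast
  then have i: "bump integrable_on cbox (- 1) (1 :: real ^ 'd)" by (rule integrable_continuous)
  have nn: "0 \<le> bump z" for z :: "real ^ 'd" by (simp add: bump_def)
  have "0 \<le> bump_mass TYPE('d)"
    unfolding bump_mass_def by (rule integral_nonneg[OF i nn])
  moreover have "bump_mass TYPE('d) \<noteq> 0"
  proof
    assume "bump_mass TYPE('d) = 0"
    then have h: "(bump has_integral 0) (cbox (- 1) (1 :: real ^ 'd))"
      using integrable_integral[OF i] by (simp add: bump_mass_def)
    have "(0 :: real ^ 'd) \<in> box (- 1) 1" by (simp add: mem_box_cart)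
    then have "bump (0 :: real ^ 'd) = 0"
      using has_integral_0_cbox_imp_0[OF c nn h] box_subset_cbox by blast
    then show False by (simp add: bump_def)
  qed
  ultimately show ?thesis by simp
qed

definition bump_average :: "(real ^ 'd \<Rightarrow> real) \<Rightarrow> real" where
  "bump_average f = integral (cbox (- 1) 1) (\<lambda>z. f z * bump z) / bump_mass TYPE('d)"

lemma bump_integrable:
  assumes "continuous_on UNIV f"
  shows "(\<lambda>z. f z * bump z) integrable_on cbox (- 1) (1 :: real ^ 'd)"
  by (intro integrable_continuous continuous_intros continuous_on_subset[OF assms]
      continuous_on_subset[OF bump_continuous]) auto

lemma bump_average_const: "bump_average (\<lambda>_ :: real ^ 'd. b) = b"
  using bump_mass_pos[where 'd = 'd] by (simp add: bump_average_def bump_mass_def)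

lemma bump_average_add:
  fixes f g :: "real ^ 'd \<Rightarrow> real"
  assumes "continuous_on UNIV f" "continuous_on UNIV g"
  shows "bump_average (\<lambda>z. f z + g z) = bump_average f + bump_average g"
  using integral_add[OF bump_integrable[OF assms(1)] bump_integrable[OF assms(2)]]
  by (simp add: bump_average_def algebra_simps add_divide_distrib)

lemma bump_average_mult: "bump_average (\<lambda>z. b * f z) = b * bump_average f"
  by (simp add: bump_average_def mult.assoc)

lemma bump_average_reflect: "bump_average (\<lambda>z :: real ^ 'd. f (- z)) = bump_average f"
proof -
  have "bump (- z) = bump z" for z :: "real ^ 'd" by (simp add: bump_def)
  then show ?thesis
    using integral_reflect[of "1 :: real ^ 'd" "- 1" "\<lambda>z. f z * bump z"] by (simp add: bump_average_def)
qed

text \<open>The weight vanishes outside the unit ball, so only values there matter.\<close>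

lemma bump_average_mono:
  fixes f g :: "real ^ 'd \<Rightarrow> real"
  assumes "continuous_on UNIV f" "continuous_on UNIV g" "\<And>z. norm z \<le> 1 \<Longrightarrow> f z \<le> g z"
  shows "bump_average f \<le> bump_average g"
proof -
  have "f z * bump z \<le> g z * bump z" for z
  proof (cases "norm z \<le> 1")
    case True
    then show ?thesis using assms(3) by (intro mult_right_mono) (auto simp: bump_def)
  next
    case False
    then have "1 < z \<bullet> z" unfolding power2_norm_eq_inner[symmetric] by (simp add: one_less_power)
    then show ?thesis by (simp add: bump_def)
  qed
  then have "integral (cbox (- 1) 1) (\<lambda>z. f z * bump z) \<le> integral (cbox (- 1) 1) (\<lambda>z. g z * bump z)"
    by (intro integral_le bump_integrable assms) auto
  then show ?thesis
    using bump_mass_pos[where 'd = 'd] by (simp add: bump_average_def divide_right_mono)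
qed

definition mollify :: "real \<Rightarrow> (real ^ 'd \<Rightarrow> real) \<Rightarrow> real ^ 'd \<Rightarrow> real" where
  "mollify \<delta> v x = bump_average (\<lambda>z. v (x + \<delta> *\<^sub>R z))"

lemma continuous_on_affine:
  "continuous_on UNIV v \<Longrightarrow> continuous_on UNIV (\<lambda>z :: real ^ 'd. v (x + \<delta> *\<^sub>R z))"
  by (rule continuous_on_compose2[of UNIV v]) (auto intro!: continuous_intros)

lemma mollify_eq_conv:
  assumes "\<delta> \<noteq> 0"
  shows "mollify \<delta> v (x :: real ^ 'd) = conv (\<lambda>y. v (\<delta> *\<^sub>R y)) bump ((1 / \<delta>) *\<^sub>R x) / bump_mass TYPE('d)"
  using assms by (simp add: mollify_def bump_average_def conv_def scaleR_add_right)

text \<open>Scaling first by \<open>1 / \<delta>\<close> reduces the derivatives to those of a convolution at unit scale.\<close>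

lemma mollify_derivatives:
  fixes v :: "real ^ 'd \<Rightarrow> real"
  assumes v: "continuous_on UNIV v" and \<delta>: "0 < \<delta>"
  obtains D\<phi> D2\<phi> where
    "\<And>x. GDERIV (mollify \<delta> v) x :> D\<phi> x"
    "\<And>x. (D\<phi> has_derivative blinfun_apply (D2\<phi> x)) (at x)"
    "continuous_on UNIV D2\<phi>"
    "\<And>x a b. blinfun_apply (D2\<phi> x) a \<bullet> b = blinfun_apply (D2\<phi> x) b \<bullet> a"
proof -
  let ?w = "\<lambda>y. v (\<delta> *\<^sub>R y)" and ?m = "bump_mass TYPE('d)"
  let ?s = "\<lambda>x :: real ^ 'd. (1 / \<delta>) *\<^sub>R x"
  have m: "0 < ?m" by (rule bump_mass_pos)
  have w: "continuous_on UNIV ?w" using continuous_on_affine[OF v, of 0 \<delta>] by simp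
  have ds: "(?s has_derivative ?s) (at x)" for x by (auto intro!: derivative_eq_intros)
  have supp: "bump z = 0" "blinfun_inner_right (bump_grad z) = 0" "bump_grad z = 0" "bump_hess z = 0"
    if "z \<notin> cbox (- 1) 1" for z :: "real ^ 'd"
    using outside_cube_norm[OF that]
    by (auto simp: bump_def bump_grad_def intro!: blinfun_eqI simp: bump_hess_apply)
  define D\<phi> where "D\<phi> x = (- 1 / (\<delta> * ?m)) *\<^sub>R conv ?w bump_grad (?s x)" for x
  define D2\<phi> where "D2\<phi> x = (1 / (\<delta> * \<delta> * ?m)) *\<^sub>R conv ?w bump_hess (?s x)" for x
  have int: "(\<lambda>z. ?w (x + z) *\<^sub>R k z) integrable_on cbox (- 1) 1"
    if "continuous_on UNIV k" for k :: "real ^ 'd \<Rightarrow> 'b::banach" and x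
    by (intro integrable_continuous continuous_intros continuous_on_subset[OF that]
        continuous_on_compose2[OF w]) auto
  have inner_conv: "blinfun_apply (conv ?w (\<lambda>z. blinfun_inner_right (bump_grad z)) x) h
      = conv ?w bump_grad x \<bullet> h" for x h
  proof -
    have "continuous_on UNIV (\<lambda>z :: real ^ 'd. blinfun_inner_right (bump_grad z))"
      by (intro continuous_intros bump_grad_continuous
          bounded_linear.continuous_on[OF bounded_linear_blinfun_inner_right])
    from blinfun_apply_integral[OF int[OF this]]
    have "blinfun_apply (conv ?w (\<lambda>z. blinfun_inner_right (bump_grad z)) x) h
      = integral (cbox (- 1) 1) (\<lambda>z. (?w (x + z) *\<^sub>R bump_grad z) \<bullet> h)"
      by (simp add: conv_def blinfun.scaleR_left)
    also have "\<dots> = conv ?w bump_grad x \<bullet> h"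
      using integral_linear[OF int[OF bump_grad_continuous] bounded_linear_inner_left[of h]]
      by (simp add: conv_def o_def)
    finally show ?thesis .
  qed
  have 1: "GDERIV (mollify \<delta> v) x :> D\<phi> x" for x
  proof -
    have "continuous_on UNIV (\<lambda>z :: real ^ 'd. blinfun_inner_right (bump_grad z))"
      by (intro continuous_intros bump_grad_continuous
          bounded_linear.continuous_on[OF bounded_linear_blinfun_inner_right])
    from conv_has_derivative[OF w bump_has_derivative this supp(1,2), of "?s x"]
    have "(conv ?w bump has_derivative (\<lambda>h. - (conv ?w bump_grad (?s x) \<bullet> h))) (at (?s x))"
      by (rule has_derivative_eq_rhs) (auto simp: fun_eq_iff blinfun.minus_left inner_conv)
    from has_derivative_compose[OF ds this]
    have "((\<lambda>x. conv ?w bump (?s x)) has_derivative (\<lambda>h. - (conv ?w bump_grad (?s x) \<bullet> ?s h))) (at x)" .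
    from bounded_linear.has_derivative[OF bounded_linear_divide this, of ?m]
    have "((\<lambda>x. conv ?w bump (?s x) / ?m) has_derivative (\<lambda>h. - (conv ?w bump_grad (?s x) \<bullet> ?s h) / ?m)) (at x)" .
    moreover have eq: "(\<lambda>x. conv ?w bump (?s x) / ?m) = mollify \<delta> v"
      using \<delta> by (auto simp: mollify_eq_conv fun_eq_iff)
    ultimately show ?thesis
      unfolding gderiv_def eq
      by (elim has_derivative_eq_rhs) (auto simp: D\<phi>_def fun_eq_iff inner_commute)
  qed
  have 2: "(D\<phi> has_derivative blinfun_apply (D2\<phi> x)) (at x)" for x
  proof -
    from conv_has_derivative[OF w bump_grad_has_derivative bump_hess_continuous supp(3,4), of "?s x"]
    have "(conv ?w bump_grad has_derivative blinfun_apply (- conv ?w bump_hess (?s x))) (at (?s x))" .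
    from has_derivative_compose[OF ds this]
    have "((\<lambda>x. conv ?w bump_grad (?s x)) has_derivative
        (\<lambda>h. blinfun_apply (- conv ?w bump_hess (?s x)) (?s h))) (at x)" .
    from has_derivative_scaleR_right[OF this, of "- 1 / (\<delta> * ?m)"]
    show ?thesis
      unfolding D\<phi>_def[abs_def]
      by (rule has_derivative_eq_rhs)
         (auto simp: fun_eq_iff D2\<phi>_def blinfun.scaleR_left blinfun.minus_left blinfun.scaleR_right)
  qed
  have 3: "continuous_on UNIV D2\<phi>"
    unfolding D2\<phi>_def[abs_def]
    by (intro continuous_intros continuous_on_compose2[OF conv_continuous[OF w bump_hess_continuous]]) auto
  have 4: "blinfun_apply (D2\<phi> x) a \<bullet> b = blinfun_apply (D2\<phi> x) b \<bullet> a" for x a b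
  proof -
    have "blinfun_apply (conv ?w bump_hess y) a \<bullet> b
        = integral (cbox (- 1) 1) (\<lambda>z. ?w (y + z) * (blinfun_apply (bump_hess z) a \<bullet> b))" for y a b
    proof -
      have c: "continuous_on UNIV (\<lambda>z. blinfun_apply (bump_hess z) a)"
        by (intro continuous_intros bump_hess_continuous)
      have "blinfun_apply (conv ?w bump_hess y) a
          = integral (cbox (- 1) 1) (\<lambda>z. ?w (y + z) *\<^sub>R blinfun_apply (bump_hess z) a)"
        using blinfun_apply_integral[OF int[OF bump_hess_continuous]]
        by (simp add: conv_def blinfun.scaleR_left)
      then show ?thesis
        using integral_linear[OF int[OF c] bounded_linear_inner_left[of b], of y] by (simp add: o_def)
    qed
    moreover have "blinfun_apply (bump_hess z) a \<bullet> b = blinfun_apply (bump_hess z) b \<bullet> a" for z :: "real ^ 'd"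
      by (simp add: bump_hess_apply inner_diff_left inner_commute[of a b])
    ultimately show ?thesis by (simp add: D2\<phi>_def blinfun.scaleR_left)
  qed
  from that[OF 1 2 3 4] show thesis .
qed

lemma mollify_admissible:
  fixes v :: "real ^ 'd \<Rightarrow> real"
  assumes v: "admissible R c v"
  shows "admissible R c (mollify \<delta> v)"
proof -
  have per: "torus_periodic v" and lip: "coord_lipschitz R v" and sc: "midpoint_semiconcave c v"
    using v by (simp_all add: admissible_def)
  have cont: "continuous_on UNIV v" by (rule coord_lipschitz_continuous[OF lip])
  note ca = continuous_on_affine[OF cont]
  have "torus_periodic (mollify \<delta> v)"
    unfolding torus_periodic_def mollify_def
  proof (intro allI)
    fix x i
    have "v (x + axis i 1 + \<delta> *\<^sub>R z) = v (x + \<delta> *\<^sub>R z)" for z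
      using torus_periodicD[OF per, of "x + \<delta> *\<^sub>R z" i] by (simp add: algebra_simps)
    then show "bump_average (\<lambda>z. v (x + axis i 1 + \<delta> *\<^sub>R z)) = bump_average (\<lambda>z. v (x + \<delta> *\<^sub>R z))"
      by simp
  qed
  moreover have "coord_lipschitz R (mollify \<delta> v)"
  proof -
    have le: "mollify \<delta> v (x + s *\<^sub>R axis i 1) \<le> mollify \<delta> v x + R * \<bar>s\<bar>" for x i s
    proof -
      have "mollify \<delta> v (x + s *\<^sub>R axis i 1) \<le> bump_average (\<lambda>z. v (x + \<delta> *\<^sub>R z) + R * \<bar>s\<bar>)"
        unfolding mollify_def
      proof (rule bump_average_mono)
        show "v (x + s *\<^sub>R axis i 1 + \<delta> *\<^sub>R z) \<le> v (x + \<delta> *\<^sub>R z) + R * \<bar>s\<bar>" for z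
          using lip[unfolded coord_lipschitz_def, rule_format, of "x + \<delta> *\<^sub>R z" s i]
          by (simp add: abs_le_iff algebra_simps)
      qed (intro ca continuous_intros)+
      also have "\<dots> = mollify \<delta> v x + R * \<bar>s\<bar>"
        by (simp add: bump_average_add[OF ca] bump_average_const mollify_def)
      finally show ?thesis .
    qed
    show ?thesis
      unfolding coord_lipschitz_def
    proof (intro allI)
      fix x i s
      show "\<bar>mollify \<delta> v (x + s *\<^sub>R axis i 1) - mollify \<delta> v x\<bar> \<le> R * \<bar>s\<bar>"
        using le[of x s i] le[of "x + s *\<^sub>R axis i 1" "- s" i] by (simp add: abs_le_iff)
    qed
  qed
  moreover have "midpoint_semiconcave c (mollify \<delta> v)"
    unfolding midpoint_semiconcave_def
  proof (intro allI)
    fix x y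
    have "mollify \<delta> v (x + y) + mollify \<delta> v (x - y)
        = bump_average (\<lambda>z. v (x + y + \<delta> *\<^sub>R z) + v (x - y + \<delta> *\<^sub>R z))"
      by (simp add: mollify_def bump_average_add[OF ca ca])
    also have "\<dots> \<le> bump_average (\<lambda>z. 2 * v (x + \<delta> *\<^sub>R z) + 2 * c * (norm y)\<^sup>2)"
    proof (rule bump_average_mono)
      show "v (x + y + \<delta> *\<^sub>R z) + v (x - y + \<delta> *\<^sub>R z) \<le> 2 * v (x + \<delta> *\<^sub>R z) + 2 * c * (norm y)\<^sup>2" for z
        using sc[unfolded midpoint_semiconcave_def, rule_format, of "x + \<delta> *\<^sub>R z" y]
        by (simp add: algebra_simps)
    qed (intro ca continuous_intros)+
    also have "\<dots> = 2 * mollify \<delta> v x + 2 * c * (norm y)\<^sup>2"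
    proof -
      have "continuous_on UNIV (\<lambda>z. 2 * v (x + \<delta> *\<^sub>R z))" by (intro ca continuous_intros)
      then show ?thesis
        by (simp add: bump_average_add bump_average_const bump_average_mult mollify_def)
    qed
    finally show "mollify \<delta> v (x + y) + mollify \<delta> v (x - y) \<le> 2 * mollify \<delta> v x + 2 * c * (norm y)\<^sup>2" .
  qed
  ultimately show ?thesis by (simp add: admissible_def)
qed

lemma mollify_close:
  fixes v :: "real ^ 'd \<Rightarrow> real"
  assumes lip: "coord_lipschitz R v" and \<delta>: "0 \<le> \<delta>"
  shows "\<bar>mollify \<delta> v x - v x\<bar> \<le> R * real CARD('d) * \<delta>"
proof -
  let ?L = "R * real CARD('d)"
  have cont: "continuous_on UNIV v" by (rule coord_lipschitz_continuous[OF lip])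
  note ca = continuous_on_affine[OF cont]
  have L: "0 \<le> ?L" using coord_lipschitz_norm[OF lip, of "axis undefined 1" 0] by (simp)
  have near: "\<bar>v (x + \<delta> *\<^sub>R z) - v x\<bar> \<le> ?L * \<delta>" if z: "norm z \<le> 1" for z
  proof -
    have "\<bar>v (x + \<delta> *\<^sub>R z) - v x\<bar> \<le> ?L * norm (x + \<delta> *\<^sub>R z - x)" by (rule coord_lipschitz_norm[OF lip])
    also have "\<dots> = ?L * (\<delta> * norm z)" using \<delta> by simp
    also have "\<dots> \<le> ?L * (\<delta> * 1)" using L \<delta> z by (intro mult_left_mono) auto
    finally show ?thesis by simp
  qed
  have "mollify \<delta> v x \<le> bump_average (\<lambda>_ :: real ^ 'd. v x + ?L * \<delta>)"
    unfolding mollify_def by (rule bump_average_mono) (use near ca in \<open>auto simp: abs_le_iff algebra_simps\<close>)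
  moreover have "bump_average (\<lambda>_ :: real ^ 'd. v x - ?L * \<delta>) \<le> mollify \<delta> v x"
    unfolding mollify_def by (rule bump_average_mono) (use near ca in \<open>auto simp: abs_le_iff algebra_simps\<close>)
  ultimately show ?thesis by (simp add: bump_average_const abs_le_iff)
qed

text \<open>The kernel is even, so first order terms cancel and semiconcavity gives a second order bound
  from above.\<close>

lemma mollify_le:
  fixes v :: "real ^ 'd \<Rightarrow> real"
  assumes cont: "continuous_on UNIV v" and sc: "midpoint_semiconcave c v" and c: "0 \<le> c"
  shows "mollify \<delta> v x \<le> v x + c * \<delta>\<^sup>2"
proof -
  note ca = continuous_on_affine[OF cont]
  have "2 * mollify \<delta> v x = bump_average (\<lambda>z. v (x + \<delta> *\<^sub>R z)) + bump_average (\<lambda>z. v (x + \<delta> *\<^sub>R (- z)))"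
    using bump_average_reflect[of "\<lambda>z. v (x + \<delta> *\<^sub>R z)"] by (simp add: mollify_def)
  also have "\<dots> = bump_average (\<lambda>z. v (x + \<delta> *\<^sub>R z) + v (x + \<delta> *\<^sub>R (- z)))"
    using bump_average_add[OF ca ca[of x "- \<delta>"], of x \<delta>] by simp
  also have "\<dots> \<le> bump_average (\<lambda>_ :: real ^ 'd. 2 * v x + 2 * c * \<delta>\<^sup>2)"
  proof (rule bump_average_mono)
    show "v (x + \<delta> *\<^sub>R z) + v (x + \<delta> *\<^sub>R (- z)) \<le> 2 * v x + 2 * c * \<delta>\<^sup>2" if z: "norm z \<le> 1" for z
    proof -
      have "v (x + \<delta> *\<^sub>R z) + v (x - \<delta> *\<^sub>R z) \<le> 2 * v x + 2 * c * (norm (\<delta> *\<^sub>R z))\<^sup>2"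
        using sc unfolding midpoint_semiconcave_def by blast
      moreover have "(norm (\<delta> *\<^sub>R z))\<^sup>2 \<le> \<delta>\<^sup>2"
        using z by (simp add: power_mult_distrib mult_left_le power_le_one)
      then have "2 * c * (norm (\<delta> *\<^sub>R z))\<^sup>2 \<le> 2 * c * \<delta>\<^sup>2" using c by (intro mult_left_mono) auto
      ultimately show ?thesis by simp
    qed
  qed (use ca[of x \<delta>] ca[of x "- \<delta>"] in \<open>auto intro!: continuous_intros\<close>)
  finally show ?thesis by (simp add: bump_average_const)
qed

lemma integral_mollify:
  fixes v :: "real ^ 'd \<Rightarrow> real"
  assumes per: "torus_periodic v" and cont: "continuous_on UNIV v"
  shows "integral (cbox 0 1) (mollify \<delta> v) = integral (cbox 0 1) v"
proof -
  let ?f = "\<lambda>(x :: real ^ 'd) z. v (x + \<delta> *\<^sub>R z) * bump z"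
  have c: "continuous_on (cbox (0, - 1) (1, 1)) (\<lambda>(x, z). ?f x z)"
    unfolding split_beta
    by (intro continuous_intros continuous_on_compose2[OF cont] continuous_on_compose2[OF bump_continuous]) auto
  have "integral (cbox 0 1) (mollify \<delta> v)
      = integral (cbox 0 1) (\<lambda>x. integral (cbox (- 1) 1) (?f x)) / bump_mass TYPE('d)"
    by (simp add: mollify_def[abs_def] bump_average_def)
  also have "integral (cbox 0 1) (\<lambda>x. integral (cbox (- 1) 1) (?f x))
      = integral (cbox (- 1) 1) (\<lambda>z. integral (cbox 0 1) (\<lambda>x. ?f x z))"
    by (rule integral_swap_continuous[OF c])
  also have "\<dots> = integral (cbox (- 1) (1 :: real ^ 'd)) (\<lambda>z. integral (cbox 0 1) v * bump z)"
    by (simp add: integral_cell_shift[OF per cont])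
  also have "\<dots> = integral (cbox 0 1) v * bump_mass TYPE('d)"
    by (simp add: bump_mass_def)
  finally show ?thesis using bump_mass_pos[where 'd = 'd] by simp
qed

section \<open>Second derivatives of semiconcave functions\<close>

definition quadratic_form :: "'i set \<Rightarrow> ('i \<Rightarrow> 'i \<Rightarrow> real) \<Rightarrow> ('i \<Rightarrow> real) \<Rightarrow> real" where
  "quadratic_form S B r = (\<Sum>l\<in>S. \<Sum>m\<in>S. B l m * (r l * r m))"

lemma quadratic_form_shift:
  assumes S: "finite S" "i \<in> S" and sym: "\<And>l m. l \<in> S \<Longrightarrow> m \<in> S \<Longrightarrow> B l m = B m l"
  shows "quadratic_form S B (\<lambda>l. r l + (if l = i then s else 0))
    = quadratic_form S B r + 2 * s * (\<Sum>l\<in>S. B i l * r l) + s\<^sup>2 * B i i"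
proof -
  let ?d = "\<lambda>l. if l = i then s else 0"
  have 1: "(\<Sum>l\<in>S. \<Sum>m\<in>S. B l m * (r l * ?d m)) = s * (\<Sum>l\<in>S. B i l * r l)"
  proof -
    have "(\<Sum>m\<in>S. B l m * (r l * ?d m)) = s * (B i l * r l)" if "l \<in> S" for l
    proof -
      have "(\<Sum>m\<in>S. B l m * (r l * ?d m)) = (\<Sum>m\<in>S. if m = i then B l m * (r l * s) else 0)"
        by (intro sum.cong) auto
      then show ?thesis using S sym[OF that S(2)] by simp
    qed
    then show ?thesis by (simp add: sum_distrib_left)
  qed
  have "(\<Sum>l\<in>S. \<Sum>m\<in>S. B l m * (?d l * r m)) = (\<Sum>m\<in>S. \<Sum>l\<in>S. B l m * (?d l * r m))"
    by (rule sum.swap)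
  also have "\<dots> = (\<Sum>m\<in>S. \<Sum>l\<in>S. B m l * (r m * ?d l))"
    using sym by (intro sum.cong) auto
  also note 1
  finally have 2: "(\<Sum>l\<in>S. \<Sum>m\<in>S. B l m * (?d l * r m)) = s * (\<Sum>l\<in>S. B i l * r l)" .
  have 3: "(\<Sum>l\<in>S. \<Sum>m\<in>S. B l m * (?d l * ?d m)) = s\<^sup>2 * B i i"
  proof -
    have "(\<Sum>m\<in>S. B l m * (?d l * ?d m)) = (if l = i then s\<^sup>2 * B i i else 0)" for l
    proof -
      have "(\<Sum>m\<in>S. B l m * (?d l * ?d m)) = (\<Sum>m\<in>S. if m = i then B l m * (?d l * s) else 0)"
        by (intro sum.cong) auto
      then show ?thesis using S by (simp add: power2_eq_square)
    qed
    then show ?thesis using S by simp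
  qed
  have expand: "b * ((x + y) * (z + w)) = b * (x * z) + b * (x * w) + b * (y * z) + b * (y * w)"
    for b x y z w :: real by (simp add: algebra_simps)
  have "quadratic_form S B (\<lambda>l. r l + ?d l) = (\<Sum>l\<in>S. \<Sum>m\<in>S. B l m * (r l * r m) + B l m * (r l * ?d m)
      + B l m * (?d l * r m) + B l m * (?d l * ?d m))"
    unfolding quadratic_form_def by (intro sum.cong refl) (simp only: expand)
  also have "\<dots> = quadratic_form S B r + s * (\<Sum>l\<in>S. B i l * r l) + s * (\<Sum>l\<in>S. B i l * r l) + s\<^sup>2 * B i i"
    by (simp only: sum.distrib 1 2 3 quadratic_form_def)
  finally show ?thesis by simp
qed

lemma quadratic_form_unit:
  assumes "finite S" "i \<in> S" "\<And>l m. l \<in> S \<Longrightarrow> m \<in> S \<Longrightarrow> B l m = B m l"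
  shows "quadratic_form S B (\<lambda>l. if l = i then s else 0) = s\<^sup>2 * B i i"
proof -
  have "quadratic_form S B (\<lambda>l. 0 + (if l = i then s else 0))
      = quadratic_form S B (\<lambda>_. 0) + 2 * s * (\<Sum>l\<in>S. B i l * 0) + s\<^sup>2 * B i i"
    by (rule quadratic_form_shift[where B = B and r = "\<lambda>_. 0", OF assms])
  then show ?thesis by (simp only: add_0 mult_zero_right sum.neutral_const quadratic_form_def)
qed

text \<open>Gaussian elimination splits the symmetric matrix \<open>B\<close> into rank one terms \<open>r r\<^sup>T\<close>, and the trace of \<open>A\<close>
  times such a term is a value of the quadratic form of \<open>A\<close>. Each step clears at least one diagonal entry,
  and a vanishing diagonal entry of a semidefinite matrix forces a vanishing row.\<close>

lemma trace_mult_nonneg: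
  assumes S: "finite S"
    and A: "\<And>r. 0 \<le> quadratic_form S A r"
    and sym: "\<And>l m. l \<in> S \<Longrightarrow> m \<in> S \<Longrightarrow> B l m = B m l"
    and B: "\<And>r. 0 \<le> quadratic_form S B r"
  shows "0 \<le> (\<Sum>l\<in>S. \<Sum>m\<in>S. A l m * B l m)"
  using sym B
proof (induction "card {l \<in> S. B l l \<noteq> 0}" arbitrary: B rule: less_induct)
  case less
  have diag: "0 \<le> B i i" if "i \<in> S" for i
    using less.prems(2)[of "\<lambda>l. if l = i then 1 else 0"]
      quadratic_form_unit[where B = B and s = 1, OF S that less.prems(1)] by simp
  have row: "B i m = 0" if i: "i \<in> S" "B i i = 0" and m: "m \<in> S" for i m
  proof -
    let ?r = "\<lambda>l. if l = m then 1 else (0 :: real)"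
    have q: "quadratic_form S B ?r = B m m"
      using quadratic_form_unit[where B = B and s = 1, OF S m less.prems(1)] by simp
    have b: "(\<Sum>l\<in>S. B i l * ?r l) = B i m"
    proof -
      have "(\<Sum>l\<in>S. B i l * ?r l) = (\<Sum>l\<in>S. if l = m then B i l else 0)" by (intro sum.cong) auto
      then show ?thesis using S m by simp
    qed
    have "0 \<le> B m m + 2 * s * B i m" for s
      using less.prems(2)[of "\<lambda>l. ?r l + (if l = i then s else 0)"]
        quadratic_form_shift[where B = B and r = ?r and s = s, OF S i(1) less.prems(1)] i(2)
      by (simp only: q b mult_zero_right add_0_right)
    \<comment> \<open>The multiple for which the form would take the value \<open>- 1\<close> if \<open>B i m\<close> did not vanish.\<close>
    from this[of "- (B m m + 1) / (2 * B i m)"] show ?thesis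
      by (cases "B i m = 0") (auto simp: field_simps)
  qed
  show ?case
  proof (cases "\<exists>i\<in>S. B i i \<noteq> 0")
    case False
    then have "B l m = 0" if "l \<in> S" "m \<in> S" for l m using row that by blast
    then show ?thesis by simp
  next
    case True
    then obtain i where i: "i \<in> S" "B i i \<noteq> 0" by blast
    then have pos: "0 < B i i" using diag[OF i(1)] by simp
    define C where "C l m = B l m - B i l * B i m / B i i" for l m
    have C_sym: "C l m = C m l" if "l \<in> S" "m \<in> S" for l m
      using less.prems(1)[OF that] by (simp add: C_def mult.commute)
    have C_form: "0 \<le> quadratic_form S C r" for r
    proof -
      let ?b = "\<Sum>l\<in>S. B i l * r l"
      have "quadratic_form S C r = quadratic_form S B r - ?b * ?b / B i i"
        unfolding quadratic_form_def sum_product sum_divide_distrib sum_subtractf[symmetric]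
        by (intro sum.cong refl) (simp add: C_def left_diff_distrib)
      also have "\<dots> = quadratic_form S B (\<lambda>l. r l + (if l = i then - ?b / B i i else 0))"
        using quadratic_form_shift[where B = B and r = r and s = "- ?b / B i i", OF S i(1) less.prems(1)] i(2)
        by (simp add: power2_eq_square)
      finally show ?thesis using less.prems(2) by simp
    qed
    have "{l \<in> S. C l l \<noteq> 0} \<subset> {l \<in> S. B l l \<noteq> 0}"
    proof
      have "C l l = 0" if l: "l \<in> S" "B l l = 0" for l
        using row[OF l i(1)] less.prems(1)[OF i(1) l(1)] l(2) by (simp add: C_def)
      then show "{l \<in> S. C l l \<noteq> 0} \<subseteq> {l \<in> S. B l l \<noteq> 0}" by blast
      have "C i i = 0" using i(2) by (simp add: C_def)
      then show "{l \<in> S. C l l \<noteq> 0} \<noteq> {l \<in> S. B l l \<noteq> 0}" using i by blast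
    qed
    then have "card {l \<in> S. C l l \<noteq> 0} < card {l \<in> S. B l l \<noteq> 0}"
      using S by (intro psubset_card_mono) auto
    from less.hyps[OF this C_sym C_form] have C: "0 \<le> (\<Sum>l\<in>S. \<Sum>m\<in>S. A l m * C l m)" .
    have "(\<Sum>l\<in>S. \<Sum>m\<in>S. A l m * B l m)
        = (\<Sum>l\<in>S. \<Sum>m\<in>S. A l m * C l m) + quadratic_form S A (B i) / B i i"
      unfolding quadratic_form_def sum_divide_distrib sum.distrib[symmetric]
      by (intro sum.cong refl) (simp add: C_def right_diff_distrib)
    then show ?thesis using C A[of "B i"] pos by simp
  qed
qed

definition C2_data ::
    "(real ^ 'd \<Rightarrow> real) \<Rightarrow> (real ^ 'd \<Rightarrow> real ^ 'd) \<Rightarrow> (real ^ 'd \<Rightarrow> (real ^ 'd) \<Rightarrow>\<^sub>L (real ^ 'd)) \<Rightarrow> bool" where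
  "C2_data \<phi> D\<phi> D2\<phi> \<longleftrightarrow>
     (\<forall>x. GDERIV \<phi> x :> D\<phi> x) \<and> (\<forall>x. (D\<phi> has_derivative blinfun_apply (D2\<phi> x)) (at x)) \<and>
     continuous_on UNIV D2\<phi> \<and>
     (\<forall>x a b. blinfun_apply (D2\<phi> x) a \<bullet> b = blinfun_apply (D2\<phi> x) b \<bullet> a)"

lemma GDERIV_line_at:
  assumes "\<And>x. GDERIV \<phi> x :> D\<phi> x"
  shows "((\<lambda>t. \<phi> (x + t *\<^sub>R y)) has_real_derivative D\<phi> (x + t *\<^sub>R y) \<bullet> y) (at t)"
proof -
  have "(\<phi> has_derivative (\<lambda>h. h \<bullet> D\<phi> (x + t *\<^sub>R y))) (at (x + t *\<^sub>R y))"
    using assms by (simp add: gderiv_def)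
  moreover have "((\<lambda>t. x + t *\<^sub>R y) has_derivative (\<lambda>t. t *\<^sub>R y)) (at t)"
    by (auto intro!: derivative_eq_intros)
  ultimately have "((\<lambda>t. \<phi> (x + t *\<^sub>R y)) has_derivative (\<lambda>s. (s *\<^sub>R y) \<bullet> D\<phi> (x + t *\<^sub>R y))) (at t)"
    using has_derivative_compose by fastforce
  then show ?thesis
    by (simp add: has_field_derivative_def inner_commute mult_commute_abs)
qed

lemma inner_derivative_line_at:
  fixes f :: "'a::real_normed_vector \<Rightarrow> 'b::real_inner"
  assumes "\<And>x. (f has_derivative blinfun_apply (f' x)) (at x)"
  shows "((\<lambda>t. f (x + t *\<^sub>R y) \<bullet> z) has_real_derivative blinfun_apply (f' (x + t *\<^sub>R y)) y \<bullet> z) (at t)"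
proof -
  have "((\<lambda>t. x + t *\<^sub>R y) has_derivative (\<lambda>t. t *\<^sub>R y)) (at t)"
    by (auto intro!: derivative_eq_intros)
  from has_derivative_compose[OF this assms[of "x + t *\<^sub>R y"]]
  have "((\<lambda>t. f (x + t *\<^sub>R y)) has_derivative (\<lambda>s. blinfun_apply (f' (x + t *\<^sub>R y)) (s *\<^sub>R y))) (at t)" .
  from has_derivative_inner_left[OF this, of z]
  show ?thesis
    by (simp add: has_field_derivative_def blinfun.scaleR_right mult_commute_abs)
qed

context
  fixes \<phi> :: "real ^ 'd \<Rightarrow> real" and D\<phi> D2\<phi>
  assumes C2: "C2_data \<phi> D\<phi> D2\<phi>"
begin

lemma C2_grad: "GDERIV \<phi> x :> D\<phi> x"
  and C2_hess: "(D\<phi> has_derivative blinfun_apply (D2\<phi> x)) (at x)"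
  and C2_cont: "continuous_on UNIV D2\<phi>"
  and C2_sym: "blinfun_apply (D2\<phi> x) a \<bullet> b = blinfun_apply (D2\<phi> x) b \<bullet> a"
  using C2 by (simp_all add: C2_data_def)

lemma C2_grad_continuous: "continuous_on UNIV D\<phi>"
  by (rule has_derivative_continuous_on) (use C2_hess in auto)

text \<open>If the second derivative in direction \<open>y\<close> were larger, then the symmetric second difference would
  be strictly convex in the step near zero and exceed its bound.\<close>

lemma semiconcave_hessian_le:
  assumes sc: "midpoint_semiconcave c \<phi>"
  shows "blinfun_apply (D2\<phi> x) y \<bullet> y \<le> 2 * c * (norm y)\<^sup>2"
proof (rule ccontr)
  let ?k = "c * (norm y)\<^sup>2"
  let ?p = "\<lambda>t. D\<phi> (x + t *\<^sub>R y) \<bullet> y"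
  assume "\<not> ?thesis"
  then have gt: "2 * ?k < blinfun_apply (D2\<phi> x) y \<bullet> y" by simp
  let ?\<chi> = "\<lambda>t. \<phi> (x + t *\<^sub>R y) + \<phi> (x + t *\<^sub>R (- y)) - 2 * ?k * t\<^sup>2"
  let ?\<omega> = "\<lambda>t. D\<phi> (x + t *\<^sub>R y) \<bullet> y + D\<phi> (x + t *\<^sub>R (- y)) \<bullet> (- y) - 4 * ?k * t"
  have d\<chi>: "(?\<chi> has_real_derivative ?\<omega> t) (at t)" for t
    by (rule derivative_eq_intros GDERIV_line_at[OF C2_grad] refl)+ simp
  have d\<omega>: "(?\<omega> has_real_derivative (2 * (blinfun_apply (D2\<phi> x) y \<bullet> y) - 4 * ?k)) (at 0)"
  proof -
    have "((\<lambda>t. 4 * ?k * t) has_real_derivative 4 * ?k) (at 0)"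
      by (auto intro!: derivative_eq_intros)
    from DERIV_diff[OF DERIV_add[OF inner_derivative_line_at[OF C2_hess, of x y y 0]
          inner_derivative_line_at[OF C2_hess, of x "- y" "- y" 0]] this]
    show ?thesis by (simp add: blinfun.minus_right)
  qed
  have "0 < 2 * (blinfun_apply (D2\<phi> x) y \<bullet> y) - 4 * ?k" using gt by simp
  from DERIV_pos_inc_right[OF d\<omega> this] obtain r where r: "0 < r" "\<And>t. 0 < t \<Longrightarrow> t < r \<Longrightarrow> ?\<omega> 0 < ?\<omega> t"
    by auto
  obtain z where z: "0 < z" "z < r / 2" "?\<chi> (r / 2) - ?\<chi> 0 = (r / 2 - 0) * ?\<omega> z"
    using MVT2[of 0 "r / 2" ?\<chi> ?\<omega>] d\<chi> r(1) by auto
  have "0 < ?\<omega> z" using r(2)[of z] z by simp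
  then have "0 < (r / 2 - 0) * ?\<omega> z" using r(1) by (intro mult_pos_pos) auto
  then have "?\<chi> 0 < ?\<chi> (r / 2)" using z(3) by linarith
  moreover have "\<phi> (x + (r / 2) *\<^sub>R y) + \<phi> (x - (r / 2) *\<^sub>R y) \<le> 2 * \<phi> x + 2 * c * (norm ((r / 2) *\<^sub>R y))\<^sup>2"
    using sc unfolding midpoint_semiconcave_def by blast
  ultimately show False by (simp add: power_mult_distrib power_divide)
qed

text \<open>Taylor's formula with the upper bound on the second derivative, by monotonicity of the first.\<close>

lemma semiconcave_tangent_le:
  assumes sc: "midpoint_semiconcave c \<phi>"
  shows "\<phi> (x + y) \<le> \<phi> x + D\<phi> x \<bullet> y + c * (norm y)\<^sup>2"
proof -
  let ?k = "c * (norm y)\<^sup>2"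
  let ?f = "\<lambda>t. \<phi> (x + t *\<^sub>R y) - (D\<phi> x \<bullet> y) * t - ?k * t\<^sup>2"
  let ?f' = "\<lambda>t. D\<phi> (x + t *\<^sub>R y) \<bullet> y - D\<phi> x \<bullet> y - 2 * ?k * t"
  have df: "(?f has_real_derivative ?f' t) (at t)" for t
    by (rule derivative_eq_intros GDERIV_line_at[OF C2_grad] refl)+ simp
  have df': "(?f' has_real_derivative (blinfun_apply (D2\<phi> (x + t *\<^sub>R y)) y \<bullet> y - 2 * ?k)) (at t)" for t
    by (rule derivative_eq_intros inner_derivative_line_at[OF C2_hess] refl)+ simp
  have neg: "?f' t \<le> 0" if "0 \<le> t" for t
  proof -
    have "?f' t \<le> ?f' 0"
      by (rule DERIV_nonpos_imp_nonincreasing[OF that])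
         (use df' semiconcave_hessian_le[OF sc] in \<open>auto intro!: exI simp: mult.assoc\<close>)
    then show ?thesis by simp
  qed
  have "?f 1 \<le> ?f 0"
    by (rule DERIV_nonpos_imp_nonincreasing) (use df neg in \<open>auto intro!: exI\<close>)
  then show ?thesis by simp
qed

lemma coord_lipschitz_grad_bound:
  assumes "coord_lipschitz R \<phi>"
  shows "\<bar>D\<phi> x $ i\<bar> \<le> R"
proof -
  have le: "D\<phi> x \<bullet> d \<le> R" if d: "d = axis i 1 \<or> d = - axis i 1" for d
  proof -
    have "((\<lambda>t. R * t - \<phi> (x + t *\<^sub>R d)) has_real_derivative (R - D\<phi> x \<bullet> d)) (at 0)"
      using GDERIV_line[OF C2_grad, of x d] by (auto intro!: derivative_eq_intros)
    then have "0 \<le> R - D\<phi> x \<bullet> d"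
    proof (rule nonneg_derivative_at_right[OF _ zero_less_one])
      fix t :: real assume t: "0 < t" "t < 1"
      have "\<bar>\<phi> (x + t *\<^sub>R d) - \<phi> x\<bar> \<le> R * \<bar>t\<bar>"
        using d assms[unfolded coord_lipschitz_def, rule_format, of x t i]
          assms[unfolded coord_lipschitz_def, rule_format, of x "- t" i] by auto
      then show "R * 0 - \<phi> (x + 0 *\<^sub>R d) \<le> R * t - \<phi> (x + t *\<^sub>R d)" using t by (simp add: abs_le_iff)
    qed
    then show ?thesis by simp
  qed
  from le[of "axis i 1"] le[of "- axis i 1"] show ?thesis by (simp add: inner_axis abs_le_iff)
qed

lemma grad_torus_periodic:
  assumes "torus_periodic \<phi>"
  shows "torus_periodic D\<phi>"
  unfolding torus_periodic_def
proof (intro allI)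
  fix x :: "real ^ 'd" and i
  have "((\<lambda>x. x + axis i 1) has_derivative (\<lambda>h. h)) (at x)"
    by (auto intro!: derivative_eq_intros)
  from has_derivative_compose[OF this C2_grad[of "x + axis i 1", unfolded gderiv_def]]
  have "(\<phi> has_derivative (\<lambda>h. h \<bullet> D\<phi> (x + axis i 1))) (at x)"
    using torus_periodicD[OF assms] by simp
  from has_derivative_unique[OF this C2_grad[of x, unfolded gderiv_def]]
  have "h \<bullet> D\<phi> (x + axis i 1) = h \<bullet> D\<phi> x" for h by meson
  then show "D\<phi> (x + axis i 1) = D\<phi> x" using vector_eq_ldot by blast
qed

end

text \<open>By the mean value theorem a difference quotient is a value of the derivative nearby, and the
  derivative is periodic, hence uniformly continuous.\<close>

lemma uniform_difference_quotient:
  fixes f :: "real ^ 'd \<Rightarrow> real"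
  assumes per: "torus_periodic f"
    and f: "\<And>x t. ((\<lambda>t. f (x + t *\<^sub>R d)) has_real_derivative f' (x + t *\<^sub>R d)) (at t)"
    and cont: "continuous_on UNIV f'" and d: "norm d \<le> 1" and e: "0 < e"
  obtains r where "0 < r" "\<And>k x. 0 < k \<Longrightarrow> k < r \<Longrightarrow> \<bar>(f (x + k *\<^sub>R d) - f x) / k - f' x\<bar> \<le> e"
proof -
  have "torus_periodic f'"
    unfolding torus_periodic_def
  proof (intro allI)
    fix x :: "real ^ 'd" and i
    have "(\<lambda>t. f ((x + axis i 1) + t *\<^sub>R d)) = (\<lambda>t. f (x + t *\<^sub>R d))"
    proof
      fix t
      have "(x + axis i 1) + t *\<^sub>R d = (x + t *\<^sub>R d) + axis i 1" by simp
      then show "f ((x + axis i 1) + t *\<^sub>R d) = f (x + t *\<^sub>R d)" using torus_periodicD[OF per] by metis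
    qed
    then show "f' (x + axis i 1) = f' x"
      using f[of "x + axis i 1" 0] f[of x 0] DERIV_unique by fastforce
  qed
  from torus_periodic_uniformly_continuous[OF this cont e]
  obtain r where r: "0 < r" "\<And>x y. norm (y - x) < r \<Longrightarrow> norm (f' y - f' x) < e" by blast
  have "\<bar>(f (x + k *\<^sub>R d) - f x) / k - f' x\<bar> \<le> e" if k: "0 < k" "k < r" for k x
  proof -
    obtain z where z: "0 < z" "z < k" "f (x + k *\<^sub>R d) - f (x + 0 *\<^sub>R d) = (k - 0) * f' (x + z *\<^sub>R d)"
      using MVT2[of 0 k "\<lambda>t. f (x + t *\<^sub>R d)" "\<lambda>t. f' (x + t *\<^sub>R d)"] f k(1) by blast
    have "norm (z *\<^sub>R d) \<le> z * 1" using z d by (simp add: mult_left_le)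
    then have "norm (z *\<^sub>R d) < r" using z k by linarith
    then have "norm (f' (x + z *\<^sub>R d) - f' x) < e" using r(2)[of "x + z *\<^sub>R d" x] by (simp only: add_diff_cancel_left')
    moreover have "(f (x + k *\<^sub>R d) - f x) / k = f' (x + z *\<^sub>R d)" using z k by simp
    ultimately show ?thesis by simp
  qed
  then show thesis using that r(1) by blast
qed

lemma integral_cell_diff:
  fixes f g :: "real ^ 'd \<Rightarrow> real"
  assumes "continuous_on UNIV f" "continuous_on UNIV g"
  shows "integral (cbox 0 1) (\<lambda>x. f x - g x) = integral (cbox 0 1) f - integral (cbox 0 1) g"
  by (intro integral_diff continuous_on_cell assms)

lemma integral_cell_add:
  fixes f g :: "real ^ 'd \<Rightarrow> real"
  assumes "continuous_on UNIV f" "continuous_on UNIV g"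
  shows "integral (cbox 0 1) (\<lambda>x. f x + g x) = integral (cbox 0 1) f + integral (cbox 0 1) g"
  by (intro integral_add continuous_on_cell assms)

lemma integral_cell_add_const:
  fixes f :: "real ^ 'd \<Rightarrow> real"
  assumes "continuous_on UNIV f"
  shows "integral (cbox 0 1) (\<lambda>x. f x + b) = integral (cbox 0 1) f + b"
  using integral_cell_add[OF assms, of "\<lambda>_. b"] by (simp add: content_cell)

text \<open>Difference quotients have mean zero by periodicity and converge uniformly.\<close>

lemma integral_cell_dir_derivative:
  fixes \<phi> :: "real ^ 'd \<Rightarrow> real"
  assumes C2: "C2_data \<phi> D\<phi> D2\<phi>" and per: "torus_periodic \<phi>" and d: "norm d \<le> 1"
  shows "integral (cbox 0 1) (\<lambda>x. D\<phi> x \<bullet> d) = 0"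
proof -
  have c\<phi>: "continuous_on UNIV \<phi>"
    by (rule has_derivative_continuous_on) (use C2_grad[OF C2] in \<open>auto simp: gderiv_def\<close>)
  have cD: "continuous_on UNIV (\<lambda>x. D\<phi> x \<bullet> d)"
    by (intro continuous_intros C2_grad_continuous[OF C2])
  have "\<bar>integral (cbox 0 1) (\<lambda>x. D\<phi> x \<bullet> d)\<bar> \<le> 0 + e" if e: "0 < e" for e
  proof -
    obtain r where r: "0 < r"
      "\<And>k x. 0 < k \<Longrightarrow> k < r \<Longrightarrow> \<bar>(\<phi> (x + k *\<^sub>R d) - \<phi> x) / k - D\<phi> x \<bullet> d\<bar> \<le> e"
      by (rule uniform_difference_quotient[OF per GDERIV_line_at[OF C2_grad[OF C2]] cD d e]) blast
    let ?k = "r / 2"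
    let ?q = "\<lambda>x. (\<phi> (x + ?k *\<^sub>R d) - \<phi> x) / ?k"
    have q: "integral (cbox 0 1) ?q = 0"
      unfolding integral_divide
      using integral_cell_diff[OF continuous_on_shift[OF c\<phi>] c\<phi>, of "?k *\<^sub>R d"]
        integral_cell_shift[OF per c\<phi>, of "?k *\<^sub>R d"] by simp
    have cq: "continuous_on UNIV ?q"
      using r(1) by (intro continuous_intros continuous_on_shift c\<phi>) auto
    have b: "?q x - D\<phi> x \<bullet> d \<le> e" "D\<phi> x \<bullet> d - ?q x \<le> e" for x
      using r(2)[of ?k x] r(1) by (simp_all add: abs_le_iff)
    have "integral (cbox 0 1) (\<lambda>x. D\<phi> x \<bullet> d) \<le> integral (cbox 0 1) (\<lambda>x. ?q x + e)"
      by (intro integral_cell_le cD continuous_intros cq) (use b in \<open>auto simp: algebra_simps\<close>)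
    moreover have "integral (cbox 0 1) ?q \<le> integral (cbox 0 1) (\<lambda>x. D\<phi> x \<bullet> d + e)"
      by (intro integral_cell_le cD continuous_intros cq) (use b in \<open>auto simp: algebra_simps\<close>)
    ultimately show ?thesis
      unfolding abs_le_iff
      using q integral_cell_add_const[OF cq, of e] integral_cell_add_const[OF cD, of e] by linarith
  qed
  then have "\<bar>integral (cbox 0 1) (\<lambda>x. D\<phi> x \<bullet> d)\<bar> \<le> 0" by (rule field_le_epsilon)
  then show ?thesis by simp
qed

section \<open>Balance of the mean of the error\<close>

lemma slopes_eq_sum: "slopes h v x = (\<Sum>l\<in>Basis. ((v x - v (x + h *\<^sub>R dir l)) / h) *\<^sub>R l)"
  by (rule euclidean_eqI) (simp add: slopes_inner inner_sum_left_Basis)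

lemma slopes_continuous:
  assumes "continuous_on UNIV v" "h \<noteq> 0"
  shows "continuous_on UNIV (slopes h v)"
proof -
  have "continuous_on UNIV (\<lambda>x. v (x + h *\<^sub>R dir l))" for l by (rule continuous_on_shift[OF assms(1)])
  then show ?thesis
    unfolding slopes_eq_sum[abs_def] using assms by (intro continuous_intros) auto
qed

lemma finite_common_radius:
  assumes "finite S" "\<And>l. l \<in> S \<Longrightarrow> \<exists>r>0. \<forall>k::real. 0 < k \<and> k < r \<longrightarrow> P l k"
  shows "\<exists>r>0. \<forall>l\<in>S. \<forall>k. 0 < k \<and> k < r \<longrightarrow> P l k"
  using assms
proof (induction S)
  case empty
  then show ?case by (auto intro: exI[of _ 1])
next
  case (insert l S)
  obtain r1 where r1: "0 < r1" "\<And>k. 0 < k \<Longrightarrow> k < r1 \<Longrightarrow> P l k" using insert.prems by blast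
  obtain r2 where r2: "0 < r2" "\<And>m k. m \<in> S \<Longrightarrow> 0 < k \<Longrightarrow> k < r2 \<Longrightarrow> P m k"
    using insert.IH insert.prems by blast
  show ?case
    by (rule exI[of _ "min r1 r2"]) (use r1 r2 in auto)
qed

lemma blinfun_quadratic_form:
  fixes f :: "'a::euclidean_space \<Rightarrow>\<^sub>L 'a"
  shows "quadratic_form S (\<lambda>l m. blinfun_apply f (b l) \<bullet> b m) r
    = blinfun_apply f (\<Sum>l\<in>S. r l *\<^sub>R b l) \<bullet> (\<Sum>m\<in>S. r m *\<^sub>R b m)"
  unfolding blinfun.sum_right blinfun.scaleR_right inner_sum_left quadratic_form_def
  by (simp add: inner_sum_right sum_distrib_left mult.assoc mult.left_commute mult.commute)

text \<open>The parameter \<open>dm\<close> is the number of neighbours of a node.\<close>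

locale smooth_monotone_scheme = bounded_monotone_scheme F DF R \<rho> M K A
  for F :: "(real ^ 'd) \<times> (real ^ 'd) \<Rightarrow> real" and DF R \<rho> M K A +
  fixes D2F :: "(real ^ 'd) \<times> (real ^ 'd) \<Rightarrow> ((real ^ 'd) \<times> (real ^ 'd)) \<Rightarrow>\<^sub>L ((real ^ 'd) \<times> (real ^ 'd))"
    and J dm :: real
  assumes dm_eq: "dm = real (DIM((real ^ 'd) \<times> (real ^ 'd)))"
    and hess: "\<And>q. (DF has_derivative blinfun_apply (D2F q)) (at q)"
    and hess_cont: "continuous_on UNIV D2F"
    and hess_bound: "\<And>q. q \<in> slope_box R \<Longrightarrow> norm (D2F q) \<le> J"
begin

lemma F_continuous: "continuous_on UNIV F"
  by (rule has_derivative_continuous_on) (use grad in \<open>auto simp: gderiv_def\<close>)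

lemma DF_continuous: "continuous_on UNIV DF"
  by (rule has_derivative_continuous_on) (use hess in auto)

lemma flux_continuous:
  "continuous_on UNIV v \<Longrightarrow> k \<noteq> 0 \<Longrightarrow> continuous_on UNIV (\<lambda>x. F (slopes k v x))"
  by (rule continuous_on_compose2[OF F_continuous]) (auto intro: slopes_continuous)

lemma hessian_nonneg: "0 \<le> blinfun_apply (D2F q) y \<bullet> y"
proof -
  have "((\<lambda>t. DF (q + t *\<^sub>R y) \<bullet> y) has_real_derivative blinfun_apply (D2F q) y \<bullet> y) (at 0)"
    using inner_derivative_line_at[OF hess, of q y y 0] by simp
  then show ?thesis
  proof (rule nonneg_derivative_at_right[OF _ zero_less_one])
    fix t :: real assume t: "0 < t" "t < 1"
    have "0 \<le> t * (DF (q + t *\<^sub>R y) \<bullet> y - DF q \<bullet> y)"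
      using tangent[of q "q + t *\<^sub>R y"] tangent[of "q + t *\<^sub>R y" q] by (simp add: algebra_simps)
    then show "DF (q + 0 *\<^sub>R y) \<bullet> y \<le> DF (q + t *\<^sub>R y) \<bullet> y" using t by (simp add: zero_le_mult_iff)
  qed
qed

lemma J_nonneg: "0 \<le> J"
  using hess_bound[OF zero_in_slope_box[OF less_imp_le[OF R]]] norm_ge_zero[of "D2F 0"] by linarith

text \<open>Bounds the trace of the product of the Hessians of \<open>F\<close> and of a function with semiconcavity constant
  \<open>c\<close>: at most \<open>J\<close> for each of the \<open>dm\<^sup>2\<close> entries of the former, times \<open>2 c\<close>.\<close>

definition div_const :: "real \<Rightarrow> real" where
  "div_const c = 2 * c * J * dm\<^sup>2"

lemma div_const_nonneg: "0 \<le> c \<Longrightarrow> 0 \<le> div_const c"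
  using J_nonneg by (simp add: div_const_def)

text \<open>The divergence of \<open>DH (D\<phi>)\<close> is the trace of the product of the Hessians of
  \<open>H\<close> and \<open>\<phi>\<close>, which semiconcavity of \<open>\<phi>\<close> bounds from above. The left-hand side is this divergence
  with \<open>F\<close> in place of \<open>H\<close>: the component of \<open>DF\<close> belonging to the neighbour in direction
  \<open>dir l\<close> is differentiated in direction \<open>- dir l\<close>.\<close>

lemma divergence_le:
  assumes C2: "C2_data \<phi> D\<phi> D2\<phi>" and sc: "midpoint_semiconcave c \<phi>" and c: "0 \<le> c"
    and q: "q \<in> slope_box R"
  shows "(\<Sum>l\<in>Basis. blinfun_apply (D2F q)
      (- blinfun_apply (D2\<phi> x) (- dir l), blinfun_apply (D2\<phi> x) (- dir l)) \<bullet> l) \<le> div_const c"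
proof -
  let ?S = "Basis :: ((real ^ 'd) \<times> (real ^ 'd)) set"
  let ?A = "\<lambda>l m. blinfun_apply (D2F q) l \<bullet> m"
  let ?h = "\<lambda>l m. blinfun_apply (D2\<phi> x) (dir l) \<bullet> dir m"
  let ?B = "\<lambda>l m. 2 * c * (dir l \<bullet> dir m) - ?h l m"
  have "blinfun_apply (D2F q) (- blinfun_apply (D2\<phi> x) (- dir l), blinfun_apply (D2\<phi> x) (- dir l)) \<bullet> l
      = (\<Sum>m\<in>?S. ?A m l * ?h m l)" if l: "l \<in> ?S" for l
  proof -
    let ?w = "blinfun_apply (D2\<phi> x) (- dir l)"
    have comp: "(- ?w, ?w) \<bullet> m = ?h m l" if m: "m \<in> ?S" for m
      using C2_sym[OF C2, of x "dir l" "dir m"]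
      unfolding inner_diagonal[OF m] by (simp add: blinfun.minus_right inner_commute)
    have "(- ?w, ?w) = (\<Sum>m\<in>?S. ?h m l *\<^sub>R m)"
      by (subst euclidean_representation[symmetric]) (auto intro!: sum.cong simp only: comp)
    then show ?thesis
      by (simp add: blinfun.sum_right blinfun.scaleR_right inner_sum_left mult.commute)
  qed
  then have "(\<Sum>l\<in>?S. blinfun_apply (D2F q)
      (- blinfun_apply (D2\<phi> x) (- dir l), blinfun_apply (D2\<phi> x) (- dir l)) \<bullet> l)
      = (\<Sum>l\<in>?S. \<Sum>m\<in>?S. ?A m l * ?h m l)"
    by (intro sum.cong) auto
  also have "\<dots> = (\<Sum>l\<in>?S. \<Sum>m\<in>?S. ?A l m * ?h l m)" by (rule sum.swap)
  also have "\<dots> \<le> (\<Sum>l\<in>?S. \<Sum>m\<in>?S. ?A l m * (2 * c * (dir l \<bullet> dir m)))"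
  proof -
    have "0 \<le> (\<Sum>l\<in>?S. \<Sum>m\<in>?S. ?A l m * ?B l m)"
    proof (rule trace_mult_nonneg)
      show "0 \<le> quadratic_form ?S ?A r" for r
        using blinfun_quadratic_form[of ?S "D2F q" "\<lambda>l. l" r] hessian_nonneg by simp
      show "?B l m = ?B m l" for l m
        using C2_sym[OF C2, of x "dir l" "dir m"] by (simp add: inner_commute)
      show "0 \<le> quadratic_form ?S ?B r" for r
      proof -
        let ?y = "\<Sum>l\<in>?S. r l *\<^sub>R dir l"
        have "quadratic_form ?S ?B r
            = 2 * c * quadratic_form ?S (\<lambda>l m. blinfun_apply id_blinfun (dir l) \<bullet> dir m) r - quadratic_form ?S ?h r"
          by (simp add: quadratic_form_def left_diff_distrib sum_subtractf sum_distrib_left mult.assoc)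
        also have "\<dots> = 2 * c * (norm ?y)\<^sup>2 - blinfun_apply (D2\<phi> x) ?y \<bullet> ?y"
          unfolding blinfun_quadratic_form by (simp add: power2_norm_eq_inner)
        finally show ?thesis using semiconcave_hessian_le[OF C2 sc, of x ?y] by simp
      qed
    qed simp
    then show ?thesis by (simp add: right_diff_distrib sum_subtractf)
  qed
  also have "\<dots> \<le> (\<Sum>l\<in>?S. \<Sum>m\<in>?S. J * (2 * c * 1))"
  proof (intro sum_mono)
    fix l m :: "(real ^ 'd) \<times> (real ^ 'd)" assume l: "l \<in> ?S" and m: "m \<in> ?S"
    have "\<bar>?A l m\<bar> \<le> norm (blinfun_apply (D2F q) l) * norm m" by (rule Cauchy_Schwarz_ineq2)
    also have "\<dots> \<le> norm (D2F q)" using norm_blinfun[of "D2F q" l] l m by simp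
    finally have a: "\<bar>?A l m\<bar> \<le> J" using hess_bound[OF q] by linarith
    have d: "\<bar>dir l \<bullet> dir m\<bar> \<le> 1"
      using Cauchy_Schwarz_ineq2[of "dir l" "dir m"] l m by (simp add: norm_dir)
    have "?A l m * (2 * c * (dir l \<bullet> dir m)) \<le> \<bar>?A l m\<bar> * (2 * c * \<bar>dir l \<bullet> dir m\<bar>)"
      using c by (simp add: abs_mult[symmetric] order_trans[OF abs_ge_self] abs_mult)
    also have "\<dots> \<le> J * (2 * c * 1)"
      using a d c by (intro mult_mono mult_left_mono) auto
    finally show "?A l m * (2 * c * (dir l \<bullet> dir m)) \<le> J * (2 * c * 1)" .
  qed
  also have "\<dots> = div_const c" unfolding div_const_def by (simp add: power2_eq_square dm_eq)
  finally show ?thesis .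
qed

text \<open>A fine step \<open>k\<close> for which the discrete counterparts of the divergence and the gradient of the fixed
  function \<open>\<phi>\<close> have come within \<open>e\<close> of their limits.\<close>

definition good_step :: "real \<Rightarrow> real \<Rightarrow> (real ^ 'd \<Rightarrow> real) \<Rightarrow> (real ^ 'd \<Rightarrow> real ^ 'd) \<Rightarrow> real \<Rightarrow> bool" where
  "good_step c e \<phi> D\<phi> k \<longleftrightarrow>
     (\<forall>x. (\<Sum>l\<in>Basis. (DF (- D\<phi> (x + k *\<^sub>R (- dir l)), D\<phi> (x + k *\<^sub>R (- dir l))) \<bullet> l
          - DF (- D\<phi> x, D\<phi> x) \<bullet> l) / k) \<le> div_const c + dm * e) \<and>
     (\<forall>x. \<forall>l\<in>Basis. \<bar>(slopes k \<phi> x - (- D\<phi> x, D\<phi> x)) \<bullet> l\<bar> \<le> e)"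

lemma eventually_good_step:
  assumes C2: "C2_data \<phi> D\<phi> D2\<phi>" and adm: "admissible R c \<phi>" and c: "0 \<le> c" and e: "0 < e"
  obtains r where "0 < r" "\<And>k. 0 < k \<Longrightarrow> k < r \<Longrightarrow> good_step c e \<phi> D\<phi> k"
proof -
  let ?S = "Basis :: ((real ^ 'd) \<times> (real ^ 'd)) set"
  let ?\<Sigma> = "\<lambda>x. (- D\<phi> x, D\<phi> x)"
  let ?a = "\<lambda>l x. DF (?\<Sigma> x) \<bullet> l"
  let ?a' = "\<lambda>l x. blinfun_apply (D2F (?\<Sigma> x)) (- blinfun_apply (D2\<phi> x) (- dir l), blinfun_apply (D2\<phi> x) (- dir l)) \<bullet> l"
  have per: "torus_periodic \<phi>" and lip: "coord_lipschitz R \<phi>" and sc: "midpoint_semiconcave c \<phi>"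
    using adm by (simp_all add: admissible_def)
  have perD: "torus_periodic D\<phi>" by (rule grad_torus_periodic[OF C2 per])
  have contD: "continuous_on UNIV D\<phi>" by (rule C2_grad_continuous[OF C2])
  have cont\<Sigma>: "continuous_on UNIV ?\<Sigma>" by (intro continuous_intros contD)
  have box: "?\<Sigma> x \<in> slope_box R" for x
    by (rule diagonal_in_slope_box[OF coord_lipschitz_grad_bound[OF C2 lip]])
  have "\<exists>r>0. \<forall>l\<in>?S. \<forall>k. 0 < k \<and> k < r \<longrightarrow>
      (\<forall>x. (?a l (x + k *\<^sub>R (- dir l)) - ?a l x) / k - ?a' l x \<le> e)"
  proof (rule finite_common_radius[OF finite_Basis])
    fix l assume l: "l \<in> ?S"
    have pera: "torus_periodic (?a l)" using perD unfolding torus_periodic_def by simp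
    have der: "((\<lambda>t. ?a l (x + t *\<^sub>R (- dir l))) has_real_derivative ?a' l (x + t *\<^sub>R (- dir l))) (at t)" for x t
    proof -
      let ?z = "x + t *\<^sub>R (- dir l)"
      have "((\<lambda>t. x + t *\<^sub>R (- dir l)) has_derivative (\<lambda>t. t *\<^sub>R (- dir l))) (at t)"
        by (rule derivative_eq_intros refl)+ simp
      from has_derivative_compose[OF this C2_hess[OF C2]]
      have d: "((\<lambda>t. D\<phi> (x + t *\<^sub>R (- dir l))) has_derivative (\<lambda>s. blinfun_apply (D2\<phi> ?z) (s *\<^sub>R (- dir l)))) (at t)" .
      from has_derivative_compose[OF has_derivative_Pair[OF has_derivative_minus[OF d] d] hess]
      have "((\<lambda>t. DF (?\<Sigma> (x + t *\<^sub>R (- dir l)))) has_derivative (\<lambda>s. blinfun_apply (D2F (?\<Sigma> ?z))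
          (- blinfun_apply (D2\<phi> ?z) (s *\<^sub>R (- dir l)), blinfun_apply (D2\<phi> ?z) (s *\<^sub>R (- dir l))))) (at t)" .
      from has_derivative_inner_left[OF this, of l]
      have "((\<lambda>t. ?a l (x + t *\<^sub>R (- dir l))) has_derivative (\<lambda>s. blinfun_apply (D2F (?\<Sigma> ?z))
          (- blinfun_apply (D2\<phi> ?z) (s *\<^sub>R (- dir l)), blinfun_apply (D2\<phi> ?z) (s *\<^sub>R (- dir l))) \<bullet> l)) (at t)" .
      moreover have "(- blinfun_apply (D2\<phi> ?z) (s *\<^sub>R (- dir l)), blinfun_apply (D2\<phi> ?z) (s *\<^sub>R (- dir l)))
          = s *\<^sub>R (- blinfun_apply (D2\<phi> ?z) (- dir l), blinfun_apply (D2\<phi> ?z) (- dir l))" for s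
        by (simp add: blinfun.scaleR_right blinfun.minus_right)
      ultimately show ?thesis
        by (simp only: has_field_derivative_def blinfun.scaleR_right inner_scaleR_left mult_commute_abs)
    qed
    have cont: "continuous_on UNIV (?a' l)"
      by (intro continuous_intros continuous_on_compose2[OF hess_cont] cont\<Sigma> C2_cont[OF C2]) auto
    have "norm (- dir l) \<le> 1" using l by (simp add: norm_dir)
    from uniform_difference_quotient[OF pera der cont this e]
    obtain r where "0 < r" "\<And>k x. 0 < k \<Longrightarrow> k < r \<Longrightarrow> \<bar>(?a l (x + k *\<^sub>R (- dir l)) - ?a l x) / k - ?a' l x\<bar> \<le> e"
      by blast
    then show "\<exists>r>0. \<forall>k. 0 < k \<and> k < r \<longrightarrow> (\<forall>x. (?a l (x + k *\<^sub>R (- dir l)) - ?a l x) / k - ?a' l x \<le> e)"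
      by (meson abs_le_D1)
  qed
  then obtain r1 where r1: "0 < r1" "\<And>l k x. l \<in> ?S \<Longrightarrow> 0 < k \<Longrightarrow> k < r1 \<Longrightarrow>
      (?a l (x + k *\<^sub>R (- dir l)) - ?a l x) / k - ?a' l x \<le> e" by blast
  have "\<exists>r>0. \<forall>l\<in>?S. \<forall>k. 0 < k \<and> k < r \<longrightarrow> (\<forall>x. \<bar>(slopes k \<phi> x - ?\<Sigma> x) \<bullet> l\<bar> \<le> e)"
  proof (rule finite_common_radius[OF finite_Basis])
    fix l assume l: "l \<in> ?S"
    have cont: "continuous_on UNIV (\<lambda>x. D\<phi> x \<bullet> dir l)" by (intro continuous_intros contD)
    have "norm (dir l) \<le> 1" using l by (simp add: norm_dir)
    from uniform_difference_quotient[OF per GDERIV_line_at[OF C2_grad[OF C2]] cont this e]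
    obtain r where r: "0 < r" "\<And>k x. 0 < k \<Longrightarrow> k < r \<Longrightarrow> \<bar>(\<phi> (x + k *\<^sub>R dir l) - \<phi> x) / k - D\<phi> x \<bullet> dir l\<bar> \<le> e"
      by blast
    have "(slopes k \<phi> x - ?\<Sigma> x) \<bullet> l = - ((\<phi> (x + k *\<^sub>R dir l) - \<phi> x) / k - D\<phi> x \<bullet> dir l)" for k x
      unfolding inner_diff_left slopes_inner[OF l] inner_diagonal[OF l]
      by (simp add: diff_divide_distrib inner_commute)
    then show "\<exists>r>0. \<forall>k. 0 < k \<and> k < r \<longrightarrow> (\<forall>x. \<bar>(slopes k \<phi> x - ?\<Sigma> x) \<bullet> l\<bar> \<le> e)"
      using r by (metis abs_minus_cancel)
  qed
  then obtain r2 where r2: "0 < r2" "\<And>l k x. l \<in> ?S \<Longrightarrow> 0 < k \<Longrightarrow> k < r2 \<Longrightarrow>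
      \<bar>(slopes k \<phi> x - ?\<Sigma> x) \<bullet> l\<bar> \<le> e" by blast
  have "good_step c e \<phi> D\<phi> k" if k: "0 < k" "k < min r1 r2" for k
  proof -
    have "(\<Sum>l\<in>?S. (?a l (x + k *\<^sub>R (- dir l)) - ?a l x) / k) \<le> div_const c + dm * e" for x
    proof -
      have "(\<Sum>l\<in>?S. (?a l (x + k *\<^sub>R (- dir l)) - ?a l x) / k) \<le> (\<Sum>l\<in>?S. ?a' l x + e)"
        using r1(2)[of _ k x] k by (intro sum_mono) (smt (verit))
      also have "\<dots> = (\<Sum>l\<in>?S. ?a' l x) + dm * e" by (simp add: sum.distrib dm_eq)
      also have "(\<Sum>l\<in>?S. ?a' l x) \<le> div_const c" by (rule divergence_le[OF C2 sc c box])
      finally show ?thesis by simp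
    qed
    then show ?thesis using r2(2) k unfolding good_step_def by auto
  qed
  then show thesis using that[of "min r1 r2"] r1(1) r2(1) by simp
qed

text \<open>Convexity bounds the flux of \<open>U\<close> from below by its linearization at \<open>\<phi>\<close>. After a discrete
  integration by parts the difference \<open>U - \<phi> + \<kappa>\<close>, which is nonnegative, is multiplied by a
  discrete divergence for which only a one-sided bound is uniform in the mollification, since
  semiconcave functions may have concave kinks.\<close>

lemma flux_lower_bound:
  assumes C2: "C2_data \<phi> D\<phi> D2\<phi>" and adm: "admissible R c \<phi>"
    and k: "0 < k" "good_step c e \<phi> D\<phi> k" and e: "0 \<le> e" and c: "0 \<le> c"
    and U: "torus_periodic U" "continuous_on UNIV U" "\<And>x. \<phi> x - \<kappa> \<le> U x"
  shows "integral (cbox 0 1) (\<lambda>x. F (- D\<phi> x, D\<phi> x))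
      - (div_const c + dm * e) * (integral (cbox 0 1) U - integral (cbox 0 1) \<phi> + \<kappa>) - dm * K * e
    \<le> integral (cbox 0 1) (\<lambda>x. F (slopes k U x))"
proof -
  let ?S = "Basis :: ((real ^ 'd) \<times> (real ^ 'd)) set"
  let ?\<Sigma> = "\<lambda>x. (- D\<phi> x, D\<phi> x)"
  let ?a = "\<lambda>l x. DF (?\<Sigma> x) \<bullet> l"
  let ?f = "\<lambda>x. U x - \<phi> x + \<kappa>"
  let ?C = "div_const c + dm * e"
  have per: "torus_periodic \<phi>" and lip: "coord_lipschitz R \<phi>"
    using adm by (simp_all add: admissible_def)
  have perD: "torus_periodic D\<phi>" by (rule grad_torus_periodic[OF C2 per])
  have cont\<phi>: "continuous_on UNIV \<phi>" by (rule coord_lipschitz_continuous[OF lip])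
  have contD: "continuous_on UNIV D\<phi>" by (rule C2_grad_continuous[OF C2])
  have cont\<Sigma>: "continuous_on UNIV ?\<Sigma>" by (intro continuous_intros contD)
  have box: "?\<Sigma> x \<in> slope_box R" for x
    by (rule diagonal_in_slope_box[OF coord_lipschitz_grad_bound[OF C2 lip]])
  have conta: "continuous_on UNIV (?a l)" for l
    by (intro continuous_intros continuous_on_compose2[OF DF_continuous cont\<Sigma>]) auto
  have contF: "continuous_on UNIV (\<lambda>x. F (?\<Sigma> x))"
    by (rule continuous_on_compose2[OF F_continuous cont\<Sigma>]) auto
  have contf: "continuous_on UNIV ?f" by (intro continuous_intros U cont\<phi>)
  have perf: "torus_periodic ?f" using U(1) per unfolding torus_periodic_def by simp
  have f0: "0 \<le> ?f x" for x using U(3)[of x] by simp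
  let ?P = "\<lambda>l x. ?a l x * ((?f x - ?f (x + k *\<^sub>R dir l)) / k)"
  let ?Q = "\<lambda>l x. ?f x * ((?a l x - ?a l (x + k *\<^sub>R (- dir l))) / k)"
  have contP: "continuous_on UNIV (?P l)" for l
    using k by (intro continuous_intros conta contf continuous_on_shift[OF contf]) auto
  have contQ: "continuous_on UNIV (?Q l)" for l
    using k by (intro continuous_intros conta contf continuous_on_shift[OF conta]) auto
  have PQ: "integral (cbox 0 1) (?P l) = integral (cbox 0 1) (?Q l)" for l
  proof -
    let ?g = "\<lambda>x. ?a l x * ?f (x + k *\<^sub>R dir l)"
    have cg: "continuous_on UNIV ?g" by (intro continuous_intros conta continuous_on_shift[OF contf])
    have pg: "torus_periodic ?g"
      using perD torus_periodic_shift[OF perf, of "k *\<^sub>R dir l"] unfolding torus_periodic_def by simp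
    have ca: "continuous_on UNIV (\<lambda>x. ?a l x * ?f x)" by (intro continuous_intros conta contf)
    have cs: "continuous_on UNIV (\<lambda>x. ?a l (x + k *\<^sub>R (- dir l)) * ?f x)"
      by (intro continuous_intros continuous_on_shift[OF conta] contf)
    have "integral (cbox 0 1) (?P l) = integral (cbox 0 1) (\<lambda>x. (?a l x * ?f x - ?g x) / k)"
      by (rule arg_cong[where f = "integral (cbox 0 1)"]) (auto simp: algebra_simps)
    also have "\<dots> = (integral (cbox 0 1) (\<lambda>x. ?a l x * ?f x) - integral (cbox 0 1) ?g) / k"
      unfolding integral_divide integral_cell_diff[OF ca cg] ..
    also have "integral (cbox 0 1) ?g = integral (cbox 0 1) (\<lambda>x. ?g (x + k *\<^sub>R (- dir l)))"
      by (rule integral_cell_shift[OF pg cg, symmetric])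
    also have "(\<lambda>x. ?g (x + k *\<^sub>R (- dir l))) = (\<lambda>x. ?a l (x + k *\<^sub>R (- dir l)) * ?f x)"
      by (rule ext) simp
    also have "(integral (cbox 0 1) (\<lambda>x. ?a l x * ?f x) - integral (cbox 0 1) (\<lambda>x. ?a l (x + k *\<^sub>R (- dir l)) * ?f x)) / k
        = integral (cbox 0 1) (\<lambda>x. (?a l x * ?f x - ?a l (x + k *\<^sub>R (- dir l)) * ?f x) / k)"
      unfolding integral_divide integral_cell_diff[OF ca cs] ..
    also have "\<dots> = integral (cbox 0 1) (?Q l)"
      by (rule arg_cong[where f = "integral (cbox 0 1)"]) (auto simp: algebra_simps)
    finally show ?thesis .
  qed
  have pointwise: "F (?\<Sigma> x) + (\<Sum>l\<in>?S. ?P l x) - dm * K * e \<le> F (slopes k U x)" for x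
  proof -
    have s: "slopes k U x - ?\<Sigma> x = slopes k ?f x + (slopes k \<phi> x - ?\<Sigma> x)"
      using slopes_add_const[of k "\<lambda>x. U x - \<phi> x" \<kappa> x] slopes_diff[of k U \<phi> x] by simp
    have p: "DF (?\<Sigma> x) \<bullet> slopes k ?f x = (\<Sum>l\<in>?S. ?P l x)" by (rule inner_slopes)
    have "- (dm * K * e) \<le> DF (?\<Sigma> x) \<bullet> (slopes k \<phi> x - ?\<Sigma> x)"
    proof -
      have "\<bar>DF (?\<Sigma> x) \<bullet> (slopes k \<phi> x - ?\<Sigma> x)\<bar> = \<bar>\<Sum>l\<in>?S. ?a l x * ((slopes k \<phi> x - ?\<Sigma> x) \<bullet> l)\<bar>"
        by (subst euclidean_inner) simp
      also have "\<dots> \<le> (\<Sum>l\<in>?S. \<bar>?a l x * ((slopes k \<phi> x - ?\<Sigma> x) \<bullet> l)\<bar>)" by (rule sum_abs)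
      also have "\<dots> \<le> (\<Sum>l\<in>?S. K * e)"
      proof (rule sum_mono)
        fix l assume l: "l \<in> ?S"
        have "\<bar>?a l x\<bar> \<le> K" by (rule norm_bound_Basis_le[OF l DF_bound[OF box]])
        moreover have "\<bar>(slopes k \<phi> x - ?\<Sigma> x) \<bullet> l\<bar> \<le> e" using k(2) l unfolding good_step_def by blast
        ultimately show "\<bar>?a l x * ((slopes k \<phi> x - ?\<Sigma> x) \<bullet> l)\<bar> \<le> K * e"
          unfolding abs_mult using K_nonneg by (intro mult_mono) auto
      qed
      also have "\<dots> = dm * K * e" by (simp add: dm_eq)
      finally show ?thesis by (simp only: abs_le_iff) linarith
    qed
    then show ?thesis
      using tangent[of "?\<Sigma> x" "slopes k U x"] unfolding s inner_add_right p by linarith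
  qed
  have contsP: "continuous_on UNIV (\<lambda>x. \<Sum>l\<in>?S. ?P l x)" by (intro continuous_intros contP)
  have contsQ: "continuous_on UNIV (\<lambda>x. \<Sum>l\<in>?S. ?Q l x)" by (intro continuous_intros contQ)
  have sums: "integral (cbox 0 1) (\<lambda>x. \<Sum>l\<in>?S. ?P l x) = integral (cbox 0 1) (\<lambda>x. \<Sum>l\<in>?S. ?Q l x)"
  proof -
    have "integral (cbox 0 1) (\<lambda>x. \<Sum>l\<in>?S. ?P l x) = (\<Sum>l\<in>?S. integral (cbox 0 1) (?P l))"
      by (intro integral_sum finite_Basis continuous_on_cell contP)
    also have "\<dots> = (\<Sum>l\<in>?S. integral (cbox 0 1) (?Q l))"
      by (intro sum.cong refl PQ)
    also have "\<dots> = integral (cbox 0 1) (\<lambda>x. \<Sum>l\<in>?S. ?Q l x)"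
      by (intro integral_sum[symmetric] finite_Basis continuous_on_cell contQ)
    finally show ?thesis .
  qed
  have "- ?C * ?f x \<le> (\<Sum>l\<in>?S. ?Q l x)" for x
  proof -
    have "(\<Sum>l\<in>?S. (?a l (x + k *\<^sub>R (- dir l)) - ?a l x) / k) \<le> ?C"
      using k(2) unfolding good_step_def by blast
    then have "?f x * (\<Sum>l\<in>?S. (?a l (x + k *\<^sub>R (- dir l)) - ?a l x) / k) \<le> ?f x * ?C"
      by (rule mult_left_mono[OF _ f0])
    moreover have alg: "y * ((b - b') / k) = - (y * ((b' - b) / k))" for y b b' :: real
      by (simp add: right_diff_distrib diff_divide_distrib)
    have "(\<Sum>l\<in>?S. ?Q l x) = - (?f x * (\<Sum>l\<in>?S. (?a l (x + k *\<^sub>R (- dir l)) - ?a l x) / k))"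
      unfolding sum_distrib_left sum_negf[symmetric]
      by (intro sum.cong refl alg)
    moreover have "- ?C * ?f x = - (?f x * ?C)" by (simp only: mult_minus_left mult.commute)
    ultimately show ?thesis by linarith
  qed
  then have Q: "integral (cbox 0 1) (\<lambda>x. - ?C * ?f x) \<le> integral (cbox 0 1) (\<lambda>x. \<Sum>l\<in>?S. ?Q l x)"
    by (intro integral_cell_le contsQ continuous_intros contf)
  have intf: "integral (cbox 0 1) ?f = integral (cbox 0 1) U - integral (cbox 0 1) \<phi> + \<kappa>"
    using integral_cell_add_const[of "\<lambda>x. U x - \<phi> x" \<kappa>] integral_cell_diff[OF U(2) cont\<phi>] U(2) cont\<phi>
    by (simp add: continuous_on_diff)
  have "integral (cbox 0 1) (\<lambda>x. F (?\<Sigma> x)) + integral (cbox 0 1) (\<lambda>x. \<Sum>l\<in>?S. ?P l x) - dm * K * e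
      = integral (cbox 0 1) (\<lambda>x. F (?\<Sigma> x) + (\<Sum>l\<in>?S. ?P l x) + - (dm * K * e))"
    using integral_cell_add_const[OF continuous_on_add[OF contF contsP], of "- (dm * K * e)"]
      integral_cell_add[OF contF contsP] by linarith
  also have "\<dots> \<le> integral (cbox 0 1) (\<lambda>x. F (slopes k U x))"
    using pointwise k by (intro integral_cell_le continuous_intros contF contsP flux_continuous U) auto
  finally show ?thesis using Q unfolding sums integral_mult_right intf by linarith
qed

end

lemma integral_cell_diff_le:
  fixes f g :: "real ^ 'd \<Rightarrow> real"
  assumes "continuous_on UNIV f" "continuous_on UNIV g" "\<And>x. \<bar>f x - g x\<bar> \<le> B"
  shows "\<bar>integral (cbox 0 1) f - integral (cbox 0 1) g\<bar> \<le> B"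
proof -
  have "integral (cbox 0 1) f \<le> integral (cbox 0 1) (\<lambda>x. g x + B)"
  proof (intro integral_cell_le continuous_intros assms)
    show "f x \<le> g x + B" for x using assms(3)[of x] by linarith
  qed
  moreover have "integral (cbox 0 1) g \<le> integral (cbox 0 1) (\<lambda>x. f x + B)"
  proof (intro integral_cell_le continuous_intros assms)
    show "g x \<le> f x + B" for x using assms(3)[of x] by linarith
  qed
  ultimately show ?thesis
    unfolding integral_cell_add_const[OF assms(1)] integral_cell_add_const[OF assms(2)] by linarith
qed

lemma viscosity_solution_slice_continuous:
  assumes "viscosity_solution H g T u" "t \<in> {0..T}"
  shows "continuous_on UNIV (\<lambda>x. u (x, t))"
proof -
  have "continuous_on (UNIV \<times> {0..T}) u" using assms(1) by (simp add: viscosity_solution_def)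
  then show ?thesis
    by (rule continuous_on_compose2) (use assms(2) in \<open>auto intro!: continuous_intros\<close>)
qed

context smooth_monotone_scheme
begin

lemma scheme_continuous:
  assumes "0 < h" "admissible R c g"
  shows "continuous_on UNIV (fd_scheme F g h (\<rho> * h) n)"
proof -
  have "coord_lipschitz R (fd_scheme F g h (\<rho> * h) n)"
    using scheme_admissible[OF assms] by (simp add: admissible_def)
  then show ?thesis by (rule coord_lipschitz_continuous)
qed

lemma integral_scheme_Suc:
  assumes h: "0 < h" and g: "admissible R c g"
  shows "integral (cbox 0 1) (fd_scheme F g h (\<rho> * h) (Suc n))
    = integral (cbox 0 1) (fd_scheme F g h (\<rho> * h) n)
      - \<rho> * h * integral (cbox 0 1) (\<lambda>x. F (slopes h (fd_scheme F g h (\<rho> * h) n) x))"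
proof -
  let ?v = "fd_scheme F g h (\<rho> * h) n"
  have c: "continuous_on UNIV ?v" by (rule scheme_continuous[OF h g])
  have f: "continuous_on UNIV (\<lambda>x. \<rho> * h * F (slopes h ?v x))"
    using h by (intro continuous_intros flux_continuous c) auto
  have "integral (cbox 0 1) (fd_scheme F g h (\<rho> * h) (Suc n))
      = integral (cbox 0 1) (\<lambda>x. ?v x - \<rho> * h * F (slopes h ?v x))"
    by (simp only: fd_scheme_Suc fd_step_def[abs_def])
  then show ?thesis unfolding integral_cell_diff[OF c f] integral_mult_right .
qed

text \<open>The values of the scheme during the time \<open>\<rho> k n\<close> differ from those at the start by at most
  \<open>\<rho> k n M\<close>. This keeps the scheme above \<open>\<phi>\<close> minus a constant, so that the lower bound for the flux
  with the same \<open>\<phi>\<close> can be used in each of the steps.\<close>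

lemma integral_scheme_decrease:
  assumes C2: "C2_data \<phi> D\<phi> D2\<phi>" and adm: "admissible R c \<phi>" and c: "0 \<le> c"
    and k: "0 < k" "good_step c e \<phi> D\<phi> k" and e: "0 \<le> e" and g: "admissible R c g"
    and start: "\<And>x. \<phi> x - \<kappa> \<le> fd_scheme F g k (\<rho> * k) N x"
    and j: "j \<le> n"
  shows "integral (cbox 0 1) (fd_scheme F g k (\<rho> * k) (N + j))
    \<le> integral (cbox 0 1) (fd_scheme F g k (\<rho> * k) N)
      - \<rho> * k * real j * (integral (cbox 0 1) (\<lambda>x. F (- D\<phi> x, D\<phi> x))
          - (div_const c + dm * e) * (integral (cbox 0 1) (fd_scheme F g k (\<rho> * k) N)
              - integral (cbox 0 1) \<phi> + \<kappa> + 2 * (\<rho> * k * real n * M)) - dm * K * e)"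
    (is "_ \<le> _ - _ * ?B")
  using j
proof (induction j)
  case (Suc j)
  let ?U = "fd_scheme F g k (\<rho> * k)"
  let ?w = "\<rho> * k * real n * M"
  let ?C = "div_const c + dm * e"
  have C: "0 \<le> ?C" using div_const_nonneg[OF c] e dm_eq by simp
  have adm_U: "admissible R c (?U m)" for m by (rule scheme_admissible[OF k(1) g])
  have cont: "continuous_on UNIV (?U m)" for m by (rule scheme_continuous[OF k(1) g])
  have time: "\<bar>?U (N + j) x - ?U N x\<bar> \<le> ?w" for x
  proof -
    have "\<bar>?U (N + j) x - ?U N x\<bar> \<le> \<rho> * k * real j * M"
      by (rule scheme_time_lipschitz[OF k(1)])
         (use adm_U k(1) in \<open>auto simp: admissible_def intro: coord_lipschitz_slopes\<close>)
    also have "\<dots> \<le> ?w"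
      using Suc.prems lam k(1) M_nonneg by (intro mult_right_mono mult_left_mono) auto
    finally show ?thesis .
  qed
  have low: "\<phi> x - (\<kappa> + ?w) \<le> ?U (N + j) x" for x using start[of x] time[of x] by linarith
  have per: "torus_periodic (?U (N + j))" using adm_U by (simp add: admissible_def)
  have "integral (cbox 0 1) (?U (N + j)) \<le> integral (cbox 0 1) (?U N) + ?w"
    using integral_cell_diff_le[OF cont cont time] by linarith
  then have "?C * (integral (cbox 0 1) (?U (N + j)) - integral (cbox 0 1) \<phi> + (\<kappa> + ?w))
      \<le> ?C * (integral (cbox 0 1) (?U N) - integral (cbox 0 1) \<phi> + \<kappa> + 2 * ?w)"
    by (intro mult_left_mono C) linarith
  then have "?B \<le> integral (cbox 0 1) (\<lambda>x. F (slopes k (?U (N + j)) x))"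
    using flux_lower_bound[OF C2 adm k e c per cont low] by linarith
  then have "\<rho> * k * ?B \<le> \<rho> * k * integral (cbox 0 1) (\<lambda>x. F (slopes k (?U (N + j)) x))"
    using lam k(1) by (intro mult_left_mono) auto
  moreover have "\<rho> * k * real (Suc j) * ?B = \<rho> * k * real j * ?B + \<rho> * k * ?B"
    by (simp add: distrib_left distrib_right)
  ultimately show ?case
    using Suc integral_scheme_Suc[OF k(1) g, of "N + j"] unfolding add_Suc_right by linarith
qed simp

lemma refined_scheme_tendsto:
  fixes u :: "(real ^ 'd) \<times> real \<Rightarrow> real"
  assumes T: "0 < T" and u: "viscosity_solution H g T u" and FH: "\<And>p. F (- p, p) = H p"
    and h: "0 < h" and g: "admissible R c g" and n: "real n * (\<rho> * h) \<le> T"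
  shows "(\<lambda>i. fd_scheme F g (h / 2 ^ i) (\<rho> * (h / 2 ^ i)) (n * 2 ^ i) x) \<longlonglongrightarrow> u (x, real n * (\<rho> * h))"
    and "(\<lambda>i. integral (cbox 0 1) (fd_scheme F g (h / 2 ^ i) (\<rho> * (h / 2 ^ i)) (n * 2 ^ i)))
      \<longlonglongrightarrow> integral (cbox 0 1) (\<lambda>x. u (x, real n * (\<rho> * h)))"
proof -
  let ?C = "((R * real CARD('d))\<^sup>2 + M\<^sup>2) / 2 + (1 + K * real (DIM((real ^ 'd) \<times> (real ^ 'd)))) * T / 2"
  let ?U = "\<lambda>i. fd_scheme F g (h / 2 ^ i) (\<rho> * (h / 2 ^ i)) (n * 2 ^ i)"
  let ?t = "real n * (\<rho> * h)"
  let ?b = "\<lambda>i. ?C * sqrt (h / 2 ^ i + \<rho> * (h / 2 ^ i))"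
  have hi: "0 < h / 2 ^ i" for i :: nat using h by simp
  have t: "?t \<in> {0..T}" using n h lam by simp
  have ti: "real (n * 2 ^ i) * (\<rho> * (h / 2 ^ i)) = ?t" for i by simp
  have err: "\<bar>?U i x - u (x, ?t)\<bar> \<le> ?b i" for i x
    using scheme_error_sqrt[OF T u FH hi[of i] g, of "n * 2 ^ i" x] n unfolding ti
    by (simp only: abs_minus_commute)
  have "(\<lambda>i. (h + \<rho> * h) * (1 / 2) ^ i) \<longlonglongrightarrow> (h + \<rho> * h) * 0"
    by (intro tendsto_intros LIMSEQ_power_zero) simp
  then have "(\<lambda>i. ?C * sqrt ((h + \<rho> * h) * (1 / 2) ^ i)) \<longlonglongrightarrow> ?C * sqrt 0"
    by (intro tendsto_intros) simp
  moreover have "(h + \<rho> * h) * (1 / 2) ^ i = h / 2 ^ i + \<rho> * (h / 2 ^ i)" for i :: nat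
    by (simp add: power_divide field_simps)
  ultimately have lim: "?b \<longlonglongrightarrow> 0" by (simp only: real_sqrt_zero mult_zero_right)
  have "(\<lambda>i. ?U i x - u (x, ?t)) \<longlonglongrightarrow> 0"
    using err[of _ x] by (intro Lim_null_comparison[OF _ lim] always_eventually allI) (simp only: real_norm_def)
  then show "(\<lambda>i. ?U i x) \<longlonglongrightarrow> u (x, ?t)" by (rule Lim_null[THEN iffD2])
  have "norm (integral (cbox 0 1) (?U i) - integral (cbox 0 1) (\<lambda>x. u (x, ?t))) \<le> ?b i" for i
    unfolding real_norm_def
    by (intro integral_cell_diff_le scheme_continuous[OF hi g] viscosity_solution_slice_continuous[OF u t] err)
  then have "(\<lambda>i. integral (cbox 0 1) (?U i) - integral (cbox 0 1) (\<lambda>x. u (x, ?t))) \<longlonglongrightarrow> 0"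
    by (intro Lim_null_comparison[OF _ lim] always_eventually allI)
  then show "(\<lambda>i. integral (cbox 0 1) (?U i)) \<longlonglongrightarrow> integral (cbox 0 1) (\<lambda>x. u (x, ?t))"
    by (rule Lim_null[THEN iffD2])
qed

text \<open>The refined schemes lie above the given one up to a fixed multiple of \<open>h\<close> and converge to \<open>u\<close>.\<close>

lemma solution_ge_scheme:
  fixes u :: "(real ^ 'd) \<times> real \<Rightarrow> real"
  assumes T: "0 < T" and u: "viscosity_solution H g T u" and FH: "\<And>p. F (- p, p) = H p"
    and h: "0 < h" and g: "admissible R c g" and c: "0 \<le> c" and n: "real n * (\<rho> * h) \<le> T"
  shows "fd_scheme F g h (\<rho> * h) n x - 4 * c * A * T * h \<le> u (x, real n * (\<rho> * h))"
proof -
  have "\<rho> * h * real n \<le> T" using n by (simp only: mult.commute[of "\<rho> * h"])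
  then have "4 * c * A * h * (\<rho> * h * real n) \<le> 4 * c * A * h * T"
    using c A_nonneg h by (intro mult_left_mono) auto
  also have "4 * c * A * h * T = 4 * c * A * T * h" by simp
  finally have "fd_scheme F g h (\<rho> * h) n x - 4 * c * A * T * h
      \<le> fd_scheme F g (h / 2 ^ i) (\<rho> * (h / 2 ^ i)) (n * 2 ^ i) x" for i
    using scheme_le_refined[OF h g c, of n x i] by linarith
  then show ?thesis
    by (intro tendsto_lowerbound[OF refined_scheme_tendsto(1)[OF T u FH h g n]] always_eventually allI) simp_all
qed

text \<open>In the limit of the refined schemes the mean of \<open>u\<close> obeys a linearized balance: over a
  time step it decreases at least at the rate \<open>\<integral> H (D\<phi>)\<close>, up to the mean distance to \<open>\<phi>\<close>. The function
  \<open>\<phi>\<close> stays fixed while the refined steps tend to zero, so its difference quotients may be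
  replaced by derivatives.\<close>

lemma solution_mean_decrease:
  fixes u :: "(real ^ 'd) \<times> real \<Rightarrow> real"
  assumes T: "0 < T" and u: "viscosity_solution H g T u" and FH: "\<And>p. F (- p, p) = H p"
    and h: "0 < h" and g: "admissible R c g" and c: "0 \<le> c" and n: "real (Suc n) * (\<rho> * h) \<le> T"
    and C2: "C2_data \<phi> D\<phi> D2\<phi>" and adm: "admissible R c \<phi>"
    and start: "\<And>i x. \<phi> x - \<kappa> \<le> fd_scheme F g (h / 2 ^ i) (\<rho> * (h / 2 ^ i)) (n * 2 ^ i) x"
  shows "integral (cbox 0 1) (\<lambda>x. u (x, real (Suc n) * (\<rho> * h)))
    \<le> integral (cbox 0 1) (\<lambda>x. u (x, real n * (\<rho> * h)))
      - \<rho> * h * (integral (cbox 0 1) (\<lambda>x. F (- D\<phi> x, D\<phi> x))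
          - div_const c * (integral (cbox 0 1) (\<lambda>x. u (x, real n * (\<rho> * h)))
              - integral (cbox 0 1) \<phi> + \<kappa> + 2 * (\<rho> * h * M)))"
proof (rule le_of_forall_small_error)
  fix e :: real assume e: "0 < e"
  define V where "V n = integral (cbox 0 1) (\<lambda>x. u (x, real n * (\<rho> * h)))" for n
  define W where "W n i = integral (cbox 0 1) (fd_scheme F g (h / 2 ^ i) (\<rho> * (h / 2 ^ i)) (n * 2 ^ i))" for n i
  define I where "I = integral (cbox 0 1) (\<lambda>x. F (- D\<phi> x, D\<phi> x))"
  define P where "P = - integral (cbox 0 1) \<phi> + \<kappa> + 2 * (\<rho> * h * M)"
  let ?C = "div_const c + dm * e"
  have \<tau>: "0 < \<rho> * h" using h lam by simp
  have n': "real n * (\<rho> * h) \<le> T" using n \<tau> by (simp add: algebra_simps)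
  have lim: "W n \<longlonglongrightarrow> V n" "W (Suc n) \<longlonglongrightarrow> V (Suc n)"
    unfolding W_def[abs_def] V_def
    by (rule refined_scheme_tendsto(2)[OF T u FH h g n'], rule refined_scheme_tendsto(2)[OF T u FH h g n])
  obtain r where r: "0 < r" "\<And>k. 0 < k \<Longrightarrow> k < r \<Longrightarrow> good_step c e \<phi> D\<phi> k"
    using eventually_good_step[OF C2 adm c e] by blast
  have step: "W (Suc n) i \<le> W n i - \<rho> * h * (I - ?C * (W n i + P) - dm * K * e)" if i: "h / 2 ^ i < r" for i
  proof -
    let ?k = "h / 2 ^ i"
    have k: "0 < ?k" using h by simp
    have eq: "\<rho> * ?k * real (2 ^ i) = \<rho> * h" by simp
    have idx: "n * 2 ^ i + 2 ^ i = Suc n * 2 ^ i" by simp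
    have P: "W n i + P = W n i - integral (cbox 0 1) \<phi> + \<kappa> + 2 * (\<rho> * h * M)" by (simp add: P_def)
    show ?thesis
      using integral_scheme_decrease[where j = "2 ^ i" and n = "2 ^ i",
          OF C2 adm c k r(2)[OF k i] less_imp_le[OF e] g start order_refl]
      unfolding P unfolding eq idx W_def I_def .
  qed
  have "(\<lambda>i. h * (1 / 2) ^ i) \<longlonglongrightarrow> h * 0" by (intro tendsto_intros LIMSEQ_power_zero) simp
  then have "\<forall>\<^sub>F i in sequentially. h * (1 / 2) ^ i < r" using r(1) by (intro order_tendstoD(2)) auto
  then have ev: "\<forall>\<^sub>F i in sequentially. W (Suc n) i \<le> W n i - \<rho> * h * (I - ?C * (W n i + P) - dm * K * e)"
    by eventually_elim (use step in \<open>simp add: power_divide\<close>)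
  have "(\<lambda>i. W n i - \<rho> * h * (I - ?C * (W n i + P) - dm * K * e))
      \<longlonglongrightarrow> V n - \<rho> * h * (I - ?C * (V n + P) - dm * K * e)"
    by (intro tendsto_intros lim)
  from tendsto_le[OF sequentially_bot this lim(2) ev]
  have "V (Suc n) \<le> V n - \<rho> * h * (I - ?C * (V n + P) - dm * K * e)" .
  also have "\<dots> = V n - \<rho> * h * (I - div_const c * (V n + P)) + e * (\<rho> * h * (dm * (V n + P) + dm * K))"
    by (simp add: algebra_simps)
  finally have "V (Suc n) \<le> V n - \<rho> * h * (I - div_const c * (V n + P))
    + e * (\<rho> * h * (dm * (V n + P) + dm * K))" .
  moreover have "V n + P = V n - integral (cbox 0 1) \<phi> + \<kappa> + 2 * (\<rho> * h * M)" by (simp add: P_def)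
  ultimately show "integral (cbox 0 1) (\<lambda>x. u (x, real (Suc n) * (\<rho> * h)))
    \<le> integral (cbox 0 1) (\<lambda>x. u (x, real n * (\<rho> * h)))
      - \<rho> * h * (integral (cbox 0 1) (\<lambda>x. F (- D\<phi> x, D\<phi> x))
          - div_const c * (integral (cbox 0 1) (\<lambda>x. u (x, real n * (\<rho> * h)))
              - integral (cbox 0 1) \<phi> + \<kappa> + 2 * (\<rho> * h * M)))
      + e * (\<rho> * h * (dm * (V n + P) + dm * K))"
    by (simp only: V_def I_def)
qed

text \<open>By semiconcavity forward and backward quotients differ from the derivative by a function
  that is, up to sign, bounded below by a multiple of \<open>h\<close> and has mean zero. The truncation error,
  although of order one at kinks, is therefore of first order in the mean.\<close>

lemma flux_consistency:
  assumes v: "admissible R c v" and h: "0 < h" and c: "0 \<le> c"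
    and C2: "C2_data (mollify h v) D\<phi> D2\<phi>"
  shows "integral (cbox 0 1) (\<lambda>x. F (slopes h v x))
    \<le> integral (cbox 0 1) (\<lambda>x. F (- D\<phi> x, D\<phi> x)) + 6 * c * K * dm * h"
proof -
  let ?S = "Basis :: ((real ^ 'd) \<times> (real ^ 'd)) set"
  let ?\<phi> = "mollify h v"
  let ?\<Sigma> = "\<lambda>x. (- D\<phi> x, D\<phi> x)"
  have adm: "admissible R c ?\<phi>" by (rule mollify_admissible[OF v])
  have lip: "coord_lipschitz R v" "coord_lipschitz R ?\<phi>" and per: "torus_periodic v" "torus_periodic ?\<phi>"
    and sc: "midpoint_semiconcave c v" "midpoint_semiconcave c ?\<phi>"
    using v adm by (simp_all add: admissible_def)
  have cv: "continuous_on UNIV v" and c\<phi>: "continuous_on UNIV ?\<phi>"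
    using lip coord_lipschitz_continuous by blast+
  have cD: "continuous_on UNIV D\<phi>" by (rule C2_grad_continuous[OF C2])
  have c\<Sigma>: "continuous_on UNIV ?\<Sigma>" by (intro continuous_intros cD)
  have box: "?\<Sigma> x \<in> slope_box R" for x
    by (rule diagonal_in_slope_box[OF coord_lipschitz_grad_bound[OF C2 lip(2)]])
  have boxv: "slopes h v x \<in> slope_box R" for x by (rule coord_lipschitz_slopes[OF lip(1) h])
  let ?d = "\<lambda>x. v x - ?\<phi> x"
  have cd: "continuous_on UNIV ?d" by (intro continuous_intros cv c\<phi>)
  have pd: "torus_periodic ?d" using per unfolding torus_periodic_def by simp
  have cad: "continuous_on UNIV (\<lambda>x. \<bar>?d x\<bar>)" by (intro continuous_intros cd)
  have pad: "torus_periodic (\<lambda>x. \<bar>?d x\<bar>)" using pd unfolding torus_periodic_def by simp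
  have intd: "integral (cbox 0 1) (\<lambda>x. \<bar>?d x\<bar>) \<le> 2 * c * h\<^sup>2"
  proof -
    have "- (c * h\<^sup>2) \<le> ?d x" for x using mollify_le[OF cv sc(1) c, of h x] by simp
    then have "integral (cbox 0 1) (\<lambda>x. \<bar>?d x\<bar>) \<le> integral (cbox 0 1) ?d + 2 * (c * h\<^sup>2)"
      using c by (intro integral_cell_abs_le cd) auto
    also have "integral (cbox 0 1) ?d = 0"
      using integral_cell_diff[OF cv c\<phi>] integral_mollify[OF per(1) cv, of h] by simp
    finally show ?thesis by simp
  qed
  \<comment> \<open>Replacing \<open>v\<close> by its mollification, and difference quotients of the latter by derivatives.\<close>
  let ?X = "\<lambda>l x. (?d x - ?d (x + h *\<^sub>R dir l)) / h"
  let ?Y = "\<lambda>l x. (?\<phi> x - ?\<phi> (x + h *\<^sub>R dir l)) / h + D\<phi> x \<bullet> dir l"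
  have cX: "continuous_on UNIV (\<lambda>x. \<bar>?X l x\<bar>)" for l
    using h by (intro continuous_intros cd continuous_on_shift[OF cd]) auto
  have cY: "continuous_on UNIV (?Y l)" for l
    using h by (intro continuous_intros c\<phi> continuous_on_shift[OF c\<phi>] cD) auto
  have caY: "continuous_on UNIV (\<lambda>x. \<bar>?Y l x\<bar>)" for l by (intro continuous_intros cY)
  have intX: "integral (cbox 0 1) (\<lambda>x. \<bar>?X l x\<bar>) \<le> 4 * c * h" for l
  proof -
    have cs: "continuous_on UNIV (\<lambda>x. \<bar>?d (x + h *\<^sub>R dir l)\<bar>)"
      by (rule continuous_on_shift[OF cad])
    have "integral (cbox 0 1) (\<lambda>x. \<bar>?X l x\<bar>)
        \<le> integral (cbox 0 1) (\<lambda>x. (\<bar>?d x\<bar> + \<bar>?d (x + h *\<^sub>R dir l)\<bar>) / h)"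
    proof (intro integral_cell_le cX)
      show "continuous_on UNIV (\<lambda>x. (\<bar>?d x\<bar> + \<bar>?d (x + h *\<^sub>R dir l)\<bar>) / h)"
        using h by (intro continuous_intros cad cs) auto
      show "\<bar>?X l x\<bar> \<le> (\<bar>?d x\<bar> + \<bar>?d (x + h *\<^sub>R dir l)\<bar>) / h" for x
        using h abs_triangle_ineq4[of "?d x" "?d (x + h *\<^sub>R dir l)"] by (simp add: divide_right_mono)
    qed
    also have "\<dots> = (integral (cbox 0 1) (\<lambda>x. \<bar>?d x\<bar>) + integral (cbox 0 1) (\<lambda>x. \<bar>?d (x + h *\<^sub>R dir l)\<bar>)) / h"
      unfolding integral_divide integral_cell_add[OF cad cs] ..
    also have "integral (cbox 0 1) (\<lambda>x. \<bar>?d (x + h *\<^sub>R dir l)\<bar>) = integral (cbox 0 1) (\<lambda>x. \<bar>?d x\<bar>)"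
      by (rule integral_cell_shift[OF pad cad])
    also have "(integral (cbox 0 1) (\<lambda>x. \<bar>?d x\<bar>) + integral (cbox 0 1) (\<lambda>x. \<bar>?d x\<bar>)) / h \<le> (2 * c * h\<^sup>2 + 2 * c * h\<^sup>2) / h"
      using intd h by (intro divide_right_mono add_mono) auto
    also have "\<dots> = 4 * c * h" using h by (simp add: power2_eq_square field_simps)
    finally show ?thesis .
  qed
  have intY: "integral (cbox 0 1) (\<lambda>x. \<bar>?Y l x\<bar>) \<le> 2 * c * h" if l: "l \<in> ?S" for l
  proof -
    have low: "- (c * h) \<le> ?Y l x" for x
    proof -
      have "?\<phi> (x + h *\<^sub>R dir l) \<le> ?\<phi> x + D\<phi> x \<bullet> (h *\<^sub>R dir l) + c * (norm (h *\<^sub>R dir l))\<^sup>2"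
        by (rule semiconcave_tangent_le[OF C2 sc(2)])
      moreover have "?Y l x * h = ?\<phi> x - ?\<phi> (x + h *\<^sub>R dir l) + (D\<phi> x \<bullet> dir l) * h"
        using h by (simp add: distrib_right)
      ultimately have "- (c * h) * h \<le> ?Y l x * h"
        using l by (simp add: norm_dir power2_eq_square algebra_simps)
      then show ?thesis using h mult_right_le_imp_le by blast
    qed
    have cs: "continuous_on UNIV (\<lambda>x. ?\<phi> (x + h *\<^sub>R dir l))" by (rule continuous_on_shift[OF c\<phi>])
    have cq: "continuous_on UNIV (\<lambda>x. (?\<phi> x - ?\<phi> (x + h *\<^sub>R dir l)) / h)"
      using h by (intro continuous_intros c\<phi> cs) auto
    have "integral (cbox 0 1) (\<lambda>x. (?\<phi> x - ?\<phi> (x + h *\<^sub>R dir l)) / h) = 0"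
      unfolding integral_divide integral_cell_diff[OF c\<phi> cs] integral_cell_shift[OF per(2) c\<phi>] by simp
    moreover have "integral (cbox 0 1) (\<lambda>x. D\<phi> x \<bullet> dir l) = 0"
      by (rule integral_cell_dir_derivative[OF C2 per(2)]) (use l in \<open>simp add: norm_dir\<close>)
    ultimately have "integral (cbox 0 1) (?Y l) = 0"
      using integral_cell_add[OF cq continuous_on_inner[OF cD continuous_on_const[of UNIV "dir l"]]] by simp
    then show ?thesis
      using integral_cell_abs_le[OF cY low] c h by simp
  qed
  have pointwise: "F (slopes h v x) \<le> F (?\<Sigma> x) + K * (\<Sum>l\<in>?S. \<bar>?X l x\<bar> + \<bar>?Y l x\<bar>)" for x
  proof -
    have "norm (slopes h v x - ?\<Sigma> x) \<le> (\<Sum>l\<in>?S. \<bar>(slopes h v x - ?\<Sigma> x) \<bullet> l\<bar>)" by (rule norm_le_l1)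
    also have "\<dots> \<le> (\<Sum>l\<in>?S. \<bar>?X l x\<bar> + \<bar>?Y l x\<bar>)"
    proof (rule sum_mono)
      fix l assume l: "l \<in> ?S"
      have "(slopes h v x - ?\<Sigma> x) \<bullet> l = ?X l x + ?Y l x"
        unfolding inner_diff_left slopes_inner[OF l] inner_diagonal[OF l]
        by (simp add: inner_commute diff_divide_distrib)
      then show "\<bar>(slopes h v x - ?\<Sigma> x) \<bullet> l\<bar> \<le> \<bar>?X l x\<bar> + \<bar>?Y l x\<bar>"
        by (simp only: abs_triangle_ineq)
    qed
    finally have "K * norm (slopes h v x - ?\<Sigma> x) \<le> K * (\<Sum>l\<in>?S. \<bar>?X l x\<bar> + \<bar>?Y l x\<bar>)"
      using K_nonneg by (rule mult_left_mono)
    then show ?thesis using F_lipschitz[OF boxv box, of x x] by linarith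
  qed
  have cXY: "continuous_on UNIV (\<lambda>x. \<bar>?X l x\<bar> + \<bar>?Y l x\<bar>)" for l by (intro continuous_on_add cX caY)
  have cS: "continuous_on UNIV (\<lambda>x. K * (\<Sum>l\<in>?S. \<bar>?X l x\<bar> + \<bar>?Y l x\<bar>))"
    by (intro continuous_on_mult continuous_on_const continuous_on_sum cXY)
  have cF: "continuous_on UNIV (\<lambda>x. F (?\<Sigma> x))"
    by (rule continuous_on_compose2[OF F_continuous c\<Sigma>]) auto
  have "integral (cbox 0 1) (\<lambda>x. F (slopes h v x))
      \<le> integral (cbox 0 1) (\<lambda>x. F (?\<Sigma> x) + K * (\<Sum>l\<in>?S. \<bar>?X l x\<bar> + \<bar>?Y l x\<bar>))"
    using h by (intro integral_cell_le flux_continuous[OF cv] continuous_on_add cF cS pointwise) auto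
  also have "\<dots> = integral (cbox 0 1) (\<lambda>x. F (?\<Sigma> x))
      + K * integral (cbox 0 1) (\<lambda>x. \<Sum>l\<in>?S. \<bar>?X l x\<bar> + \<bar>?Y l x\<bar>)"
    unfolding integral_cell_add[OF cF cS] integral_mult_right ..
  also have "integral (cbox 0 1) (\<lambda>x. \<Sum>l\<in>?S. \<bar>?X l x\<bar> + \<bar>?Y l x\<bar>)
      = (\<Sum>l\<in>?S. integral (cbox 0 1) (\<lambda>x. \<bar>?X l x\<bar> + \<bar>?Y l x\<bar>))"
    by (intro integral_sum finite_Basis continuous_on_cell cXY)
  also have "K * \<dots> \<le> K * (\<Sum>l\<in>?S. 6 * c * h)"
  proof (intro mult_left_mono sum_mono K_nonneg)
    fix l assume l: "l \<in> ?S"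
    show "integral (cbox 0 1) (\<lambda>x. \<bar>?X l x\<bar> + \<bar>?Y l x\<bar>) \<le> 6 * c * h"
      unfolding integral_cell_add[OF cX caY] using intX[of l] intY[OF l] by linarith
  qed
  also have "K * (\<Sum>l\<in>?S. 6 * c * h) = 6 * c * K * dm * h" by (simp add: dm_eq)
  finally show ?thesis by simp
qed

text \<open>Induction over the coarse time steps with the mollified scheme as \<open>\<phi>\<close>: the flux of
  \<open>u\<close> is at least that of \<open>\<phi>\<close> up to a multiple of the mean error already accumulated, the flux of the scheme is
  at most that of \<open>\<phi>\<close> up to \<open>O(h)\<close>, and mollification leaves the mean unchanged.\<close>

lemma mean_error:
  fixes u :: "(real ^ 'd) \<times> real \<Rightarrow> real"
  assumes T: "0 < T" and u: "viscosity_solution H g T u" and FH: "\<And>p. F (- p, p) = H p"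
    and h: "0 < h" and g: "admissible R c g" and c: "0 \<le> c" and n: "real n * (\<rho> * h) \<le> T"
  shows "integral (cbox 0 1) (\<lambda>x. u (x, real n * (\<rho> * h))) - integral (cbox 0 1) (fd_scheme F g h (\<rho> * h) n)
    \<le> real n * (\<rho> * h) * ((6 * c * K * dm + div_const c * (R * real CARD('d) + 4 * c * A * T + 2 * M)) * (h + \<rho> * h))
        * exp (div_const c * (real n * (\<rho> * h)))"
  using n
proof (induction n)
  case 0
  then show ?case using u by (simp add: viscosity_solution_def)
next
  case (Suc n)
  let ?L = "R * real CARD('d)"
  define \<tau> where "\<tau> = \<rho> * h"
  define E where "E n = integral (cbox 0 1) (\<lambda>x. u (x, real n * \<tau>)) - integral (cbox 0 1) (fd_scheme F g h \<tau> n)" for n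
  define d where "d = div_const c"
  define C1 where "C1 = 6 * c * K * dm"
  define C2' where "C2' = ?L + 4 * c * A * T + 2 * M"
  define B where "B = (C1 + d * C2') * (h + \<tau>)"
  have \<tau>: "0 < \<tau>" using h lam by (simp add: \<tau>_def)
  have d0: "0 \<le> d" using div_const_nonneg[OF c] by (simp add: d_def)
  have C1: "0 \<le> C1" using c K_nonneg by (simp add: C1_def dm_eq)
  have L: "0 \<le> ?L" using R by simp
  have C2'0: "0 \<le> C2'" using L c A_nonneg T M_nonneg by (simp add: C2'_def)
  have B0: "0 \<le> B" using C1 d0 C2'0 h \<tau> by (simp add: B_def)
  have n': "real n * (\<rho> * h) \<le> T" using Suc.prems \<tau> by (simp add: \<tau>_def algebra_simps)
  have IH: "E n \<le> real n * \<tau> * B * exp (d * (real n * \<tau>))"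
    using Suc.IH[OF n'] by (simp only: E_def B_def C1_def C2'_def d_def \<tau>_def)
  let ?v = "fd_scheme F g h (\<rho> * h) n"
  have v: "admissible R c ?v" by (rule scheme_admissible[OF h g])
  then have lip: "coord_lipschitz R ?v" and per: "torus_periodic ?v" by (simp_all add: admissible_def)
  have cv: "continuous_on UNIV ?v" by (rule scheme_continuous[OF h g])
  let ?\<phi> = "mollify h ?v"
  obtain D\<phi> D2\<phi> where C2: "C2_data ?\<phi> D\<phi> D2\<phi>"
    using mollify_derivatives[OF cv h] unfolding C2_data_def by metis
  \<comment> \<open>Mollification costs \<open>?L * h\<close>, passing to a refined scheme costs \<open>4 * c * A * T * h\<close>.\<close>
  let ?\<kappa> = "(?L + 4 * c * A * T) * h"
  have start: "?\<phi> x - ?\<kappa> \<le> fd_scheme F g (h / 2 ^ i) (\<rho> * (h / 2 ^ i)) (n * 2 ^ i) x" for i x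
  proof -
    have "?\<phi> x \<le> ?v x + ?L * h" using mollify_close[OF lip, of h x] h by (simp add: abs_le_iff)
    moreover have "\<rho> * h * real n \<le> T" using n' by (simp only: mult.commute[of "\<rho> * h"])
    then have "4 * c * A * h * (\<rho> * h * real n) \<le> 4 * c * A * h * T"
      using c A_nonneg h by (intro mult_left_mono) auto
    moreover have "?\<kappa> = ?L * h + 4 * c * A * h * T" by (simp add: algebra_simps)
    ultimately show ?thesis using scheme_le_refined[OF h g c, of n x i] by linarith
  qed
  let ?I = "integral (cbox 0 1) (\<lambda>x. F (- D\<phi> x, D\<phi> x))"
  have "integral (cbox 0 1) (\<lambda>x. u (x, real (Suc n) * \<tau>))
      \<le> integral (cbox 0 1) (\<lambda>x. u (x, real n * \<tau>)) - \<tau> * (?I - d * (E n + ?\<kappa> + 2 * (\<tau> * M)))"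
    using solution_mean_decrease[OF T u FH h g c Suc.prems C2 mollify_admissible[OF v] start]
    by (simp only: integral_mollify[OF per cv] E_def d_def \<tau>_def)
  moreover have "integral (cbox 0 1) (fd_scheme F g h \<tau> (Suc n))
      \<ge> integral (cbox 0 1) (fd_scheme F g h \<tau> n) - \<tau> * (?I + C1 * h)"
    using integral_scheme_Suc[OF h g, of n] mult_left_mono[OF flux_consistency[OF v h c C2] less_imp_le[OF \<tau>]]
    unfolding C1_def \<tau>_def by linarith
  ultimately have "E (Suc n) \<le> E n + \<tau> * (d * (E n + ?\<kappa> + 2 * (\<tau> * M)) + C1 * h)"
    by (simp add: E_def algebra_simps)
  moreover have "d * (?\<kappa> + 2 * (\<tau> * M)) + C1 * h \<le> B"
  proof -
    have "?\<kappa> + 2 * (\<tau> * M) \<le> C2' * (h + \<tau>)"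
    proof -
      have "0 \<le> (?L + 4 * c * A * T) * \<tau>" "0 \<le> 2 * M * h"
        using L c A_nonneg T M_nonneg \<tau> h by simp_all
      moreover have "C2' * (h + \<tau>) = ?\<kappa> + 2 * (\<tau> * M) + (?L + 4 * c * A * T) * \<tau> + 2 * M * h"
        by (simp add: C2'_def algebra_simps)
      ultimately show ?thesis by linarith
    qed
    then have "d * (?\<kappa> + 2 * (\<tau> * M)) \<le> d * (C2' * (h + \<tau>))" using d0 by (rule mult_left_mono)
    moreover have "C1 * h \<le> C1 * (h + \<tau>)" using C1 \<tau> by (intro mult_left_mono) auto
    moreover have "B = C1 * (h + \<tau>) + d * (C2' * (h + \<tau>))" by (simp add: B_def algebra_simps)
    ultimately show ?thesis by linarith
  qed
  then have "\<tau> * (d * (?\<kappa> + 2 * (\<tau> * M)) + C1 * h) \<le> \<tau> * B" using \<tau> by (intro mult_left_mono) auto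
  moreover have "\<tau> * (d * (E n + ?\<kappa> + 2 * (\<tau> * M)) + C1 * h)
      = \<tau> * d * E n + \<tau> * (d * (?\<kappa> + 2 * (\<tau> * M)) + C1 * h)"
    by (simp add: algebra_simps)
  moreover have "(1 + d * \<tau>) * E n = E n + \<tau> * d * E n" by (simp add: algebra_simps)
  ultimately have "E (Suc n) \<le> (1 + d * \<tau>) * E n + \<tau> * B" by linarith
  also have "\<dots> \<le> (1 + d * \<tau>) * (real n * \<tau> * B * exp (d * (real n * \<tau>))) + \<tau> * B"
    using IH d0 \<tau> by (intro add_right_mono mult_left_mono) auto
  also have "\<dots> \<le> exp (d * \<tau>) * (real n * \<tau> * B * exp (d * (real n * \<tau>))) + \<tau> * B * exp (d * (real (Suc n) * \<tau>))"
  proof (intro add_mono mult_right_mono)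
    show "1 + d * \<tau> \<le> exp (d * \<tau>)" by (rule exp_ge_add_one_self)
    show "0 \<le> real n * \<tau> * B * exp (d * (real n * \<tau>))" using \<tau> B0 by simp
    have "1 \<le> exp (d * (real (Suc n) * \<tau>))" using d0 \<tau> by simp
    then show "\<tau> * B \<le> \<tau> * B * exp (d * (real (Suc n) * \<tau>))"
      using \<tau> B0 mult_left_mono[of 1 _ "\<tau> * B"] by simp
  qed
  also have "exp (d * \<tau>) * (real n * \<tau> * B * exp (d * (real n * \<tau>)))
      = real n * \<tau> * B * exp (d * (real (Suc n) * \<tau>))"
  proof -
    have "d * (real (Suc n) * \<tau>) = d * \<tau> + d * (real n * \<tau>)" by (simp add: algebra_simps)
    then show ?thesis by (simp only: exp_add mult.commute mult.left_commute mult.assoc)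
  qed
  also have "real n * \<tau> * B * exp (d * (real (Suc n) * \<tau>)) + \<tau> * B * exp (d * (real (Suc n) * \<tau>))
      = real (Suc n) * \<tau> * B * exp (d * (real (Suc n) * \<tau>))"
    by (simp only: of_nat_Suc distrib_right mult_1_left add.commute)
  finally show ?case by (simp only: E_def B_def C1_def C2'_def d_def \<tau>_def)
qed

text \<open>The mean of the error is small and the error is bounded below by a multiple of \<open>- h\<close>.\<close>

lemma scheme_error_L1:
  fixes u :: "(real ^ 'd) \<times> real \<Rightarrow> real"
  assumes T: "0 < T" and u: "viscosity_solution H g T u" and FH: "\<And>p. F (- p, p) = H p"
    and h: "0 < h" and g: "admissible R c g" and c: "0 \<le> c" and n: "real n * (\<rho> * h) \<le> T"
  shows "integral (cbox 0 1) (\<lambda>x. \<bar>u (x, real n * (\<rho> * h)) - fd_scheme F g h (\<rho> * h) n x\<bar>)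
    \<le> (T * (6 * c * K * dm + div_const c * (R * real CARD('d) + 4 * c * A * T + 2 * M)) * exp (div_const c * T)
        + 8 * c * A * T) * (h + \<rho> * h)"
proof -
  let ?t = "real n * (\<rho> * h)"
  let ?B = "6 * c * K * dm + div_const c * (R * real CARD('d) + 4 * c * A * T + 2 * M)"
  let ?d = "div_const c"
  have \<tau>: "0 < \<rho> * h" using h lam by simp
  have t: "?t \<in> {0..T}" using n \<tau> by simp
  have cu: "continuous_on UNIV (\<lambda>x. u (x, ?t))" by (rule viscosity_solution_slice_continuous[OF u t])
  have cv: "continuous_on UNIV (fd_scheme F g h (\<rho> * h) n)" by (rule scheme_continuous[OF h g])
  have d0: "0 \<le> ?d" by (rule div_const_nonneg[OF c])
  have B0: "0 \<le> ?B" using d0 c K_nonneg R A_nonneg T M_nonneg by (simp add: dm_eq)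
  have low: "- (4 * c * A * T * h) \<le> u (x, ?t) - fd_scheme F g h (\<rho> * h) n x" for x
    using solution_ge_scheme[OF T u FH h g c n, of x] by linarith
  have "integral (cbox 0 1) (\<lambda>x. \<bar>u (x, ?t) - fd_scheme F g h (\<rho> * h) n x\<bar>)
      \<le> integral (cbox 0 1) (\<lambda>x. u (x, ?t) - fd_scheme F g h (\<rho> * h) n x) + 2 * (4 * c * A * T * h)"
    using c A_nonneg T h by (intro integral_cell_abs_le continuous_on_diff cu cv low) auto
  also have "\<dots> \<le> ?t * (?B * (h + \<rho> * h)) * exp (?d * ?t) + 8 * c * A * T * h"
    unfolding integral_cell_diff[OF cu cv] using mean_error[OF T u FH h g c n] by simp
  also have "?t * (?B * (h + \<rho> * h)) * exp (?d * ?t) \<le> T * (?B * (h + \<rho> * h)) * exp (?d * T)"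
    using t n B0 d0 h \<tau> T by (intro mult_mono) (auto intro!: mult_left_mono mult_nonneg_nonneg)
  also have "8 * c * A * T * h \<le> 8 * c * A * T * (h + \<rho> * h)"
    using c A_nonneg T \<tau> by (intro mult_left_mono) auto
  finally show ?thesis by (simp add: algebra_simps)
qed

end

section \<open>Large slopes, interpolation and the error estimate\<close>

lemma datum_slopes_bounded_steps:
  assumes ds: "datum_slopes_bounded R h g" and h: "0 < h"
  shows "\<bar>g (x + (real m * h) *\<^sub>R axis i 1) - g x\<bar> \<le> R * (real m * h)"
proof (induction m)
  case (Suc m)
  let ?y = "x + (real m * h) *\<^sub>R axis i 1"
  have "\<bar>(g (?y + h *\<^sub>R axis i 1) - g ?y) / h\<bar> \<le> R"
    using ds unfolding datum_slopes_bounded_def fd_forward_def by simp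
  then have "\<bar>g (?y + h *\<^sub>R axis i 1) - g ?y\<bar> \<le> R * h"
    using h by (simp add: pos_divide_le_eq)
  moreover have y: "x + (real (Suc m) * h) *\<^sub>R axis i 1 = ?y + h *\<^sub>R axis i 1"
    by (simp add: algebra_simps)
  moreover have R: "R * (real (Suc m) * h) = R * (real m * h) + R * h" by (simp add: algebra_simps)
  ultimately show ?case using Suc unfolding y R by linarith
qed simp

text \<open>A long increment is a sum of increments of length \<open>h\<close> up to a remainder, so a difference
  quotient of \<open>g\<close> larger than \<open>R\<close> shows up at all small steps.\<close>

lemma datum_slopes_bounded_imp_large_step:
  fixes g :: "real ^ 'd \<Rightarrow> real"
  assumes lip: "L-lipschitz_on UNIV g" and R: "0 < R" and n: "\<not> coord_lipschitz R g"
  obtains h0 where "0 < h0" "\<And>h. 0 < h \<Longrightarrow> datum_slopes_bounded R h g \<Longrightarrow> h0 \<le> h"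
proof -
  have L: "0 \<le> L" using lip by (rule lipschitz_on_nonneg)
  obtain x i s where xs: "R * \<bar>s\<bar> < \<bar>g (x + s *\<^sub>R axis i 1) - g x\<bar>"
    using n unfolding coord_lipschitz_def by (auto simp: not_le)
  obtain y r where yr: "0 \<le> r" "R * r < \<bar>g (y + r *\<^sub>R axis i 1) - g y\<bar>"
  proof (cases "0 \<le> s")
    case True
    then show thesis using xs that[of s x] by simp
  next
    case False
    have "x + s *\<^sub>R axis i 1 + (- s) *\<^sub>R axis i 1 = x" by simp
    then show thesis using xs False that[of "- s" "x + s *\<^sub>R axis i 1"] by (simp add: abs_minus_commute)
  qed
  define \<delta> where "\<delta> = \<bar>g (y + r *\<^sub>R axis i 1) - g y\<bar> - R * r"
  have \<delta>: "0 < \<delta>" using yr by (simp add: \<delta>_def)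
  have "\<delta> / (L + 1) \<le> h" if h: "0 < h" and ds: "datum_slopes_bounded R h g" for h
  proof -
    \<comment> \<open>The increment of length \<open>r\<close> consists of \<open>m\<close> steps and a remainder shorter than \<open>h\<close>.\<close>
    define m where "m = nat \<lfloor>r / h\<rfloor>"
    have rh: "0 \<le> r / h" using yr h by simp
    then have m: "real m \<le> r / h" "r / h < real m + 1"
      unfolding m_def by linarith+
    then have mh: "real m * h \<le> r" "r < real m * h + h"
      using h by (simp_all add: field_simps)
    let ?z = "y + (real m * h) *\<^sub>R axis i 1"
    have "\<bar>g (y + r *\<^sub>R axis i 1) - g ?z\<bar> \<le> L * norm ((y + r *\<^sub>R axis i 1) - ?z)"
      using lipschitz_onD[OF lip, of "y + r *\<^sub>R axis i 1" ?z] by (simp add: dist_norm)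
    also have "(y + r *\<^sub>R axis i 1) - ?z = (r - real m * h) *\<^sub>R axis i 1" by (simp add: algebra_simps)
    also have "norm ((r - real m * h) *\<^sub>R axis i (1::real)) = r - real m * h" using mh by simp
    also have "L * (r - real m * h) \<le> L * h" using mh L by (intro mult_left_mono) auto
    finally have 1: "\<bar>g (y + r *\<^sub>R axis i 1) - g ?z\<bar> \<le> L * h" .
    have 2: "\<bar>g ?z - g y\<bar> \<le> R * (real m * h)" by (rule datum_slopes_bounded_steps[OF ds h])
    have 3: "R * (real m * h) \<le> R * r" using mh R by (intro mult_left_mono) auto
    have "\<delta> \<le> L * h" using 1 2 3 unfolding \<delta>_def by linarith
    also have "\<dots> \<le> h * (L + 1)" using h by (simp add: algebra_simps)
    finally show ?thesis using L by (simp add: pos_divide_le_eq add_nonneg_pos)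
  qed
  moreover have "0 < \<delta> / (L + 1)" using \<delta> L by (simp add: add_nonneg_pos)
  ultimately show thesis using that by blast
qed

lemma datum_slopes_bounded_in_box:
  fixes g :: "real ^ 'd \<Rightarrow> real"
  assumes "datum_slopes_bounded R h g" "0 < h"
  shows "slopes h g x \<in> slope_box R"
  unfolding mem_slope_box
proof
  fix l :: "(real ^ 'd) \<times> (real ^ 'd)" assume l: "l \<in> Basis"
  have f: "\<bar>g (y + h *\<^sub>R axis i 1) - g y\<bar> \<le> R * h" for y i
    using datum_slopes_bounded_steps[OF assms, of y 1 i] by simp
  have "\<bar>g x - g (x + h *\<^sub>R dir l)\<bar> \<le> R * h"
    using l
  proof (cases rule: Basis_pair_cases)
    case (left i)
    then show ?thesis using f[of x i] by (simp add: dir_def abs_minus_commute)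
  next
    case (right i)
    then show ?thesis using f[of "x - h *\<^sub>R axis i 1" i] by (simp add: dir_def)
  qed
  then show "\<bar>slopes h g x \<bullet> l\<bar> \<le> R"
    using assms(2) l by (simp add: slopes_inner pos_divide_le_eq)
qed

lemma (in monotone_scheme) scheme_slopes_in_box:
  assumes h: "0 < h" and g: "\<And>x. slopes h g x \<in> slope_box R"
  shows "slopes h (fd_scheme F g h (\<rho> * h) n) x \<in> slope_box R"
proof (induction n arbitrary: x)
  case (Suc n)
  let ?v = "fd_scheme F g h (\<rho> * h) n"
  show ?case
    unfolding mem_slope_box
  proof
    fix l :: "(real ^ 'd) \<times> (real ^ 'd)" assume l: "l \<in> Basis"
    have "\<bar>?v (y + h *\<^sub>R dir l) - ?v y\<bar> \<le> R * h" for y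
      using Suc[of y] l h unfolding mem_slope_box
      by (simp add: slopes_inner pos_divide_le_eq abs_minus_commute)
    from step_abs_shift_bound[OF box_monotone[OF h] h Suc this, of x]
    show "\<bar>slopes h (fd_scheme F g h (\<rho> * h) (Suc n)) x \<bullet> l\<bar> \<le> R"
      unfolding fd_scheme_Suc using l h by (simp add: slopes_inner pos_divide_le_eq abs_minus_commute)
  qed
qed (use g in simp)

lemma viscosity_solution_bounded:
  fixes u :: "(real ^ 'd) \<times> real \<Rightarrow> real"
  assumes "viscosity_solution H g T u"
  obtains B where "0 \<le> B" "\<And>x t. t \<in> {0..T} \<Longrightarrow> \<bar>u (x, t)\<bar> \<le> B"
proof -
  have per: "\<And>t. t \<in> {0..T} \<Longrightarrow> torus_periodic (\<lambda>x. u (x, t))" and cont: "continuous_on (UNIV \<times> {0..T}) u"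
    using assms by (simp_all add: viscosity_solution_def)
  have "bounded (u ` (cbox 0 1 \<times> {0..T}))"
    by (intro compact_imp_bounded compact_continuous_image continuous_on_subset[OF cont] compact_Times) auto
  then obtain B where B: "\<And>z. z \<in> cbox 0 1 \<times> {0..T} \<Longrightarrow> \<bar>u z\<bar> \<le> B"
    unfolding bounded_iff by fastforce
  have "\<bar>u (x, t)\<bar> \<le> \<bar>B\<bar>" if t: "t \<in> {0..T}" for x t
  proof -
    obtain z where z: "\<And>i. z $ i \<in> \<int>" "x + z \<in> cbox 0 1" using lattice_translate_to_cell by blast
    have "u (x + z, t) = u (x, t)" by (rule torus_periodic_lattice[OF per[OF t] z(1)])
    then show ?thesis using B[of "(x + z, t)"] z(2) t by simp
  qed
  then show thesis using that[of "\<bar>B\<bar>"] by simp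
qed

text \<open>Interpolation between \<open>L\<^sup>\<infinity>\<close> and \<open>L\<^sup>1\<close>: \<open>\<integral> \<bar>f\<bar>\<^sup>q\<close> is at most \<open>sup \<bar>f\<bar>\<^sup>q\<^sup>-\<^sup>1 \<integral> \<bar>f\<bar>\<close>, of order
  \<open>(q - 1) / 2 + 1 = q (1/2 + 1/(2 q))\<close>.\<close>

lemma torus_Lp_norm_le:
  fixes f :: "real ^ 'd \<Rightarrow> real" and p :: ereal
  assumes f: "continuous_on UNIV f" and p: "1 \<le> p" and C: "0 < C" and e: "0 < e"
    and sup: "\<And>x. \<bar>f x\<bar> \<le> C * sqrt e" and mean: "integral (cbox 0 1) (\<lambda>x. \<bar>f x\<bar>) \<le> C * e"
  shows "torus_Lp_norm p f \<le> ennreal (C * e powr (1 / 2 + real_of_ereal (1 / (2 * p))))"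
proof (cases p)
  case PInf
  have "f \<in> borel_measurable borel" using f by (rule borel_measurable_continuous_onI)
  then have "f \<in> borel_measurable (lebesgue_on (cbox 0 1))"
    by (intro measurable_restrict_space1 measurable_completion) simp
  then have "(\<lambda>x. ennreal \<bar>f x\<bar>) \<in> borel_measurable (lebesgue_on (cbox 0 1))" by simp
  then have "esssup (lebesgue_on (cbox 0 1)) (\<lambda>x. ennreal \<bar>f x\<bar>) \<le> ennreal (C * sqrt e)"
    by (rule esssup_I) (use sup in \<open>auto intro: ennreal_leI\<close>)
  then show ?thesis using PInf e by (simp add: torus_Lp_norm_def powr_half_sqrt)
next
  case (real q)
  have q: "1 \<le> q" using p real by simp
  let ?B = "C * sqrt e"
  have B: "0 < ?B" using C e by simp
  have ca: "continuous_on UNIV (\<lambda>x. ?B powr (q - 1) * \<bar>f x\<bar>)" by (intro continuous_intros f)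
  have int: "integrable (lebesgue_on (cbox 0 1)) (\<lambda>x. ?B powr (q - 1) * \<bar>f x\<bar>)"
    by (rule continuous_imp_integrable) (rule continuous_on_subset[OF ca], simp)
  have pw: "\<bar>f x\<bar> powr q \<le> ?B powr (q - 1) * \<bar>f x\<bar>" for x
  proof (cases "f x = 0")
    case False
    have "\<bar>f x\<bar> powr q = \<bar>f x\<bar> powr (q - 1) * \<bar>f x\<bar>"
      using False by (simp add: powr_diff)
    also have "\<dots> \<le> ?B powr (q - 1) * \<bar>f x\<bar>"
      using q sup[of x] by (intro mult_right_mono powr_mono2) auto
    finally show ?thesis .
  qed simp
  let ?I = "\<integral>\<^sup>+ x. ennreal (\<bar>f x\<bar> powr q) \<partial>lebesgue_on (cbox 0 1)"
  have "?I \<le> (\<integral>\<^sup>+ x. ennreal (?B powr (q - 1) * \<bar>f x\<bar>) \<partial>lebesgue_on (cbox 0 1))"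
    by (intro nn_integral_mono ennreal_leI pw)
  also have "\<dots> = ennreal (integral\<^sup>L (lebesgue_on (cbox 0 1)) (\<lambda>x. ?B powr (q - 1) * \<bar>f x\<bar>))"
    by (rule nn_integral_eq_integral[OF int]) simp
  also have "integral\<^sup>L (lebesgue_on (cbox 0 1)) (\<lambda>x. ?B powr (q - 1) * \<bar>f x\<bar>)
      = integral (cbox 0 1) (\<lambda>x. ?B powr (q - 1) * \<bar>f x\<bar>)"
    by (rule lebesgue_integral_eq_integral[OF int]) simp
  also have "\<dots> = ?B powr (q - 1) * integral (cbox 0 1) (\<lambda>x. \<bar>f x\<bar>)" by simp
  also have "ennreal \<dots> \<le> ennreal (?B powr (q - 1) * (C * e))"
    using mean by (intro ennreal_leI mult_left_mono) auto
  finally have I: "?I \<le> ennreal (?B powr (q - 1) * (C * e))" .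
  then have fin: "?I \<noteq> \<infinity>" by (auto simp: top_unique)
  have "enn2real ?I \<le> ?B powr (q - 1) * (C * e)"
    using I B C e by (intro enn2real_leI) auto
  then have "enn2real ?I powr (1 / q) \<le> (?B powr (q - 1) * (C * e)) powr (1 / q)"
    using q by (intro powr_mono2) auto
  also have "?B powr (q - 1) * (C * e) = C powr q * e powr ((q + 1) / 2)"
  proof -
    have "?B powr (q - 1) = C powr (q - 1) * e powr ((q - 1) / 2)"
      using C e by (simp add: powr_mult powr_half_sqrt[symmetric] powr_powr)
    moreover have "C powr (q - 1) * C = C powr q"
      using C by (simp add: powr_diff)
    moreover have "e powr ((q - 1) / 2) * e = e powr ((q + 1) / 2)"
    proof -
      have "e powr ((q + 1) / 2) = e powr ((q - 1) / 2 + 1)" by (simp add: field_simps)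
      then show ?thesis using e by (simp add: powr_add)
    qed
    moreover have "?B powr (q - 1) * (C * e) = C powr (q - 1) * e powr ((q - 1) / 2) * (C * e)"
      using calculation(1) by simp
    moreover have "\<dots> = (C powr (q - 1) * C) * (e powr ((q - 1) / 2) * e)" by simp
    ultimately show ?thesis by simp
  qed
  also have "\<dots> powr (1 / q) = C * e powr ((q + 1) / 2 * (1 / q))"
    using C e q by (simp add: powr_mult powr_powr)
  also have "(q + 1) / 2 * (1 / q) = 1 / 2 + 1 / (2 * q)"
    using q by (simp add: field_simps)
  finally have "enn2real ?I powr (1 / q) \<le> C * e powr (1 / 2 + 1 / (2 * q))" .
  moreover have "real_of_ereal (1 / (2 * p)) = 1 / (2 * q)"
    using real q by (simp add: one_ereal_def numeral_eq_ereal)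
  ultimately show ?thesis
    using fin real by (simp add: torus_Lp_norm_def Let_def ennreal_leI)
next
  case MInf
  then show ?thesis using p by simp
qed

lemma slope_box_bound:
  fixes f :: "(real ^ 'd) \<times> (real ^ 'd) \<Rightarrow> 'b::real_normed_vector"
  assumes "continuous_on UNIV f"
  obtains B where "\<And>q. q \<in> slope_box R \<Longrightarrow> norm (f q) \<le> B"
proof -
  have "bounded (f ` slope_box R)"
    by (intro compact_imp_bounded compact_continuous_image continuous_on_subset[OF assms] compact_slope_box) auto
  then show thesis using that unfolding bounded_iff by blast
qed

text \<open>The bounds on \<open>F\<close> and its derivatives over the slope box, and hence all constants, depend on \<open>R\<close> but not on the
  ratio of the steps.\<close>

lemma scheme_error_bounds:
  fixes u :: "(real ^ 'd) \<times> real \<Rightarrow> real"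
  assumes T: "0 < T" and g: "torus_periodic g" "L-lipschitz_on UNIV g" "semiconcave_with c g" "0 < c"
    and F: "C2_fun F" "convex_on UNIV F" "\<And>p. F (- p, p) = H p" and R: "0 < R"
    and u: "viscosity_solution H g T u"
  obtains C where "0 < C"
    "\<And>h \<tau> n. 0 < h \<Longrightarrow> 0 < \<tau> \<Longrightarrow> real n * \<tau> \<le> T \<Longrightarrow> monotonicity_condition F R h \<tau> \<Longrightarrow>
       datum_slopes_bounded R h g \<Longrightarrow>
       continuous_on UNIV (\<lambda>x. fd_scheme F g h \<tau> n x - u (x, real n * \<tau>)) \<and>
       (\<forall>x. \<bar>fd_scheme F g h \<tau> n x - u (x, real n * \<tau>)\<bar> \<le> C * sqrt (h + \<tau>)) \<and>
       integral (cbox 0 1) (\<lambda>x. \<bar>fd_scheme F g h \<tau> n x - u (x, real n * \<tau>)\<bar>) \<le> C * (h + \<tau>)"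
proof -
  obtain DF D2F where D: "\<And>z. GDERIV F z :> DF z" "\<And>z. (DF has_derivative blinfun_apply (D2F z)) (at z)"
    "continuous_on UNIV D2F"
    using F(1) unfolding C2_fun_def by blast
  have cF: "continuous_on UNIV F"
    by (rule has_derivative_continuous_on) (use D(1) in \<open>auto simp: gderiv_def\<close>)
  have cDF: "continuous_on UNIV DF" by (rule has_derivative_continuous_on) (use D(2) in auto)
  obtain M where M: "\<And>q. q \<in> slope_box R \<Longrightarrow> norm (F q) \<le> M" using slope_box_bound[OF cF] by blast
  obtain K where K: "\<And>q. q \<in> slope_box R \<Longrightarrow> norm (DF q) \<le> K" using slope_box_bound[OF cDF] by blast
  obtain J where J: "\<And>q. q \<in> slope_box R \<Longrightarrow> norm (D2F q) \<le> J" using slope_box_bound[OF D(3)] by blast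
  define dm where "dm = real (DIM((real ^ 'd) \<times> (real ^ 'd)))"
  have A: "(\<Sum>l\<in>Basis. DF q \<bullet> l) \<le> dm * K" if "q \<in> slope_box R" for q
  proof -
    have "DF q \<bullet> l \<le> K" if "l \<in> Basis" for l
      using norm_bound_Basis_le[OF that K[OF \<open>q \<in> slope_box R\<close>]] by simp
    then have "(\<Sum>l\<in>Basis. DF q \<bullet> l) \<le> (\<Sum>l\<in>(Basis :: ((real ^ 'd) \<times> (real ^ 'd)) set). K)"
      by (intro sum_mono) auto
    then show ?thesis by (simp add: dm_def)
  qed
  have scheme: "smooth_monotone_scheme F DF R (\<tau> / h) M K (dm * K) D2F J dm"
    if "0 < h" "0 < \<tau>" "monotonicity_condition F R h \<tau>" for h \<tau>
  proof -
    interpret monotone_scheme F DF R "\<tau> / h"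
      by (rule monotone_schemeI[OF D(1) cDF F(2) R that])
    show ?thesis
      by unfold_locales (use M K J A D dm_def in auto)
  qed
  have cg: "continuous_on UNIV g" using lipschitz_on_continuous_on[OF g(2)] .
  have slice: "continuous_on UNIV (\<lambda>x. u (x, real n * \<tau>))" if "0 < \<tau>" "real n * \<tau> \<le> T" for n and \<tau>
    by (rule viscosity_solution_slice_continuous[OF u]) (use that in simp)
  show thesis
  proof (cases "coord_lipschitz R g")
    case True
    have adm: "admissible R c g"
      using True g semiconcave_with_imp_midpoint by (simp add: admissible_def)
    define C1 where "C1 = ((R * real CARD('d))\<^sup>2 + M\<^sup>2) / 2 + (1 + K * real (DIM((real ^ 'd) \<times> (real ^ 'd)))) * T / 2"
    define dv where "dv = 2 * c * J * dm\<^sup>2"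
    define C2 where "C2 = T * (6 * c * K * dm + dv * (R * real CARD('d) + 4 * c * (dm * K) * T + 2 * M)) * exp (dv * T)
        + 8 * c * (dm * K) * T"
    let ?C = "\<bar>C1\<bar> + \<bar>C2\<bar> + 1"
    show thesis
    proof (rule that[of ?C])
      show "0 < ?C" by simp
      fix h \<tau> :: real and n :: nat
      assume h: "0 < h" and \<tau>: "0 < \<tau>" and n: "real n * \<tau> \<le> T"
        and mc: "monotonicity_condition F R h \<tau>" and "datum_slopes_bounded R h g"
      interpret smooth_monotone_scheme F DF R "\<tau> / h" M K "dm * K" D2F J dm
        by (rule scheme[OF h \<tau> mc])
      have eq: "\<tau> / h * h = \<tau>" using h by simp
      have n': "real n * (\<tau> / h * h) \<le> T" unfolding eq by (rule n)
      have sup: "\<bar>u (x, real n * \<tau>) - fd_scheme F g h \<tau> n x\<bar> \<le> C1 * sqrt (h + \<tau>)" for x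
        using scheme_error_sqrt[OF T u F(3) h adm n', of x] unfolding eq C1_def .
      have mean: "integral (cbox 0 1) (\<lambda>x. \<bar>u (x, real n * \<tau>) - fd_scheme F g h \<tau> n x\<bar>) \<le> C2 * (h + \<tau>)"
        using scheme_error_L1[OF T u F(3) h adm less_imp_le[OF g(4)] n']
        unfolding eq C2_def dv_def div_const_def .
      have "C1 * sqrt (h + \<tau>) \<le> ?C * sqrt (h + \<tau>)"
        using h \<tau> by (intro mult_right_mono) auto
      then have "\<bar>fd_scheme F g h \<tau> n x - u (x, real n * \<tau>)\<bar> \<le> ?C * sqrt (h + \<tau>)" for x
        using sup[of x] abs_minus_commute[of "fd_scheme F g h \<tau> n x"] by (simp only:)
      moreover have "C2 * (h + \<tau>) \<le> ?C * (h + \<tau>)"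
        using h \<tau> by (intro mult_right_mono) auto
      then have "integral (cbox 0 1) (\<lambda>x. \<bar>fd_scheme F g h \<tau> n x - u (x, real n * \<tau>)\<bar>) \<le> ?C * (h + \<tau>)"
        using mean unfolding abs_minus_commute[of "u _"] by linarith
      moreover have "continuous_on UNIV (\<lambda>x. fd_scheme F g h \<tau> n x - u (x, real n * \<tau>))"
        using continuous_on_diff[OF scheme_continuous[OF h adm, of n] slice[OF \<tau> n]] unfolding eq .
      ultimately show "continuous_on UNIV (\<lambda>x. fd_scheme F g h \<tau> n x - u (x, real n * \<tau>)) \<and>
         (\<forall>x. \<bar>fd_scheme F g h \<tau> n x - u (x, real n * \<tau>)\<bar> \<le> ?C * sqrt (h + \<tau>)) \<and>
         integral (cbox 0 1) (\<lambda>x. \<bar>fd_scheme F g h \<tau> n x - u (x, real n * \<tau>)\<bar>) \<le> ?C * (h + \<tau>)"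
        by blast
    qed
  next
    case False
    obtain h0 where h0: "0 < h0" "\<And>h. 0 < h \<Longrightarrow> datum_slopes_bounded R h g \<Longrightarrow> h0 \<le> h"
      using datum_slopes_bounded_imp_large_step[OF g(2) R False] by blast
    obtain Bg where Bg: "0 \<le> Bg" "\<And>x. norm (g x) \<le> Bg" using torus_periodic_bounded[OF g(1) cg] by blast
    obtain Bu where Bu: "0 \<le> Bu" "\<And>x t. t \<in> {0..T} \<Longrightarrow> \<bar>u (x, t)\<bar> \<le> Bu"
      using viscosity_solution_bounded[OF u] by blast
    define B where "B = Bg + T * M + Bu"
    have M0: "0 \<le> M" using M[OF zero_in_slope_box[OF less_imp_le[OF R]]] norm_ge_zero[of "F 0"] by linarith
    have B: "0 \<le> B" using Bg Bu T M0 by (simp add: B_def)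
    let ?C = "B / sqrt h0 + B / h0 + 1"
    show thesis
    proof (rule that[of ?C])
      show "0 < ?C" using B h0 by (simp add: add_nonneg_pos)
      fix h \<tau> :: real and n :: nat
      assume h: "0 < h" and \<tau>: "0 < \<tau>" and n: "real n * \<tau> \<le> T"
        and mc: "monotonicity_condition F R h \<tau>" and ds: "datum_slopes_bounded R h g"
      interpret smooth_monotone_scheme F DF R "\<tau> / h" M K "dm * K" D2F J dm
        by (rule scheme[OF h \<tau> mc])
      have eq: "\<tau> / h * h = \<tau>" using h by simp
      let ?v = "fd_scheme F g h \<tau>"
      let ?f = "\<lambda>x. ?v n x - u (x, real n * \<tau>)"
      have sl: "slopes h (fd_scheme F g h (\<tau> / h * h) m) x \<in> slope_box R" for m x
        by (rule scheme_slopes_in_box[OF h datum_slopes_bounded_in_box[OF ds h]])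
      have cv: "continuous_on UNIV (?v m)" for m
      proof (induction m)
        case (Suc m)
        show ?case
          unfolding fd_scheme_Suc fd_step_def[abs_def]
          using h by (intro continuous_on_diff continuous_on_mult continuous_on_const flux_continuous Suc) auto
      qed (simp add: cg)
      have cf: "continuous_on UNIV ?f" by (rule continuous_on_diff[OF cv slice[OF \<tau> n]])
      have f: "\<bar>?f x\<bar> \<le> B" for x
      proof -
        have "\<bar>?v n x - g x\<bar> \<le> \<tau> * real n * M"
          using scheme_time_lipschitz[OF h sl, of 0 n x] unfolding eq by simp
        also have "\<dots> \<le> T * M" using n M0 by (intro mult_right_mono) (auto simp: mult.commute)
        finally show ?thesis
          using Bg(2)[of x] Bu(2)[of "real n * \<tau>" x] \<tau> n unfolding B_def by simp
      qed
      have hh: "h0 \<le> h + \<tau>" using h0(2)[OF h ds] \<tau> by simp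
      have s1: "B \<le> ?C * sqrt (h + \<tau>)"
      proof -
        have "B = B / sqrt h0 * sqrt h0" using h0 by simp
        also have "\<dots> \<le> ?C * sqrt (h + \<tau>)"
          using hh h0 B by (intro mult_mono real_sqrt_le_mono) auto
        finally show ?thesis .
      qed
      have s2: "B \<le> ?C * (h + \<tau>)"
      proof -
        have "B = B / h0 * h0" using h0 by simp
        also have "\<dots> \<le> ?C * (h + \<tau>)" using hh h0 B by (intro mult_mono) auto
        finally show ?thesis .
      qed
      have "integral (cbox 0 1) (\<lambda>x. \<bar>?f x\<bar>) \<le> integral (cbox 0 (1 :: real ^ 'd)) (\<lambda>_. B)"
        by (intro integral_cell_le continuous_on_rabs cf continuous_on_const f)
      then have "integral (cbox 0 1) (\<lambda>x. \<bar>?f x\<bar>) \<le> ?C * (h + \<tau>)"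
        using s2 unfolding integral_cell_const by linarith
      moreover have "\<bar>?f x\<bar> \<le> ?C * sqrt (h + \<tau>)" for x using f[of x] s1 by linarith
      ultimately show "continuous_on UNIV ?f \<and> (\<forall>x. \<bar>?f x\<bar> \<le> ?C * sqrt (h + \<tau>)) \<and>
         integral (cbox 0 1) (\<lambda>x. \<bar>?f x\<bar>) \<le> ?C * (h + \<tau>)"
        using cf by blast
    qed
  qed
qed

theorem corollary2p7:
  fixes H :: "real ^ 'd \<Rightarrow> real"
    and g :: "real ^ 'd \<Rightarrow> real"
    and F :: "(real ^ 'd) \<times> (real ^ 'd) \<Rightarrow> real"
    and u :: "(real ^ 'd) \<times> real \<Rightarrow> real"
    and T R :: real
  assumes T: "T > 0"
    and H: "C2_fun H" "convex_on UNIV H" "filterlim H at_top at_infinity"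
    and g: "torus_periodic g" "\<exists>L. L-lipschitz_on UNIV g" "\<exists>C>0. semiconcave_with C g"
    and F: "C2_fun F" "convex_on UNIV F" "\<forall>p. F (- p, p) = H p"
    and R: "R > 0"
    and u: "viscosity_solution H g T u"
  shows "\<forall>p::ereal. 1 \<le> p \<longrightarrow>
    (\<exists>C>0. \<forall>(h::real) (\<Delta>t::real) (N::nat).
       h > 0 \<longrightarrow> \<Delta>t > 0 \<longrightarrow> N > 0 \<longrightarrow> real N * \<Delta>t = T \<longrightarrow>
       monotonicity_condition F R h \<Delta>t \<longrightarrow> datum_slopes_bounded R h g \<longrightarrow>
       (SUP n\<in>{0..N}. torus_Lp_norm p (\<lambda>x. fd_scheme F g h \<Delta>t n x - u (x, real n * \<Delta>t)))
         \<le> ennreal (C * (h + \<Delta>t) powr (1 / 2 + real_of_ereal (1 / (2 * p)))))"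
proof (intro allI impI)
  fix p :: ereal assume p: "1 \<le> p"
  obtain L where L: "L-lipschitz_on UNIV g" using g(2) by blast
  obtain c where c: "0 < c" "semiconcave_with c g" using g(3) by blast
  have FH: "F (- q, q) = H q" for q using F(3) by blast
  obtain C where C: "0 < C"
    "\<And>h \<tau> n. 0 < h \<Longrightarrow> 0 < \<tau> \<Longrightarrow> real n * \<tau> \<le> T \<Longrightarrow> monotonicity_condition F R h \<tau> \<Longrightarrow>
       datum_slopes_bounded R h g \<Longrightarrow>
       continuous_on UNIV (\<lambda>x. fd_scheme F g h \<tau> n x - u (x, real n * \<tau>)) \<and>
       (\<forall>x. \<bar>fd_scheme F g h \<tau> n x - u (x, real n * \<tau>)\<bar> \<le> C * sqrt (h + \<tau>)) \<and>
       integral (cbox 0 1) (\<lambda>x. \<bar>fd_scheme F g h \<tau> n x - u (x, real n * \<tau>)\<bar>) \<le> C * (h + \<tau>)"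
    using scheme_error_bounds[OF T g(1) L c(2,1) F(1,2) FH R u] by blast
  show "\<exists>C>0. \<forall>h \<Delta>t N. h > 0 \<longrightarrow> \<Delta>t > 0 \<longrightarrow> N > 0 \<longrightarrow> real N * \<Delta>t = T \<longrightarrow>
       monotonicity_condition F R h \<Delta>t \<longrightarrow> datum_slopes_bounded R h g \<longrightarrow>
       (SUP n\<in>{0..N}. torus_Lp_norm p (\<lambda>x. fd_scheme F g h \<Delta>t n x - u (x, real n * \<Delta>t)))
         \<le> ennreal (C * (h + \<Delta>t) powr (1 / 2 + real_of_ereal (1 / (2 * p))))"
  proof (intro exI[of _ C] conjI C(1) allI impI SUP_least)
    fix h \<tau> :: real and N n :: nat
    assume h: "0 < h" and \<tau>: "0 < \<tau>" and N: "0 < N" "real N * \<tau> = T"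
      and mc: "monotonicity_condition F R h \<tau>" "datum_slopes_bounded R h g" and n: "n \<in> {0..N}"
    have "real n * \<tau> \<le> real N * \<tau>" using n \<tau> by (intro mult_right_mono) auto
    then have "real n * \<tau> \<le> T" using N by simp
    from C(2)[OF h \<tau> this mc]
    show "torus_Lp_norm p (\<lambda>x. fd_scheme F g h \<tau> n x - u (x, real n * \<tau>))
        \<le> ennreal (C * (h + \<tau>) powr (1 / 2 + real_of_ereal (1 / (2 * p))))"
      using p C(1) h \<tau> by (intro torus_Lp_norm_le) auto
  qed
qed

end
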